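(* Let $k$ be a commutative ring and $S$ a finite painted set with $|S|\ge 3$ containing at least two white elements. Consider the following prescription for multiplying a generator $\mu(\tau)$ of $\mathcal{M}_S$ by a variable $l_\sigma$, where $\sigma$ is a painted stable 2-partition of $S$ and $\tau$ is a painted stable $S$-tree. (1) If $\sigma$ does not break $\tau$, then $l_\sigma\,\mu(\tau)=0$. (2) If $\sigma$ breaks $\tau$ at a vertex, then $l_\sigma\,\mu(\tau)=\mu(\sigma*\tau)$. (3) If $\sigma$ breaks $\tau$ at an edge $e$ with vertices $v_1,v_2$ and halves $e_1\in F_\tau(v_1)$, $e_2\in F_\tau(v_2)$, choose an arbitrary allowed quadruple of flags $I,J,K,L$ with $I\neq J$ in $F_\tau(v_1)\setminus\{e_1\}$ and $K\ne L$ in $F_\tau(v_2)\setminus\{e_2\}$, and put $$l_\sigma\,\mu(\tau)=-\sum_{\alpha:\ IJ\alpha e_1}\mu(\tau(\alpha))-\sum_{\beta:\ e_2\beta KL}\mu(\tau(\beta)),$$ where $\alpha$ (resp. $\beta$) runs over painted stable 2-partitions of $F_\tau(v_1)$ (resp. $F_\tau(v_2)$) with the indicated property. Then these formulas induce a well defined action of the ring $H^*_S=\mathcal{R}_S/I_S$ upon $H_{*S}=\mathcal{M}_S/J_S$. (In particular, the class modulo $J_S$ of the right hand side in (3) does not depend on the choice of $I,J,K,L$.)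
   Context: **Trees.** A graph $\tau$ consists of finite sets $V_\tau$ (vertices) and $F_\tau$ (flags, or half-edges), a map $F_\tau\to V_\tau$ assigning to each flag its vertex, and an involution of $F_\tau$. Two-element orbits of the involution are edges (the two flags are the halves of the edge); fixed flags are tails. $F_\tau(v)$ is the set of flags at $v$, $E_\tau$ the set of edges. A tree is a graph whose geometric realization is connected without loops. A painted set is a finite set $S$ partitioned into white and black elements. An $S$-tree is a tree with a bijection between $S$ and its set of tails (tails inherit colors); $S$-isomorphisms and $S$-morphisms are identical on $S$. An $S$-tree is painted stable if every vertex is incident to at least 3 flags and every vertex incident to at most one edge carries at least one white tail. **2-partitions.** All 2-partitions are unordered, into two non-empty parts. A 2-partition of a painted set is painted stable if each part has at least 2 elements and contains a white element. For a 2-partition $\sigma$ and subsets $S_1,S_2$, the notation $S_1\sigma S_2$ means that $S_1$ lies in one part of $\sigma$ and $S_2$ in the other (e.g. $ij\sigma kl$). For an edge $e$ of an $S$-tree $\tau$, $\sigma_e$ is the 2-partition of $S$ obtained by deleting the interior of $e$. Let $\sigma$ be painted stable and $\tau$ a painted stable $S$-tree. We say $\sigma$ breaks $\tau$ at the edge $e$ if $\sigma=\sigma_e$; $\sigma$ breaks $\tau$ at the vertex $v$ if there is a painted stable $S$-tree $\tau'$ and an $S$-morphism $\tau'\to\tau$ contracting one edge $e$ of $\tau'$ to the vertex $v$, with $\sigma=\sigma_e$; then $\tau'$ (unique up to $S$-isomorphism) is denoted $\sigma*\tau$. If neither happens, $\sigma$ does not break $\tau$. **Allowed quadruples.** An ordered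 quadruple of pairwise distinct $i,j,k,l\in S$ is allowed if both 2-partitions $\{i,j\}|\{k,l\}$ and $\{k,j\}|\{i,l\}$ of $\{i,j,k,l\}$ are painted stable. For a flag $f\in F_\tau(v)$, its branch is the connected component of (the geometric realization of) $\tau$ minus $v$ that starts with $f$; let $S_f\subset S$ be the set of labels of tails on this branch. A quadruple of flags $I,J,K,L$ is allowed if there are labels $i,j,k,l$ on the branches starting with $I,J,K,L$ respectively forming an allowed quadruple. (In (3) the branch of a flag is taken at its own vertex $v_1$ or $v_2$.) A 2-partition $\alpha$ of $F_\tau(v)$ induces a 2-partition $\sigma$ of $S$ (replace each flag $f$ by $S_f$); $\alpha$ is painted stable if both its parts contain at least two flags and the induced $\sigma$ is painted stable. Then $\sigma$ breaks $\tau$ at $v$ and we put $\tau(\alpha):=\sigma*\tau$. **Cohomology ring.** $\mathcal{R}_S=k[l_\sigma]$ is the polynomial ring on independent commuting variables indexed by painted stable 2-partitions $\sigma$ of $S$. $I_S\subset\mathcal{R}_S$ is the ideal generated by (a) for each allowed quadruple $i,j,k,l$, the element $R_{ijkl}=\sum_{\sigma:\,ij\sigma kl}l_\sigma-\sum_{\sigma:\,kj\sigma il}l_\sigma$; (b) the products $l_\sigma l_{\sigma'}$ for all $\sigma,\sigma'$ such that there is an allowed quadruple $i,j,k,l$ with $ij\sigma kl$ and $kj\sigma' il$. Put $H^*_S:=\mathcal{R}_S/I_S$. **Homology.** $\mathcal{M}_S=\bigoplus_\tau k\,\mu(\tau)$ is the free $k$-module on $S$-isomorphism classes of painted stable $S$-trees.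 $J_S\subset\mathcal{M}_S$ is the submodule spanned by the elements $\sum_{\alpha:\,IJ\alpha KL}\mu(\tau(\alpha))-\sum_{\alpha:\,KJ\alpha IL}\mu(\tau(\alpha))$ for all painted stable $S$-trees $\tau$, vertices $v$ of $\tau$, and allowed quadruples of flags $I,J,K,L\in F_\tau(v)$, where $\alpha$ runs over painted stable 2-partitions of $F_\tau(v)$. Put $H_{*S}:=\mathcal{M}_S/J_S$. *)

theory Defs
  imports
    "HOL-Algebra.QuotRing"
    "HOL-Algebra.Module"
    "HOL-Library.Poly_Mapping"
    "HOL-Library.Disjoint_Sets"
begin

section \<open>Painted sets and 2-partitions\<close>

text \<open>A painted set is given by a finite set \<open>S\<close> and its subset \<open>W\<close> of white elements;
  the black elements are those of \<open>S - W\<close>.\<close>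

definition two_partitions :: "'b set \<Rightarrow> 'b set set set" where
  "two_partitions X = {\<sigma>. partition_on X \<sigma> \<and> card \<sigma> = 2}"

definition stable_partitions :: "'a set \<Rightarrow> 'a set \<Rightarrow> 'a set set set" where
  "stable_partitions S W =
    {\<sigma> \<in> two_partitions S. \<forall>P\<in>\<sigma>. 2 \<le> card P \<and> P \<inter> W \<noteq> {}}"

definition separates :: "'b set set \<Rightarrow> 'b set \<Rightarrow> 'b set \<Rightarrow> bool" where
  "separates \<sigma> A B \<longleftrightarrow> (\<exists>P\<in>\<sigma>. \<exists>Q\<in>\<sigma>. P \<noteq> Q \<and> A \<subseteq> P \<and> B \<subseteq> Q)"

definition allowed :: "'a set \<Rightarrow> 'a set \<Rightarrow> 'a \<Rightarrow> 'a \<Rightarrow> 'a \<Rightarrow> 'a \<Rightarrow> bool" where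
  "allowed S W i j k l \<longleftrightarrow>
     {i, j, k, l} \<subseteq> S \<and> distinct [i, j, k, l] \<and>
     {{i, j}, {k, l}} \<in> stable_partitions {i, j, k, l} (W \<inter> {i, j, k, l}) \<and>
     {{k, j}, {i, l}} \<in> stable_partitions {i, j, k, l} (W \<inter> {i, j, k, l})"


section \<open>Trees\<close>

text \<open>Vertices and flags are taken from \<open>nat\<close>. Since they form finite sets and only isomorphism
  classes matter below, this is no restriction. The function \<open>lab\<close> is the bijection from \<open>S\<close> to
  the set of tails; \<open>base\<close>, \<open>opp\<close> and \<open>lab\<close> are irrelevant outside \<open>flags\<close> and \<open>S\<close>, respectively.\<close>

record 'a stree =
  verts :: "nat set"
  flags :: "nat set"
  base :: "nat \<Rightarrow> nat"
  opp :: "nat \<Rightarrow> nat"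
  lab :: "'a \<Rightarrow> nat"

definition is_graph :: "'a stree \<Rightarrow> bool" where
  "is_graph \<tau> \<longleftrightarrow> finite (verts \<tau>) \<and> finite (flags \<tau>) \<and>
     (\<forall>f\<in>flags \<tau>. base \<tau> f \<in> verts \<tau> \<and> opp \<tau> f \<in> flags \<tau> \<and> opp \<tau> (opp \<tau> f) = f)"

definition tails :: "'a stree \<Rightarrow> nat set" where
  "tails \<tau> = {f \<in> flags \<tau>. opp \<tau> f = f}"

definition halves :: "'a stree \<Rightarrow> nat set" where
  "halves \<tau> = {f \<in> flags \<tau>. opp \<tau> f \<noteq> f}"

definition edges :: "'a stree \<Rightarrow> nat set set" where
  "edges \<tau> = (\<lambda>f. {f, opp \<tau> f}) ` halves \<tau>"

definition flags_at :: "'a stree \<Rightarrow> nat \<Rightarrow> nat set" where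
  "flags_at \<tau> v = {f \<in> flags \<tau>. base \<tau> f = v}"

text \<open>Pairs of vertices joined by a path that runs only along edges whose halves lie in \<open>A\<close>.\<close>

definition joined :: "'a stree \<Rightarrow> nat set \<Rightarrow> (nat \<times> nat) set" where
  "joined \<tau> A = {(base \<tau> f, base \<tau> (opp \<tau> f)) | f. f \<in> halves \<tau> \<inter> A}\<^sup>*"

text \<open>A loop in the geometric realization: a nonempty cyclic sequence of half-edges \<open>fs\<close>, each
  starting at the vertex where the edge of its predecessor ends, that uses no edge twice.
  Length one and two give an edge with both halves at one vertex and a double edge, respectively.\<close>

definition is_loop :: "'a stree \<Rightarrow> nat list \<Rightarrow> bool" where
  "is_loop \<tau> fs \<longleftrightarrow> fs \<noteq> [] \<and> set fs \<subseteq> halves \<tau> \<and>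
     distinct (map (\<lambda>f. {f, opp \<tau> f}) fs) \<and>
     (\<forall>i < length fs. base \<tau> (opp \<tau> (fs ! i)) = base \<tau> (fs ! (Suc i mod length fs)))"

definition is_tree :: "'a stree \<Rightarrow> bool" where
  "is_tree \<tau> \<longleftrightarrow> is_graph \<tau> \<and> verts \<tau> \<noteq> {} \<and>
     (\<forall>u\<in>verts \<tau>. \<forall>v\<in>verts \<tau>. (u, v) \<in> joined \<tau> (flags \<tau>)) \<and>
     (\<nexists>fs. is_loop \<tau> fs)"

definition is_stree :: "'a set \<Rightarrow> 'a stree \<Rightarrow> bool" where
  "is_stree S \<tau> \<longleftrightarrow> is_tree \<tau> \<and> bij_betw (lab \<tau>) S (tails \<tau>)"

definition stable_trees :: "'a set \<Rightarrow> 'a set \<Rightarrow> 'a stree set" where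
  "stable_trees S W = {\<tau>. is_stree S \<tau> \<and>
     (\<forall>v\<in>verts \<tau>. 3 \<le> card (flags_at \<tau> v) \<and>
        (card {e \<in> edges \<tau>. e \<inter> flags_at \<tau> v \<noteq> {}} \<le> 1 \<longrightarrow> (\<exists>s\<in>W. lab \<tau> s \<in> flags_at \<tau> v)))}"

definition is_siso :: "'a set \<Rightarrow> 'a stree \<Rightarrow> 'a stree \<Rightarrow> (nat \<Rightarrow> nat) \<Rightarrow> (nat \<Rightarrow> nat) \<Rightarrow> bool" where
  "is_siso S \<tau> \<tau>' p q \<longleftrightarrow>
     bij_betw p (verts \<tau>) (verts \<tau>') \<and> bij_betw q (flags \<tau>) (flags \<tau>') \<and>
     (\<forall>f\<in>flags \<tau>. base \<tau>' (q f) = p (base \<tau> f) \<and> opp \<tau>' (q f) = q (opp \<tau> f)) \<and>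
     (\<forall>s\<in>S. q (lab \<tau> s) = lab \<tau>' s)"

definition siso_rel :: "'a set \<Rightarrow> 'a set \<Rightarrow> ('a stree \<times> 'a stree) set" where
  "siso_rel S W = {(\<tau>, \<tau>'). \<tau> \<in> stable_trees S W \<and> \<tau>' \<in> stable_trees S W \<and>
     (\<exists>p q. is_siso S \<tau> \<tau>' p q)}"

text \<open>A morphism \<open>\<tau>' \<rightarrow> \<tau>\<close> acts covariantly on vertices (\<open>p\<close>) and contravariantly on flags (\<open>q\<close>).
  The edges of \<open>\<tau>'\<close> whose halves are not in the image of \<open>q\<close> are contracted.\<close>

definition is_smorphism :: "'a set \<Rightarrow> 'a stree \<Rightarrow> 'a stree \<Rightarrow> (nat \<Rightarrow> nat) \<Rightarrow> (nat \<Rightarrow> nat) \<Rightarrow> bool" where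
  "is_smorphism S \<tau>' \<tau> p q \<longleftrightarrow>
     p ` verts \<tau>' = verts \<tau> \<and> inj_on q (flags \<tau>) \<and> q ` flags \<tau> \<subseteq> flags \<tau>' \<and>
     (\<forall>f\<in>flags \<tau>. p (base \<tau>' (q f)) = base \<tau> f \<and> opp \<tau>' (q f) = q (opp \<tau> f)) \<and>
     (\<forall>u\<in>verts \<tau>'. \<forall>v\<in>verts \<tau>'. p u = p v \<longleftrightarrow> (u, v) \<in> joined \<tau>' (flags \<tau>' - q ` flags \<tau>)) \<and>
     (\<forall>s\<in>S. q (lab \<tau> s) = lab \<tau>' s)"


section \<open>Breaking a tree\<close>

text \<open>The partition \<open>\<sigma>\<^sub>e\<close> for the edge \<open>e = {f, opp \<tau> f}\<close>: two labels belong to the same part iff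
  their tails are connected after deletion of the interior of \<open>e\<close>.\<close>

definition edge_partition :: "'a set \<Rightarrow> 'a stree \<Rightarrow> nat \<Rightarrow> 'a set set" where
  "edge_partition S \<tau> f = S // {(s, t). s \<in> S \<and> t \<in> S \<and>
     (base \<tau> (lab \<tau> s), base \<tau> (lab \<tau> t)) \<in> joined \<tau> (flags \<tau> - {f, opp \<tau> f})}"

definition breaks_at_edge :: "'a set \<Rightarrow> 'a set set \<Rightarrow> 'a stree \<Rightarrow> nat \<Rightarrow> bool" where
  "breaks_at_edge S \<sigma> \<tau> f \<longleftrightarrow> f \<in> halves \<tau> \<and> \<sigma> = edge_partition S \<tau> f"

text \<open>\<open>\<tau>'\<close> witnesses that \<open>\<sigma>\<close> breaks \<open>\<tau>\<close> at the vertex \<open>v\<close>.\<close>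

definition vertex_breaking :: "'a set \<Rightarrow> 'a set \<Rightarrow> 'a set set \<Rightarrow> 'a stree \<Rightarrow> nat \<Rightarrow> 'a stree \<Rightarrow> bool" where
  "vertex_breaking S W \<sigma> \<tau> v \<tau>' \<longleftrightarrow> \<tau>' \<in> stable_trees S W \<and>
     (\<exists>p q. \<exists>f\<in>halves \<tau>'. is_smorphism S \<tau>' \<tau> p q \<and>
        flags \<tau>' - q ` flags \<tau> = {f, opp \<tau>' f} \<and> p (base \<tau>' f) = v \<and>
        \<sigma> = edge_partition S \<tau>' f)"

definition breaks_at_vertex :: "'a set \<Rightarrow> 'a set \<Rightarrow> 'a set set \<Rightarrow> 'a stree \<Rightarrow> nat \<Rightarrow> bool" where
  "breaks_at_vertex S W \<sigma> \<tau> v \<longleftrightarrow> v \<in> verts \<tau> \<and> (\<exists>\<tau>'. vertex_breaking S W \<sigma> \<tau> v \<tau>')"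

text \<open>The tree \<open>\<sigma> * \<tau>\<close>, which is determined only up to \<open>S\<close>-isomorphism.\<close>

definition star :: "'a set \<Rightarrow> 'a set \<Rightarrow> 'a set set \<Rightarrow> 'a stree \<Rightarrow> 'a stree" where
  "star S W \<sigma> \<tau> = (SOME \<tau>'. \<exists>v\<in>verts \<tau>. vertex_breaking S W \<sigma> \<tau> v \<tau>')"

text \<open>The set \<open>S\<^sub>f\<close> of labels on the branch of \<open>f\<close> at its own vertex \<open>v = base \<tau> f\<close>: the branch
  consists of the tail \<open>f\<close> only, or it contains the flags at all vertices that can be reached from
  the other end of the edge of \<open>f\<close> without passing through \<open>v\<close>.\<close>

definition branch_labels :: "'a set \<Rightarrow> 'a stree \<Rightarrow> nat \<Rightarrow> 'a set" where
  "branch_labels S \<tau> f = (if f \<in> tails \<tau> then {s \<in> S. lab \<tau> s = f}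
     else {s \<in> S. (base \<tau> (opp \<tau> f), base \<tau> (lab \<tau> s)) \<in>
       joined \<tau> {g. base \<tau> g \<noteq> base \<tau> f \<and> base \<tau> (opp \<tau> g) \<noteq> base \<tau> f}})"

text \<open>The flags of an allowed quadruple are pairwise distinct, like the labels. (Labels on one
  and the same branch would otherwise make quadruples with \<open>I = J\<close> allowed.)\<close>

definition allowed_flags :: "'a set \<Rightarrow> 'a set \<Rightarrow> 'a stree \<Rightarrow> nat \<Rightarrow> nat \<Rightarrow> nat \<Rightarrow> nat \<Rightarrow> bool" where
  "allowed_flags S W \<tau> I J K L \<longleftrightarrow> distinct [I, J, K, L] \<and>
     (\<exists>i\<in>branch_labels S \<tau> I. \<exists>j\<in>branch_labels S \<tau> J.
      \<exists>k\<in>branch_labels S \<tau> K. \<exists>l\<in>branch_labels S \<tau> L. allowed S W i j k l)"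

definition induced_partition :: "'a set \<Rightarrow> 'a stree \<Rightarrow> nat set set \<Rightarrow> 'a set set" where
  "induced_partition S \<tau> \<alpha> = (\<lambda>P. \<Union>f\<in>P. branch_labels S \<tau> f) ` \<alpha>"

definition stable_flag_partitions :: "'a set \<Rightarrow> 'a set \<Rightarrow> 'a stree \<Rightarrow> nat \<Rightarrow> nat set set set" where
  "stable_flag_partitions S W \<tau> v = {\<alpha> \<in> two_partitions (flags_at \<tau> v).
     (\<forall>P\<in>\<alpha>. 2 \<le> card P) \<and> induced_partition S \<tau> \<alpha> \<in> stable_partitions S W}"

definition split_tree :: "'a set \<Rightarrow> 'a set \<Rightarrow> 'a stree \<Rightarrow> nat set set \<Rightarrow> 'a stree" where
  "split_tree S W \<tau> \<alpha> = star S W (induced_partition S \<tau> \<alpha>) \<tau>"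


section \<open>The ring of cohomology\<close>

text \<open>The commutative ground ring \<open>k\<close> is a type of sort \<open>{comm_ring, comm_monoid_mult}\<close>: this is
  \<open>comm_ring_1\<close> without the axiom \<open>0 \<noteq> 1\<close>, so that the zero ring is included.\<close>

definition ground_ring :: "'k::{comm_ring,comm_monoid_mult} ring" where
  "ground_ring = \<lparr>carrier = UNIV, mult = (*), one = 1, zero = 0, add = (+)\<rparr>"

type_synonym ('a, 'k) poly = "('a set set \<Rightarrow>\<^sub>0 nat) \<Rightarrow>\<^sub>0 'k"

definition const :: "'k::{comm_ring,comm_monoid_mult} \<Rightarrow> ('a, 'k) poly" where
  "const c = Poly_Mapping.single 0 c"

definition var :: "'a set set \<Rightarrow> ('a, 'k::{comm_ring,comm_monoid_mult}) poly" where
  "var \<sigma> = Poly_Mapping.single (Poly_Mapping.single \<sigma> 1) 1"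

definition poly_ring :: "'a set \<Rightarrow> 'a set \<Rightarrow> ('a, 'k::{comm_ring,comm_monoid_mult}) poly ring" where
  "poly_ring S W =
     \<lparr>carrier = {p. \<forall>m\<in>Poly_Mapping.keys p. Poly_Mapping.keys m \<subseteq> stable_partitions S W},
      mult = (*), one = const 1, zero = 0, add = (+)\<rparr>"

definition linear_relation ::
    "'a set \<Rightarrow> 'a set \<Rightarrow> 'a \<Rightarrow> 'a \<Rightarrow> 'a \<Rightarrow> 'a \<Rightarrow> ('a, 'k::{comm_ring,comm_monoid_mult}) poly" where
  "linear_relation S W i j k l =
     (\<Sum>\<sigma> \<in> {\<sigma> \<in> stable_partitions S W. separates \<sigma> {i, j} {k, l}}. var \<sigma>) -
     (\<Sum>\<sigma> \<in> {\<sigma> \<in> stable_partitions S W. separates \<sigma> {k, j} {i, l}}. var \<sigma>)"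

definition ring_relations :: "'a set \<Rightarrow> 'a set \<Rightarrow> ('a, 'k::{comm_ring,comm_monoid_mult}) poly set" where
  "ring_relations S W =
     {linear_relation S W i j k l | i j k l. allowed S W i j k l} \<union>
     {var \<sigma> * var \<sigma>' | \<sigma> \<sigma>'. \<sigma> \<in> stable_partitions S W \<and> \<sigma>' \<in> stable_partitions S W \<and>
        (\<exists>i j k l. allowed S W i j k l \<and> separates \<sigma> {i, j} {k, l} \<and> separates \<sigma>' {k, j} {i, l})}"

definition ring_ideal :: "'a set \<Rightarrow> 'a set \<Rightarrow> ('a, 'k::{comm_ring,comm_monoid_mult}) poly set" where
  "ring_ideal S W = Idl\<^bsub>poly_ring S W\<^esub> (ring_relations S W)"

definition cohomology :: "'a set \<Rightarrow> 'a set \<Rightarrow> ('a, 'k::{comm_ring,comm_monoid_mult}) poly set ring" where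
  "cohomology S W = poly_ring S W Quot ring_ideal S W"

definition coh_class :: "'a set \<Rightarrow> 'a set \<Rightarrow> ('a, 'k::{comm_ring,comm_monoid_mult}) poly \<Rightarrow> ('a, 'k) poly set" where
  "coh_class S W p = ring_ideal S W +>\<^bsub>poly_ring S W\<^esub> p"


section \<open>The homology module\<close>

text \<open>The locale \<open>module\<close> ignores the ring fields \<open>mult\<close> and \<open>one\<close> of a module record.\<close>

type_synonym ('a, 'k) chain = "'a stree set \<Rightarrow>\<^sub>0 'k"

definition mu :: "'a set \<Rightarrow> 'a set \<Rightarrow> 'a stree \<Rightarrow> ('a, 'k::{comm_ring,comm_monoid_mult}) chain" where
  "mu S W \<tau> = Poly_Mapping.single (siso_rel S W `` {\<tau>}) 1"

definition chain_module :: "'a set \<Rightarrow> 'a set \<Rightarrow> ('k::{comm_ring,comm_monoid_mult}, ('a, 'k) chain) module" where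
  "chain_module S W =
     \<lparr>carrier = {x. Poly_Mapping.keys x \<subseteq> stable_trees S W // siso_rel S W},
      mult = undefined, one = undefined, zero = 0, add = (+),
      smult = (\<lambda>c. Poly_Mapping.map ((*) c))\<rparr>"

definition chain_relations :: "'a set \<Rightarrow> 'a set \<Rightarrow> ('a, 'k::{comm_ring,comm_monoid_mult}) chain set" where
  "chain_relations S W =
     {(\<Sum>\<alpha> \<in> {\<alpha> \<in> stable_flag_partitions S W \<tau> v. separates \<alpha> {I, J} {K, L}}. mu S W (split_tree S W \<tau> \<alpha>)) -
      (\<Sum>\<alpha> \<in> {\<alpha> \<in> stable_flag_partitions S W \<tau> v. separates \<alpha> {K, J} {I, L}}. mu S W (split_tree S W \<tau> \<alpha>))
      | \<tau> v I J K L. \<tau> \<in> stable_trees S W \<and> v \<in> verts \<tau> \<and>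
          {I, J, K, L} \<subseteq> flags_at \<tau> v \<and> allowed_flags S W \<tau> I J K L}"

definition chain_submodule :: "'a set \<Rightarrow> 'a set \<Rightarrow> ('a, 'k::{comm_ring,comm_monoid_mult}) chain set" where
  "chain_submodule S W =
     \<Inter>{N. submodule N ground_ring (chain_module S W :: ('k, ('a, 'k) chain) module) \<and>
         chain_relations S W \<subseteq> N}"

definition quotient_module :: "('r, 'b) module \<Rightarrow> 'b set \<Rightarrow> ('r, 'b set) module" where
  "quotient_module M N =
     \<lparr>carrier = a_rcosets\<^bsub>M\<^esub> N, mult = undefined, one = undefined, zero = N, add = set_add M,
      smult = (\<lambda>c X. \<Union>x\<in>X. N +>\<^bsub>M\<^esub> (c \<odot>\<^bsub>M\<^esub> x))\<rparr>"

definition homology :: "'a set \<Rightarrow> 'a set \<Rightarrow> ('k::{comm_ring,comm_monoid_mult}, ('a, 'k) chain set) module" where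
  "homology S W = quotient_module (chain_module S W) (chain_submodule S W)"

definition hom_class :: "'a set \<Rightarrow> 'a set \<Rightarrow> ('a, 'k::{comm_ring,comm_monoid_mult}) chain \<Rightarrow> ('a, 'k) chain set" where
  "hom_class S W x = chain_submodule S W +>\<^bsub>(chain_module S W :: ('k, ('a, 'k) chain) module)\<^esub> x"


section \<open>The prescription and the action\<close>

text \<open>\<open>prescribed S W \<sigma> \<tau> x\<close>: the element \<open>x\<close> is a value that the prescription allows for the product
  of \<open>l\<^sub>\<sigma>\<close> and \<open>\<mu>(\<tau>)\<close>. The third rule has one value for each choice of the edge, of the order of
  its halves, and of the quadruple.\<close>

inductive prescribed ::
    "'a set \<Rightarrow> 'a set \<Rightarrow> 'a set set \<Rightarrow> 'a stree \<Rightarrow> ('a, 'k::{comm_ring,comm_monoid_mult}) chain \<Rightarrow> bool"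
  for S W \<sigma> \<tau> where
  no_break: "prescribed S W \<sigma> \<tau> 0"
    if "\<nexists>f. breaks_at_edge S \<sigma> \<tau> f" and "\<nexists>v. breaks_at_vertex S W \<sigma> \<tau> v"
| at_vertex: "prescribed S W \<sigma> \<tau> (mu S W (star S W \<sigma> \<tau>))"
    if "breaks_at_vertex S W \<sigma> \<tau> v"
| at_edge: "prescribed S W \<sigma> \<tau>
      (- (\<Sum>\<alpha> \<in> {\<alpha> \<in> stable_flag_partitions S W \<tau> v1. separates \<alpha> {I, J} {e1}}. mu S W (split_tree S W \<tau> \<alpha>))
       - (\<Sum>\<beta> \<in> {\<beta> \<in> stable_flag_partitions S W \<tau> v2. separates \<beta> {e2} {K, L}}. mu S W (split_tree S W \<tau> \<beta>)))"
    if "breaks_at_edge S \<sigma> \<tau> e1" and "e2 = opp \<tau> e1"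
      and "v1 = base \<tau> e1" and "v2 = base \<tau> e2"
      and "I \<in> flags_at \<tau> v1 - {e1}" and "J \<in> flags_at \<tau> v1 - {e1}" and "I \<noteq> J"
      and "K \<in> flags_at \<tau> v2 - {e2}" and "L \<in> flags_at \<tau> v2 - {e2}" and "K \<noteq> L"
      and "allowed_flags S W \<tau> I J K L"

definition replace_smult :: "('r, 'b) module \<Rightarrow> ('s \<Rightarrow> 'b \<Rightarrow> 'b) \<Rightarrow> ('s, 'b) module" where
  "replace_smult M act =
     \<lparr>carrier = carrier M, mult = mult M, one = one M, zero = zero M, add = add M, smult = act\<rparr>"

text \<open>\<open>act\<close> makes the homology group a module over the cohomology ring, compatibly with the given
  \<open>k\<close>-module structure (it is the \<open>k\<close>-linear extension of the prescription on generators), and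
  it satisfies the prescription for every admissible choice.\<close>

definition induced_action :: "'a set \<Rightarrow> 'a set \<Rightarrow>
    (('a, 'k::{comm_ring,comm_monoid_mult}) poly set \<Rightarrow> ('a, 'k) chain set \<Rightarrow> ('a, 'k) chain set) \<Rightarrow> bool" where
  "induced_action S W act \<longleftrightarrow>
     module (cohomology S W) (replace_smult (homology S W :: ('k, ('a, 'k) chain set) module) act) \<and>
     (\<forall>c. \<forall>X \<in> carrier (homology S W :: ('k, ('a, 'k) chain set) module).
        act (coh_class S W (const c)) X = c \<odot>\<^bsub>homology S W\<^esub> X) \<and>
     (\<forall>\<sigma> \<in> stable_partitions S W. \<forall>\<tau> \<in> stable_trees S W. \<forall>x. prescribed S W \<sigma> \<tau> x \<longrightarrow>
        act (coh_class S W (var \<sigma>)) (hom_class S W (mu S W \<tau>)) = hom_class S W x)"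

end

theory Submission
  imports Defs
begin

text \<open>
  A painted stable tree is determined by the set \<open>T\<close> of 2-partitions (splits) induced by its edges,
  and the sets arising in this way are exactly the sets of pairwise compatible stable splits, where
  \<open>\<sigma> = {P, P'}\<close> and \<open>\<rho> = {Q, Q'}\<close> are compatible iff one of the four intersections is empty. In these
  terms \<open>\<sigma>\<close> breaks the tree at a vertex iff \<open>\<sigma>\<close> is compatible with \<open>T\<close> but not in it, and
  \<open>\<sigma> * \<tau>\<close> corresponds to \<open>T \<union> {\<sigma>}\<close>.

  Write \<open>c(\<rho>) = [ij\<rho>kl] - [kj\<rho>il]\<close> for an allowed quadruple. The relations of the homology module are
  \<open>\<Sum>\<^sub>\<rho> c(\<rho>) \<mu>(T \<union> {\<rho>})\<close> for the quadruples that no split in \<open>T\<close> separates into two pairs, and rule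
  (3) reads \<open>l\<^sub>\<sigma> \<mu>(T) = - \<Sum>\<^sub>\<rho> c(\<rho>) \<mu>(T \<union> {\<rho>})\<close> for a quadruple with \<open>ij\<sigma>kl\<close> that no other split in
  \<open>T\<close> separates. Hence \<open>c\<close> restricts to the indicator function of \<open>\<sigma>\<close> on \<open>T\<close>, as for the linear functions
  on a unimodular cone of a toric fan. The combinatorial heart is that
  \<open>\<Sum>\<^sub>\<rho> c(\<rho>) l\<^sub>\<rho> \<mu>(T)\<close> vanishes in homology for \<^emph>\<open>every\<close> allowed quadruple and every \<open>T\<close>; commutativity and
  compatibility with the relations then follow formally, as for Chow groups of smooth toric varieties.
\<close>

section \<open>Bridges and sides\<close>

text \<open>The obstacle is that little holds exactly for chains: rule (3) involves an arbitrary
  quadruple, and the operators of the variables commute only modulo the relations. One quadruple is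
  therefore fixed for each family and member, the operators are defined on chains with these
  choices, and the rest is proved modulo \<open>chain_submodule\<close>. The work lies in the
  relation at quadruples that the family does separate, because there terms of rule (3) enter. Such
  a quadruple is cut at labels between the separating splits until each piece is separated by one
  split only; a piece is then a legitimate choice for rule (3), and two choices are connected by
  moves exchanging one label. Colours restrict the moves: each must come from an allowed quadruple,
  so intermediate pairs need white labels at the right places. Commutativity then follows by
  applying the relation to a family enlarged by one split. The submodule is stable under the
  operators because each of its generators is itself the value of such a relation at a basis
  element.\<close>

definition side :: "'a stree \<Rightarrow> nat \<Rightarrow> nat set" where
  "side \<tau> f = {u. f \<in> halves \<tau> \<and> (base \<tau> (opp \<tau> f), u) \<in> joined \<tau> (flags \<tau> - {f, opp \<tau> f})}"

lemma joined_refl [simp]: "(u, u) \<in> joined \<tau> A"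
  by (simp add: joined_def)

lemma joined_trans: "(u, v) \<in> joined \<tau> A \<Longrightarrow> (v, w) \<in> joined \<tau> A \<Longrightarrow> (u, w) \<in> joined \<tau> A"
  unfolding joined_def by (rule rtrancl_trans)

lemma joined_edge: "f \<in> halves \<tau> \<Longrightarrow> f \<in> A \<Longrightarrow> (base \<tau> f, base \<tau> (opp \<tau> f)) \<in> joined \<tau> A"
  unfolding joined_def by blast

lemma joined_mono:
  assumes "halves \<tau> \<inter> A \<subseteq> B" shows "joined \<tau> A \<subseteq> joined \<tau> B"
  unfolding joined_def by (rule rtrancl_mono) (use assms in blast)

lemma joined_induct [consumes 1, case_names refl edge]:
  assumes "(u, v) \<in> joined \<tau> A" and "P u"
    and "\<And>f. f \<in> halves \<tau> \<Longrightarrow> f \<in> A \<Longrightarrow> (u, base \<tau> f) \<in> joined \<tau> A \<Longrightarrow> P (base \<tau> f) \<Longrightarrow>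
      P (base \<tau> (opp \<tau> f))"
  shows "P v"
  using assms(1) unfolding joined_def
  by (induction rule: rtrancl_induct) (use assms(2,3) in \<open>auto simp: joined_def\<close>)

lemma halves_iff: "f \<in> halves \<tau> \<longleftrightarrow> f \<in> flags \<tau> \<and> opp \<tau> f \<noteq> f"
  by (auto simp: halves_def)

lemma graph_opp:
  assumes "is_graph \<tau>" "f \<in> flags \<tau>"
  shows "opp \<tau> f \<in> flags \<tau>" "opp \<tau> (opp \<tau> f) = f" "base \<tau> f \<in> verts \<tau>"
  using assms by (auto simp: is_graph_def)

lemma graph_half:
  assumes "is_graph \<tau>" "f \<in> halves \<tau>"
  shows "opp \<tau> f \<in> halves \<tau>" "opp \<tau> (opp \<tau> f) = f" "base \<tau> f \<in> verts \<tau>" "opp \<tau> f \<noteq> f"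
    "base \<tau> (opp \<tau> f) \<in> verts \<tau>" "f \<in> flags \<tau>" "opp \<tau> f \<in> flags \<tau>"
  using assms by (auto simp: is_graph_def halves_def)

lemma joined_sym:
  assumes "is_graph \<tau>" and "\<And>f. f \<in> halves \<tau> \<Longrightarrow> f \<in> A \<Longrightarrow> opp \<tau> f \<in> A"
    and "(u, v) \<in> joined \<tau> A"
  shows "(v, u) \<in> joined \<tau> A"
  using assms(3)
proof (induction rule: joined_induct)
  case (edge f)
  then have "(base \<tau> (opp \<tau> f), base \<tau> f) \<in> joined \<tau> A"
    using joined_edge[of "opp \<tau> f" \<tau> A] graph_half[OF assms(1), of f] assms(2) by auto
  then show ?case using edge joined_trans by metis
qed simp

lemma joined_verts:
  assumes "is_graph \<tau>" "(u, v) \<in> joined \<tau> A" "u \<in> verts \<tau>" shows "v \<in> verts \<tau>"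
  using assms(2) by (induction rule: joined_induct) (use assms graph_half in auto)

section \<open>Walks and trails; absence of loops as the statement that every edge is a
  bridge\<close>

fun walk :: "'a stree \<Rightarrow> nat \<Rightarrow> nat list \<Rightarrow> nat \<Rightarrow> bool" where
  "walk \<tau> u [] v \<longleftrightarrow> u = v"
| "walk \<tau> u (f # fs) v \<longleftrightarrow> f \<in> halves \<tau> \<and> base \<tau> f = u \<and> walk \<tau> (base \<tau> (opp \<tau> f)) fs v"

lemma walk_append: "walk \<tau> u (fs @ gs) v \<longleftrightarrow> (\<exists>w. walk \<tau> u fs w \<and> walk \<tau> w gs v)"
  by (induction fs arbitrary: u) auto

lemma walk_halves: "walk \<tau> u fs v \<Longrightarrow> set fs \<subseteq> halves \<tau>"
  by (induction fs arbitrary: u) auto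

lemma walk_nth:
  "walk \<tau> u fs v \<Longrightarrow> i < length fs \<Longrightarrow>
    base \<tau> (opp \<tau> (fs ! i)) = (if Suc i < length fs then base \<tau> (fs ! Suc i) else v)"
proof (induction fs arbitrary: u i)
  case (Cons f fs)
  show ?case
  proof (cases i)
    case 0
    then show ?thesis using Cons.prems by (cases fs) auto
  next
    case (Suc j)
    then show ?thesis using Cons.prems Cons.IH[of "base \<tau> (opp \<tau> f)" j] by auto
  qed
qed simp

lemma joined_walk:
  assumes "(u, v) \<in> joined \<tau> A" shows "\<exists>fs. walk \<tau> u fs v \<and> set fs \<subseteq> A"
  using assms
  proof (induction rule: joined_induct)
    case refl
    have "walk \<tau> u [] u" by simp
    then show ?case by (metis empty_set empty_subsetI)
  next
    case (edge f)
    then obtain fs where "walk \<tau> u fs (base \<tau> f)" "set fs \<subseteq> A" by auto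
    then have "walk \<tau> u (fs @ [f]) (base \<tau> (opp \<tau> f)) \<and> set (fs @ [f]) \<subseteq> A"
      using edge by (auto simp: walk_append)
    then show ?case by blast
qed

text \<open>A shortest walk uses no edge twice: a repetition in the same direction can be cut out up
  to the second use, a repetition in the opposite direction together with both uses.\<close>

lemma joined_trail:
  assumes g: "is_graph \<tau>" and "(u, v) \<in> joined \<tau> A"
  shows "\<exists>fs. walk \<tau> u fs v \<and> set fs \<subseteq> A \<and> distinct (map (\<lambda>f. {f, opp \<tau> f}) fs)"
proof -
  let ?P = "\<lambda>fs. walk \<tau> u fs v \<and> set fs \<subseteq> A"
  obtain fs where fs: "?P fs" and min: "\<And>gs. ?P gs \<Longrightarrow> length fs \<le> length gs"
    using ex_has_least_nat[of ?P _ length] joined_walk[OF assms(2)] by metis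
  have "distinct (map (\<lambda>f. {f, opp \<tau> f}) fs)"
  proof (rule ccontr)
    assume "\<not> ?thesis"
    then obtain i j where ij: "i < j" "j < length fs"
      "{fs ! i, opp \<tau> (fs ! i)} = {fs ! j, opp \<tau> (fs ! j)}"
      by (fastforce simp: distinct_conv_nth neq_iff)
    have fg: "fs ! i \<in> halves \<tau>" "fs ! j \<in> halves \<tau>" using walk_halves fs ij by fastforce+
    obtain w where w: "walk \<tau> u (take i fs) w" "walk \<tau> w (drop i fs) v"
      using fs walk_append[of \<tau> u "take i fs" "drop i fs" v] by auto
    obtain w' where w': "walk \<tau> w' (drop j fs) v"
      using fs walk_append[of \<tau> u "take j fs" "drop j fs" v] by auto
    have d: "drop i fs = fs ! i # drop (Suc i) fs" "drop j fs = fs ! j # drop (Suc j) fs"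
      using ij by (auto simp: Cons_nth_drop_Suc)
    have sub: "set (take i fs) \<subseteq> A" "set (drop j fs) \<subseteq> A" "set (drop (Suc j) fs) \<subseteq> A"
      using fs set_take_subset set_drop_subset by fast+
    have wb: "w = base \<tau> (fs ! i)" "w' = base \<tau> (fs ! j)"
      "walk \<tau> (base \<tau> (opp \<tau> (fs ! j))) (drop (Suc j) fs) v"
      using w(2) w' by (simp_all add: d)
    have "fs ! j = fs ! i \<or> fs ! j = opp \<tau> (fs ! i)"
      using ij(3) by (auto simp: doubleton_eq_iff)
    then show False
    proof
      assume "fs ! j = fs ! i"
      then have "?P (take i fs @ drop j fs)" using w w' wb sub by (auto simp: walk_append)
      then show False using min[of "take i fs @ drop j fs"] ij by simp
    next
      assume "fs ! j = opp \<tau> (fs ! i)"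
      then have "base \<tau> (opp \<tau> (fs ! j)) = w" using graph_half[OF g fg(1)] wb by simp
      then have "?P (take i fs @ drop (Suc j) fs)" using w wb sub by (auto simp: walk_append)
      then show False using min[of "take i fs @ drop (Suc j) fs"] ij by simp
    qed
  qed
  then show ?thesis using fs by blast
qed

text \<open>A trail joining the ends of \<open>f\<close> without using its edge would close up with
  that edge to a loop.\<close>

lemma tree_bridge:
  assumes "is_tree \<tau>" and f: "f \<in> halves \<tau>"
  shows "(base \<tau> f, base \<tau> (opp \<tau> f)) \<notin> joined \<tau> (flags \<tau> - {f, opp \<tau> f})"
proof
  assume "(base \<tau> f, base \<tau> (opp \<tau> f)) \<in> joined \<tau> (flags \<tau> - {f, opp \<tau> f})"
  moreover have g: "is_graph \<tau>" and nl: "\<nexists>fs. is_loop \<tau> fs" using assms by (auto simp: is_tree_def)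
  ultimately obtain fs where fs: "walk \<tau> (base \<tau> f) fs (base \<tau> (opp \<tau> f))"
    "set fs \<subseteq> flags \<tau> - {f, opp \<tau> f}" "distinct (map (\<lambda>f. {f, opp \<tau> f}) fs)"
    using joined_trail by metis
  note h = graph_half[OF g f]
  \<comment> \<open>Going back over the edge and then along the trail gives a closed walk at the far
    end of \<open>f\<close>; the trail avoids both halves, so no edge repeats.\<close>
  let ?c = "opp \<tau> f # fs"
  have w: "walk \<tau> (base \<tau> (opp \<tau> f)) ?c (base \<tau> (opp \<tau> f))" using fs h by simp
  have "is_loop \<tau> ?c"
    unfolding is_loop_def
  proof (intro conjI allI impI)
    show "distinct (map (\<lambda>f. {f, opp \<tau> f}) ?c)" using fs(2,3) h by (auto simp: doubleton_eq_iff)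
    show "set ?c \<subseteq> halves \<tau>" using walk_halves[OF w] .
    fix i assume i: "i < length ?c"
    show "base \<tau> (opp \<tau> (?c ! i)) = base \<tau> (?c ! (Suc i mod length ?c))"
    proof (cases "Suc i < length ?c")
      case True
      then show ?thesis using walk_nth[OF w i] by simp
    next
      case False
      then have "Suc i = length ?c" using i by simp
      then show ?thesis using walk_nth[OF w i] by (metis False mod_self nth_Cons_0)
    qed
  qed simp
  then show False using nl by blast
qed

text \<open>Going around a loop the long way joins the ends of its first edge without that edge.
  This converse of \<open>tree_bridge\<close> is the criterion by which the graph built below is
  recognized as a tree.\<close>

lemma no_loop_if_bridges:
  assumes g: "is_graph \<tau>"
    and br: "\<And>f. f \<in> halves \<tau> \<Longrightarrow>
      (base \<tau> f, base \<tau> (opp \<tau> f)) \<notin> joined \<tau> (flags \<tau> - {f, opp \<tau> f})"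
  shows "\<not> is_loop \<tau> fs"
proof
  assume l: "is_loop \<tau> fs"
  define f where "f = fs ! 0"
  let ?A = "flags \<tau> - {f, opp \<tau> f}"
  from l have ne: "fs \<noteq> []" and sub: "set fs \<subseteq> halves \<tau>"
    and dist: "distinct (map (\<lambda>f. {f, opp \<tau> f}) fs)"
    and nxt: "\<And>i. i < length fs \<Longrightarrow> base \<tau> (opp \<tau> (fs ! i)) = base \<tau> (fs ! (Suc i mod length fs))"
    unfolding is_loop_def by blast+
  have f: "f \<in> halves \<tau>" using ne sub by (auto simp: f_def)
  have to_end: "(base \<tau> (opp \<tau> f), base \<tau> (opp \<tau> (fs ! i))) \<in> joined \<tau> ?A" if "i < length fs" for i
    using that
  proof (induction i)
    case 0
    then show ?case by (simp add: f_def)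
  next
    case (Suc i)
    have h: "fs ! Suc i \<in> halves \<tau>" using Suc sub by auto
    have "{fs ! Suc i, opp \<tau> (fs ! Suc i)} \<noteq> {f, opp \<tau> f}"
      using dist Suc.prems ne by (auto simp: distinct_conv_nth f_def)
    then have "fs ! Suc i \<in> ?A" using h f graph_half[OF g] by auto
    then have "(base \<tau> (fs ! Suc i), base \<tau> (opp \<tau> (fs ! Suc i))) \<in> joined \<tau> ?A"
      by (rule joined_edge[OF h])
    moreover have "base \<tau> (opp \<tau> (fs ! i)) = base \<tau> (fs ! Suc i)"
      using nxt[OF Suc_lessD[OF Suc.prems]] unfolding mod_less[OF Suc.prems] .
    ultimately have st: "(base \<tau> (opp \<tau> (fs ! i)), base \<tau> (opp \<tau> (fs ! Suc i))) \<in> joined \<tau> ?A"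
      by metis
    have "(base \<tau> (opp \<tau> f), base \<tau> (opp \<tau> (fs ! i))) \<in> joined \<tau> ?A"
      using Suc by simp
    then show ?case using st by (rule joined_trans)
  qed
  obtain n where n: "length fs = Suc n" using ne by (cases fs) auto
  have "base \<tau> (opp \<tau> (fs ! n)) = base \<tau> f"
    using nxt[of n] unfolding n mod_self f_def by blast
  then have "(base \<tau> (opp \<tau> f), base \<tau> f) \<in> joined \<tau> ?A"
    using to_end[of n] n by simp
  then have "(base \<tau> f, base \<tau> (opp \<tau> f)) \<in> joined \<tau> ?A"
    using joined_sym[OF g, of ?A "base \<tau> (opp \<tau> f)" "base \<tau> f"] graph_half[OF g]
    by (metis Diff_iff f empty_iff insert_iff)
  then show False using br f by blast
qed

section \<open>The two sides of an edge of a tree\<close>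

locale tree =
  fixes \<tau> :: "'a stree"
  assumes is_tree: "is_tree \<tau>"
begin

lemma graph: "is_graph \<tau>"
  using is_tree by (simp add: is_tree_def)

lemmas half [simp] = graph_half[OF graph]

lemma finite_flags: "finite (flags \<tau>)" and finite_verts: "finite (verts \<tau>)"
  using graph by (auto simp: is_graph_def)

lemma base_verts [simp]: "f \<in> flags \<tau> \<Longrightarrow> base \<tau> f \<in> verts \<tau>"
  using graph by (auto simp: is_graph_def)

lemma side_verts: "side \<tau> f \<subseteq> verts \<tau>"
  unfolding side_def using joined_verts[OF graph] by auto

lemma verts_induct [consumes 2, case_names start edge]:
  assumes "u \<in> verts \<tau>" "v \<in> verts \<tau>" "P v"
    and "\<And>f. f \<in> halves \<tau> \<Longrightarrow> P (base \<tau> f) \<Longrightarrow> P (base \<tau> (opp \<tau> f))"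
  shows "P u"
proof -
  have "(v, u) \<in> joined \<tau> (flags \<tau>)" using is_tree assms by (auto simp: is_tree_def)
  then show ?thesis by (induction rule: joined_induct) (use assms in auto)
qed

lemma base_opp_side: "f \<in> halves \<tau> \<Longrightarrow> base \<tau> (opp \<tau> f) \<in> side \<tau> f"
  by (simp add: side_def)

text \<open>A common vertex would join the two ends of the edge while avoiding the edge.\<close>

lemma sides_disjoint: "side \<tau> f \<inter> side \<tau> (opp \<tau> f) = {}"
proof (rule ccontr)
  assume "\<not> ?thesis"
  then obtain u where f: "f \<in> halves \<tau>"
    and u: "(base \<tau> (opp \<tau> f), u) \<in> joined \<tau> (flags \<tau> - {f, opp \<tau> f})"
    "(base \<tau> f, u) \<in> joined \<tau> (flags \<tau> - {f, opp \<tau> f})"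
    by (auto simp: side_def insert_commute)
  have "(u, base \<tau> (opp \<tau> f)) \<in> joined \<tau> (flags \<tau> - {f, opp \<tau> f})"
    by (rule joined_sym[OF graph _ u(1)]) (use f half in \<open>metis Diff_iff insert_iff empty_iff\<close>)
  then show False using tree_bridge[OF is_tree f] joined_trans[OF u(2)] by blast
qed

lemma base_notin_side: "base \<tau> f \<notin> side \<tau> f"
proof
  assume a: "base \<tau> f \<in> side \<tau> f"
  then have f: "f \<in> halves \<tau>" by (simp add: side_def)
  then have "base \<tau> f \<in> side \<tau> (opp \<tau> f)" using base_opp_side[of "opp \<tau> f"] by simp
  then show False using a sides_disjoint by blast
qed

lemma base_opp_neq: "f \<in> halves \<tau> \<Longrightarrow> base \<tau> (opp \<tau> f) \<noteq> base \<tau> f"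
  using base_opp_side base_notin_side by metis

lemma side_step:
  assumes "g \<in> halves \<tau>" "g \<noteq> f" "g \<noteq> opp \<tau> f" "base \<tau> g \<in> side \<tau> f"
  shows "base \<tau> (opp \<tau> g) \<in> side \<tau> f"
proof -
  have "(base \<tau> g, base \<tau> (opp \<tau> g)) \<in> joined \<tau> (flags \<tau> - {f, opp \<tau> f})"
    using assms by (intro joined_edge) auto
  then show ?thesis using assms unfolding side_def using joined_trans by fastforce
qed

lemma side_induct [consumes 1, case_names start edge]:
  assumes "u \<in> side \<tau> f" and "P (base \<tau> (opp \<tau> f))"
    and "\<And>g. g \<in> halves \<tau> \<Longrightarrow> g \<noteq> f \<Longrightarrow> g \<noteq> opp \<tau> f \<Longrightarrow> base \<tau> g \<in> side \<tau> f \<Longrightarrow> P (base \<tau> g) \<Longrightarrow>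
      P (base \<tau> (opp \<tau> g))"
  shows "P u"
proof -
  have f: "f \<in> halves \<tau>" and "(base \<tau> (opp \<tau> f), u) \<in> joined \<tau> (flags \<tau> - {f, opp \<tau> f})"
    using assms(1) by (auto simp: side_def)
  from this(2) show ?thesis
    by (induction rule: joined_induct) (use f assms(2,3) in \<open>auto simp: side_def\<close>)
qed

lemma side_cover:
  assumes "f \<in> halves \<tau>" "u \<in> verts \<tau>"
  shows "u \<in> side \<tau> f \<or> u \<in> side \<tau> (opp \<tau> f)"
  using assms(2) half(3)[OF assms(1)]
proof (induction rule: verts_induct)
  case start
  then show ?case using base_opp_side[of "opp \<tau> f"] assms(1) by simp
next
  case (edge g)
  then show ?case
    by (metis assms(1) base_opp_side half(1,2) side_step)
qed

lemma side_opp: "f \<in> halves \<tau> \<Longrightarrow> side \<tau> (opp \<tau> f) = verts \<tau> - side \<tau> f"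
  using side_cover sides_disjoint side_verts by blast

text \<open>Everything beyond \<open>f\<close> stays connected to the common vertex when the edge of
  \<open>g\<close> is deleted, so it lies in \<open>side \<tau> (opp \<tau> g)\<close>.\<close>

lemma sides_at_disjoint:
  assumes "f \<in> halves \<tau>" "g \<in> halves \<tau>" "base \<tau> f = base \<tau> g" "f \<noteq> g"
  shows "side \<tau> f \<inter> side \<tau> g = {}"
proof -
  have "u \<in> side \<tau> (opp \<tau> g)" if "u \<in> side \<tau> f" for u
    using that
  proof (induction rule: side_induct)
    case start
    have "f \<noteq> opp \<tau> g" using base_opp_neq assms by metis
    moreover have "base \<tau> f \<in> side \<tau> (opp \<tau> g)" using assms base_opp_side[of "opp \<tau> g"] by simp
    ultimately show ?case using assms side_step[of f "opp \<tau> g"] by simp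
  next
    case (edge h)
    have "h \<noteq> g" using edge assms base_notin_side by metis
    moreover have "h \<noteq> opp \<tau> g"
    proof
      assume "h = opp \<tau> g"
      then have "base \<tau> g \<in> side \<tau> f" using side_step[OF edge(1-4)] assms by simp
      then show False using assms base_notin_side by metis
    qed
    ultimately show ?case using edge assms side_step[of h "opp \<tau> g"] by simp
  qed
  then show ?thesis using sides_disjoint by blast
qed

lemma side_exists:
  assumes "u \<in> verts \<tau>" "v \<in> verts \<tau>" "u \<noteq> v"
  shows "\<exists>f. f \<in> halves \<tau> \<and> base \<tau> f = v \<and> u \<in> side \<tau> f"
proof -
  have "u = v \<or> (\<exists>f. f \<in> halves \<tau> \<and> base \<tau> f = v \<and> u \<in> side \<tau> f)"
    using assms(1,2)
  proof (induction rule: verts_induct)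
    case (edge g)
    then show ?case by (metis base_opp_side half(2) side_step)
  qed simp
  then show ?thesis using assms(3) by simp
qed

text \<open>A path beyond \<open>h\<close> could leave the side of \<open>f\<close> only through
  \<open>v\<close>, the base of \<open>f\<close>, and \<open>v\<close> is not beyond
  \<open>h\<close>.\<close>

lemma side_subset:
  assumes h: "h \<in> halves \<tau>" and v: "v \<in> verts \<tau>" "v \<notin> side \<tau> h"
    and f: "f \<in> halves \<tau>" "base \<tau> f = v" "base \<tau> h \<in> side \<tau> f"
  shows "side \<tau> h \<subseteq> side \<tau> f"
proof
  fix u assume "u \<in> side \<tau> h"
  then show "u \<in> side \<tau> f"
  proof (induction rule: side_induct)
    case start
    have "h \<noteq> f" "h \<noteq> opp \<tau> f" using f h v base_notin_side base_opp_side by (metis half(2))+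
    then show ?case using side_step f h by blast
  next
    case (edge g)
    have "g \<noteq> f" using edge f v by blast
    moreover have "g \<noteq> opp \<tau> f" using side_step[OF edge(1-4)] f v by auto
    ultimately show ?case using side_step edge by blast
  qed
qed

end


section \<open>Branches of stable trees\<close>

locale painted =
  fixes S W :: "'a set"
  assumes finite_S: "finite S" and W_subset: "W \<subseteq> S" and card_S: "3 \<le> card S" and card_W: "2 \<le> card W"

locale stable_tree = painted S W for S W :: "'a set" +
  fixes \<tau> :: "'a stree"
  assumes stable: "\<tau> \<in> stable_trees S W"

sublocale stable_tree \<subseteq> tree \<tau>
  using stable by unfold_locales (simp add: stable_trees_def is_stree_def)

context stable_tree
begin

abbreviation B :: "nat \<Rightarrow> 'a set" where "B \<equiv> branch_labels S \<tau>"

lemma lab_bij: "bij_betw (lab \<tau>) S (tails \<tau>)"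
  using stable by (simp add: stable_trees_def is_stree_def)

lemma lab_tail: "s \<in> S \<Longrightarrow> lab \<tau> s \<in> tails \<tau>"
  using lab_bij bij_betwE by metis

lemma lab_flag [simp]: "s \<in> S \<Longrightarrow> lab \<tau> s \<in> flags \<tau>"
  using lab_tail by (simp add: tails_def)

lemma lab_not_half: "s \<in> S \<Longrightarrow> lab \<tau> s \<notin> halves \<tau>"
  using lab_tail by (simp add: tails_def halves_def del: half)

lemma lab_eqD: "s \<in> S \<Longrightarrow> t \<in> S \<Longrightarrow> lab \<tau> s = lab \<tau> t \<Longrightarrow> s = t"
  using lab_bij by (meson bij_betw_def inj_onD)

lemma tail_labE: "f \<in> tails \<tau> \<Longrightarrow> \<exists>s\<in>S. lab \<tau> s = f"
  using lab_bij by (metis bij_betw_def imageE)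

lemma tail_or_half: "f \<in> flags \<tau> \<Longrightarrow> f \<in> tails \<tau> \<or> f \<in> halves \<tau>"
  by (auto simp: tails_def halves_def simp del: half)

text \<open>Branches are defined by removing a vertex, sides by deleting an edge. In a tree both cut
  off the same vertices, because a path beyond \<open>f\<close> never returns to the base of
  \<open>f\<close>.\<close>

lemma side_avoid:
  assumes f: "f \<in> halves \<tau>"
  shows "u \<in> side \<tau> f \<longleftrightarrow>
    (base \<tau> (opp \<tau> f), u) \<in> joined \<tau> {g. base \<tau> g \<noteq> base \<tau> f \<and> base \<tau> (opp \<tau> g) \<noteq> base \<tau> f}"
    (is "_ \<longleftrightarrow> _ \<in> joined \<tau> ?A")
proof
  assume "u \<in> side \<tau> f"
  then show "(base \<tau> (opp \<tau> f), u) \<in> joined \<tau> ?A"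
  proof (induction rule: side_induct)
    case (edge g)
    have "base \<tau> (opp \<tau> g) \<in> side \<tau> f" using side_step edge by blast
    then have "g \<in> ?A" using edge base_notin_side by (metis (mono_tags, lifting) mem_Collect_eq)
    then have "(base \<tau> g, base \<tau> (opp \<tau> g)) \<in> joined \<tau> ?A" by (rule joined_edge[OF edge(1)])
    with edge(5) show ?case by (rule joined_trans)
  qed simp
next
  assume "(base \<tau> (opp \<tau> f), u) \<in> joined \<tau> ?A"
  then show "u \<in> side \<tau> f"
  proof (induction rule: joined_induct)
    case refl
    then show ?case by (rule base_opp_side[OF f])
  next
    case (edge g)
    have "g \<noteq> f" "g \<noteq> opp \<tau> f" using edge(2) f by auto
    then show ?case using side_step edge by blast
  qed
qed

text \<open>Since \<open>side\<close> is empty at a tail, one formula covers tails (first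
  alternative) and half-edges (second alternative).\<close>

lemma branch_iff:
  assumes "f \<in> flags \<tau>"
  shows "s \<in> B f \<longleftrightarrow> s \<in> S \<and> (lab \<tau> s = f \<or> base \<tau> (lab \<tau> s) \<in> side \<tau> f)"
proof (cases "f \<in> tails \<tau>")
  case True
  then have "side \<tau> f = {}" by (auto simp: side_def tails_def halves_def simp del: half)
  with True show ?thesis by (simp add: branch_labels_def)
next
  case False
  then have f: "f \<in> halves \<tau>" using tail_or_half assms by blast
  show ?thesis using False side_avoid[OF f] lab_not_half f by (auto simp: branch_labels_def)
qed

lemma branch_half:
  assumes "f \<in> halves \<tau>" shows "B f = {s \<in> S. base \<tau> (lab \<tau> s) \<in> side \<tau> f}"
  using branch_iff[of f] assms lab_not_half by auto

lemma branch_subset: "f \<in> flags \<tau> \<Longrightarrow> B f \<subseteq> S"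
  using branch_iff by blast

lemma branch_tail: "f \<in> tails \<tau> \<Longrightarrow> s \<in> S \<Longrightarrow> lab \<tau> s = f \<Longrightarrow> B f = {s}"
  using lab_eqD by (auto simp: branch_labels_def)

lemma branch_opp: "f \<in> halves \<tau> \<Longrightarrow> B (opp \<tau> f) = S - B f"
  by (auto simp: branch_half side_opp)

lemma branch_cover:
  assumes "v \<in> verts \<tau>" "s \<in> S"
  shows "\<exists>f\<in>flags_at \<tau> v. s \<in> B f"
proof (cases "base \<tau> (lab \<tau> s) = v")
  case True
  then have "lab \<tau> s \<in> flags_at \<tau> v" using assms by (simp add: flags_at_def)
  moreover have "s \<in> B (lab \<tau> s)" using assms branch_iff by simp
  ultimately show ?thesis by blast
next
  case False
  then obtain f where "f \<in> halves \<tau>" "base \<tau> f = v" "base \<tau> (lab \<tau> s) \<in> side \<tau> f"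
    using side_exists[of "base \<tau> (lab \<tau> s)" v] assms by auto
  then show ?thesis using assms(2) by (intro bexI[of _ f]) (auto simp: flags_at_def branch_half)
qed

lemma branch_disjoint:
  assumes "f \<in> flags \<tau>" "g \<in> flags \<tau>" "base \<tau> f = base \<tau> g" "f \<noteq> g"
  shows "B f \<inter> B g = {}"
proof (rule ccontr)
  assume "\<not> ?thesis"
  then obtain s where s: "s \<in> S" "lab \<tau> s = f \<or> base \<tau> (lab \<tau> s) \<in> side \<tau> f"
    "lab \<tau> s = g \<or> base \<tau> (lab \<tau> s) \<in> side \<tau> g"
    using branch_iff assms by auto
  show False
  proof (cases "lab \<tau> s = f \<or> lab \<tau> s = g")
    case True
    then show False using s assms base_notin_side by metis
  next
    case False
    then have "f \<in> halves \<tau>" "g \<in> halves \<tau>" using s by (auto simp: side_def)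
    then show False using sides_at_disjoint[of f g] assms s False by auto
  qed
qed

lemma branch_outward:
  assumes h: "h \<in> flags \<tau>" and v: "v \<in> verts \<tau>" "v \<notin> side \<tau> h" "base \<tau> h \<noteq> v"
  shows "\<exists>f. f \<in> halves \<tau> \<and> base \<tau> f = v \<and> base \<tau> h \<in> side \<tau> f \<and> side \<tau> h \<subseteq> side \<tau> f \<and> B h \<subseteq> B f"
proof -
  obtain f where f: "f \<in> halves \<tau>" "base \<tau> f = v" "base \<tau> h \<in> side \<tau> f"
    using side_exists[of "base \<tau> h" v] h v by auto
  have sub: "side \<tau> h \<subseteq> side \<tau> f"
  proof (cases "h \<in> halves \<tau>")
    case True
    then show ?thesis using side_subset[OF True v(1,2) f] by simp
  next
    case False
    then show ?thesis by (simp add: side_def)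
  qed
  have "B h \<subseteq> B f"
    using sub f(3) by (auto simp: branch_iff[OF h] branch_half[OF f(1)])
  then show ?thesis using f sub by blast
qed

section \<open>Consequences of stability for branches\<close>

lemma three_flags: "v \<in> verts \<tau> \<Longrightarrow> 3 \<le> card (flags_at \<tau> v)"
  using stable by (simp add: stable_trees_def)

lemma flags_at_finite: "finite (flags_at \<tau> v)"
  using finite_flags by (simp add: flags_at_def)

lemma third_flag:
  assumes "v \<in> verts \<tau>" shows "\<exists>h\<in>flags_at \<tau> v. h \<noteq> f \<and> h \<noteq> g"
proof (rule ccontr)
  assume "\<not> ?thesis"
  then have "flags_at \<tau> v \<subseteq> {f, g}" by blast
  then have "card (flags_at \<tau> v) \<le> card {f, g}" by (rule card_mono[rotated]) simp
  also have "card {f, g} \<le> 2" by (cases "f = g") auto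
  finally show False using three_flags[OF assms] by simp
qed

text \<open>The vertex meets at most the edge of \<open>f\<close>, so the colour condition for
  vertices with at most one edge applies.\<close>

lemma white_tail:
  assumes "v \<in> verts \<tau>" and "\<And>g. g \<in> flags_at \<tau> v \<Longrightarrow> g \<in> halves \<tau> \<Longrightarrow> g = f"
  shows "\<exists>s\<in>W. base \<tau> (lab \<tau> s) = v"
proof -
  have "{e \<in> edges \<tau>. e \<inter> flags_at \<tau> v \<noteq> {}} \<subseteq> {{f, opp \<tau> f}}"
  proof
    fix e assume "e \<in> {e \<in> edges \<tau>. e \<inter> flags_at \<tau> v \<noteq> {}}"
    then obtain g where g: "g \<in> halves \<tau>" "e = {g, opp \<tau> g}" "g \<in> flags_at \<tau> v \<or> opp \<tau> g \<in> flags_at \<tau> v"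
      by (auto simp: edges_def)
    from g(3) have "g = f \<or> opp \<tau> g = f" using assms(2) g(1) by auto
    then show "e \<in> {{f, opp \<tau> f}}" using g by auto
  qed
  then have "card {e \<in> edges \<tau>. e \<inter> flags_at \<tau> v \<noteq> {}} \<le> card {{f, opp \<tau> f}}"
    by (rule card_mono[rotated]) simp
  then have "\<exists>s\<in>W. lab \<tau> s \<in> flags_at \<tau> v" using stable assms(1) by (simp add: stable_trees_def)
  then show ?thesis by (auto simp: flags_at_def)
qed

text \<open>Follow edges away from \<open>f\<close>: either the far end has a further edge, whose
  side is strictly smaller, or it is an end vertex and stability puts a white tail there.\<close>

lemma branch_white_half: "f \<in> halves \<tau> \<Longrightarrow> B f \<inter> W \<noteq> {}"
proof (induction "card (side \<tau> f)" arbitrary: f rule: less_induct)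
  case less
  let ?u = "base \<tau> (opp \<tau> f)"
  have u: "?u \<in> verts \<tau>" "?u \<in> side \<tau> f" using less.prems base_opp_side by auto
  show ?case
  proof (cases "\<exists>g. g \<in> flags_at \<tau> ?u \<and> g \<in> halves \<tau> \<and> g \<noteq> opp \<tau> f")
    case True
    then obtain g where g: "g \<in> halves \<tau>" "base \<tau> g = ?u" "g \<noteq> opp \<tau> f"
      by (auto simp: flags_at_def)
    have "side \<tau> g \<inter> side \<tau> (opp \<tau> f) = {}" using sides_at_disjoint[of g "opp \<tau> f"] g less.prems by simp
    then have sub: "side \<tau> g \<subseteq> side \<tau> f" using side_opp[OF less.prems] side_verts by blast
    have "?u \<notin> side \<tau> g" using g base_notin_side by metis
    then have "side \<tau> g \<subset> side \<tau> f" using sub u by blast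
    then have "card (side \<tau> g) < card (side \<tau> f)"
      using finite_subset[OF side_verts finite_verts] by (simp add: psubset_card_mono)
    then have "B g \<inter> W \<noteq> {}" using less.hyps g by blast
    then show ?thesis using sub g less.prems by (auto simp: branch_half)
  next
    case False
    then obtain s where "s \<in> W" "base \<tau> (lab \<tau> s) = ?u" using white_tail[OF u(1), of "opp \<tau> f"] by blast
    then show ?thesis using u(2) less.prems W_subset by (auto simp: branch_half)
  qed
qed

lemma branch_nonempty: "f \<in> flags \<tau> \<Longrightarrow> B f \<noteq> {}"
  using branch_white_half tail_or_half tail_labE branch_tail by blast

lemma branch_subset_opp:
  assumes "f \<in> halves \<tau>" "g \<in> flags \<tau>" "base \<tau> g = base \<tau> (opp \<tau> f)" "g \<noteq> opp \<tau> f"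
  shows "B g \<subseteq> B f"
  using branch_disjoint[of g "opp \<tau> f"] assms branch_opp[of f] branch_subset[of g] by auto

text \<open>Here three flags per vertex matter: if distinct flags had equal branches, the nonempty
  branch of a third flag would be forced into a branch from which it is disjoint.\<close>

lemma branch_inj:
  assumes f: "f \<in> flags \<tau>" and h: "h \<in> flags \<tau>" and eq: "B f = B h"
  shows "f = h"
proof (rule ccontr)
  assume "f \<noteq> h"
  let ?v = "base \<tau> f"
  have v: "?v \<in> verts \<tau>" using f by simp
  have ne: "B f \<noteq> {}" "B h \<noteq> {}" using branch_nonempty f h by auto
  show False
  proof (cases "base \<tau> h = ?v")
    case True
    then show False using branch_disjoint[OF f h] \<open>f \<noteq> h\<close> ne eq by auto
  next
    case bne: False
    show False
    proof (cases "?v \<in> side \<tau> h")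
      case False
      obtain k where k: "k \<in> halves \<tau>" "base \<tau> k = ?v" "base \<tau> h \<in> side \<tau> k" "B h \<subseteq> B k"
        using branch_outward[OF h v False bne] by blast
      have "k = f" using branch_disjoint[of k f] k f ne eq by fastforce
      then have fh: "f \<in> halves \<tau>" "base \<tau> h \<in> side \<tau> f" using k by auto
      obtain l where l: "l \<in> halves \<tau>" "base \<tau> l = base \<tau> h" "?v \<in> side \<tau> l"
        using side_exists[of ?v "base \<tau> h"] v h bne by auto
      \<comment> \<open>The flags \<open>f\<close> and \<open>h\<close> point in the same direction
        here, so the branch of a third flag at the base of \<open>h\<close> lies beyond
        \<open>f\<close>.\<close>
      obtain m where m: "m \<in> flags \<tau>" "base \<tau> m = base \<tau> h" "m \<noteq> h" "m \<noteq> l"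
        using third_flag[of "base \<tau> h" h l] h by (auto simp: flags_at_def)
      have vm: "?v \<notin> side \<tau> m"
      proof
        assume "?v \<in> side \<tau> m"
        then have "m \<in> halves \<tau>" by (simp add: side_def)
        then show False using sides_at_disjoint[of m l] m l \<open>?v \<in> side \<tau> m\<close> by auto
      qed
      obtain n where n: "n \<in> halves \<tau>" "base \<tau> n = ?v" "base \<tau> m \<in> side \<tau> n" "B m \<subseteq> B n"
        using branch_outward[OF m(1) v vm] bne m by auto
      have "n = f" using sides_at_disjoint[of n f] n fh m by (metis disjoint_iff)
      then show False using n branch_disjoint[OF m(1) h] m eq branch_nonempty[OF m(1)] by auto
    next
      \<comment> \<open>Now \<open>h\<close> points back to the base of \<open>f\<close>. The
        complement of its branch fits into one branch \<open>k\<close> at that vertex, which leaves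
        no labels for a third flag there.\<close>
      case True
      then have hh: "h \<in> halves \<tau>" by (simp add: side_def)
      have v2: "?v \<notin> side \<tau> (opp \<tau> h)" using True sides_disjoint by blast
      have "B (opp \<tau> h) \<noteq> B (opp \<tau> h) \<inter> B f" using branch_opp[OF hh] branch_nonempty[of "opp \<tau> h"] hh eq by auto
      obtain k where k: "k \<in> flags \<tau>" "base \<tau> k = ?v" "B (opp \<tau> h) \<subseteq> B k"
      proof (cases "base \<tau> (opp \<tau> h) = ?v")
        case True
        then show ?thesis using that[of "opp \<tau> h"] hh by simp
      next
        case False
        then show ?thesis using branch_outward[of "opp \<tau> h" ?v] v v2 hh that by (metis half(6,7))
      qed
      obtain m where m: "m \<in> flags \<tau>" "base \<tau> m = ?v" "m \<noteq> k" "m \<noteq> f"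
        using third_flag[OF v, of k f] by (auto simp: flags_at_def)
      have "B m \<subseteq> S - B f" using branch_disjoint[OF m(1) f] m branch_subset by blast
      also have "\<dots> \<subseteq> B k" using branch_opp[OF hh] k(3) eq by simp
      finally show False using branch_disjoint[OF m(1) k(1)] m k branch_nonempty[OF m(1)] by auto
    qed
  qed
qed

lemma branch_card:
  assumes "f \<in> halves \<tau>" shows "2 \<le> card (B f)"
proof -
  obtain g where g: "g \<in> flags \<tau>" "base \<tau> g = base \<tau> (opp \<tau> f)" "g \<noteq> opp \<tau> f"
    using third_flag[of "base \<tau> (opp \<tau> f)" "opp \<tau> f" "opp \<tau> f"] assms by (auto simp: flags_at_def)
  obtain h where h: "h \<in> flags \<tau>" "base \<tau> h = base \<tau> (opp \<tau> f)" "h \<noteq> opp \<tau> f" "h \<noteq> g"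
    using third_flag[of "base \<tau> (opp \<tau> f)" "opp \<tau> f" g] assms by (auto simp: flags_at_def)
  obtain s t where "s \<in> B g" "t \<in> B h" using branch_nonempty g h by blast
  moreover have "B g \<subseteq> B f" "B h \<subseteq> B f" using branch_subset_opp assms g h by blast+
  moreover have "B g \<inter> B h = {}" using branch_disjoint g h by metis
  ultimately have "{s, t} \<subseteq> B f" "s \<noteq> t" by auto
  moreover have "finite (B f)" using branch_subset[of f] assms finite_S finite_subset by auto
  ultimately show ?thesis using card_mono[of "B f" "{s, t}"] by simp
qed

text \<open>The quotient is by joinedness without the edge, whose classes are the label sets of the
  two sides; both occur because branches are nonempty.\<close>

lemma edge_partition_eq:
  assumes f: "f \<in> halves \<tau>"
  shows "edge_partition S \<tau> f = {B f, B (opp \<tau> f)}"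
proof -
  let ?A = "flags \<tau> - {f, opp \<tau> f}"
  let ?R = "{(s, t). s \<in> S \<and> t \<in> S \<and> (base \<tau> (lab \<tau> s), base \<tau> (lab \<tau> t)) \<in> joined \<tau> ?A}"
  have cl: "\<And>g. g \<in> halves \<tau> \<Longrightarrow> g \<in> ?A \<Longrightarrow> opp \<tau> g \<in> ?A"
    using f by (metis DiffE DiffI half(2,7) insertE insertI1 insertI2 singletonD)
  have img: "?R `` {s} = B g" if g: "g = f \<or> g = opp \<tau> f" and s: "s \<in> B g" for s g
  proof -
    have gh: "g \<in> halves \<tau>" using g f by auto
    have A: "flags \<tau> - {g, opp \<tau> g} = ?A" using g f by auto
    have s': "s \<in> S" "(base \<tau> (opp \<tau> g), base \<tau> (lab \<tau> s)) \<in> joined \<tau> ?A"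
      using s gh A by (auto simp: branch_half side_def)
    have sy: "(base \<tau> (lab \<tau> s), base \<tau> (opp \<tau> g)) \<in> joined \<tau> ?A"
      by (rule joined_sym[OF graph cl s'(2)])
    have eq: "(base \<tau> (lab \<tau> s), u) \<in> joined \<tau> ?A \<longleftrightarrow> (base \<tau> (opp \<tau> g), u) \<in> joined \<tau> ?A" for u
      by (rule iffI[OF joined_trans[OF s'(2)] joined_trans[OF sy]])
    have "?R `` {s} = {t \<in> S. (base \<tau> (opp \<tau> g), base \<tau> (lab \<tau> t)) \<in> joined \<tau> ?A}"
      using s'(1) by (auto simp: eq)
    also have "\<dots> = B g" using gh A by (simp add: branch_half side_def)
    finally show ?thesis .
  qed
  obtain a b where ab: "a \<in> B f" "b \<in> B (opp \<tau> f)" using branch_nonempty f by (metis all_not_in_conv half(6,7))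
  have cov: "s \<in> B f \<or> s \<in> B (opp \<tau> f)" if "s \<in> S" for s using that branch_opp[OF f] by blast
  have sub: "B f \<subseteq> S" "B (opp \<tau> f) \<subseteq> S" using branch_subset f by auto
  show ?thesis
    unfolding edge_partition_def
  proof (rule Set.set_eqI)
    fix P
    have "P \<in> S // ?R \<longleftrightarrow> (\<exists>s\<in>S. P = ?R `` {s})" by (auto simp: quotient_def)
    also have "\<dots> \<longleftrightarrow> P = B f \<or> P = B (opp \<tau> f)"
    proof (rule iffI)
      assume "\<exists>s\<in>S. P = ?R `` {s}"
      then obtain s where s: "s \<in> S" "P = ?R `` {s}" by (elim bexE)
      from cov[OF s(1)] show "P = B f \<or> P = B (opp \<tau> f)"
      proof (rule disjE)
        assume "s \<in> B f"
        then have "?R `` {s} = B f" by (intro img disjI1 refl)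
        then show ?thesis by (intro disjI1) (simp only: s(2))
      next
        assume "s \<in> B (opp \<tau> f)"
        then have "?R `` {s} = B (opp \<tau> f)" by (intro img disjI2 refl)
        then show ?thesis by (intro disjI2) (simp only: s(2))
      qed
    next
      have ra: "?R `` {a} = B f" by (rule img[OF disjI1[OF refl] ab(1)])
      have rb: "?R `` {b} = B (opp \<tau> f)" by (rule img[OF disjI2[OF refl] ab(2)])
      assume "P = B f \<or> P = B (opp \<tau> f)"
      then show "\<exists>s\<in>S. P = ?R `` {s}"
      proof (rule disjE)
        assume "P = B f"
        then show ?thesis by (intro bexI[of _ a]) (simp only: ra, rule subsetD[OF sub(1) ab(1)])
      next
        assume "P = B (opp \<tau> f)"
        then show ?thesis by (intro bexI[of _ b]) (simp only: rb, rule subsetD[OF sub(2) ab(2)])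
      qed
    qed
    finally show "P \<in> S // ?R \<longleftrightarrow> P \<in> {B f, B (opp \<tau> f)}" by simp
  qed
qed

text \<open>The base of a half-edge with a small branch of maximal cardinality will do.\<close>

lemma center_exists:
  assumes half_small: "\<And>f. f \<in> halves \<tau> \<Longrightarrow> small (B f) \<or> small (B (opp \<tau> f))"
    and tail_small: "\<And>s. s \<in> S \<Longrightarrow> small {s}"
  shows "\<exists>v\<in>verts \<tau>. \<forall>f\<in>flags_at \<tau> v. small (B f)"
proof (cases "halves \<tau> = {}")
  case True
  obtain v where "v \<in> verts \<tau>" using is_tree by (auto simp: is_tree_def)
  moreover have "small (B f)" if "f \<in> flags_at \<tau> v" for f
  proof -
    have "f \<in> tails \<tau>" using that True tail_or_half by (auto simp: flags_at_def)
    then show ?thesis using tail_labE branch_tail tail_small by metis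
  qed
  ultimately show ?thesis by blast
next
  case False
  let ?F = "{f \<in> halves \<tau>. small (B f)}"
  have "finite ?F" using finite_flags by (simp add: halves_def del: half)
  moreover have "?F \<noteq> {}"
  proof -
    obtain f where "f \<in> halves \<tau>" using False by blast
    then show ?thesis using half_small[of f] half(1)[of f] by blast
  qed
  ultimately have "Max ((\<lambda>f. card (B f)) ` ?F) \<in> (\<lambda>f. card (B f)) ` ?F"
    and ge: "\<And>g. g \<in> ?F \<Longrightarrow> card (B g) \<le> Max ((\<lambda>f. card (B f)) ` ?F)"
    by (auto intro!: Max_in Max_ge)
  then obtain f where f: "f \<in> ?F" and "Max ((\<lambda>f. card (B f)) ` ?F) = card (B f)"
    by (elim imageE)
  with ge have max: "\<And>g. g \<in> ?F \<Longrightarrow> card (B g) \<le> card (B f)" by metis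
  have "small (B g)" if g: "g \<in> flags_at \<tau> (base \<tau> f)" for g
  proof (rule ccontr)
    assume ns: "\<not> small (B g)"
    have g': "g \<in> flags \<tau>" "base \<tau> g = base \<tau> f" using g by (auto simp: flags_at_def)
    have gh: "g \<in> halves \<tau>" using g' ns tail_or_half tail_labE branch_tail tail_small by metis
    then have "opp \<tau> g \<in> ?F" using half_small ns by auto
    then have le: "card (B (opp \<tau> g)) \<le> card (B f)" using max by blast
    have "g \<noteq> f" using ns f by auto
    \<comment> \<open>If \<open>g\<close> had a branch that is not small, the opposite branch would
      be small and would contain \<open>B f\<close> together with the branch of a third flag,
      against maximality.\<close>
    obtain h where h: "h \<in> flags \<tau>" "base \<tau> h = base \<tau> f" "h \<noteq> f" "h \<noteq> g"
      using third_flag[of "base \<tau> f" f g] f by (auto simp: flags_at_def)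
    have "B f \<subseteq> B (opp \<tau> g)" "B h \<subseteq> B (opp \<tau> g)"
      using branch_subset_opp[of "opp \<tau> g"] gh g' h f \<open>g \<noteq> f\<close> by auto
    moreover have "B h \<inter> B f = {}" "B h \<noteq> {}" using branch_disjoint[of h f] branch_nonempty h f by auto
    ultimately have "B f \<subset> B (opp \<tau> g)" by blast
    moreover have "finite (B (opp \<tau> g))" using branch_subset[of "opp \<tau> g"] gh finite_S finite_subset by auto
    ultimately show False using le psubset_card_mono by (metis not_less)
  qed
  then show ?thesis using f by (intro bexI[of _ "base \<tau> f"]) auto
qed

end


section \<open>Compatible splits and the splitting of a vertex\<close>

definition compat :: "'a set set \<Rightarrow> 'a set set \<Rightarrow> bool" where
  "compat \<sigma> \<rho> \<longleftrightarrow> (\<exists>P\<in>\<sigma>. \<exists>Q\<in>\<rho>. P \<inter> Q = {})"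

lemma compat_sym: "compat \<sigma> \<rho> \<longleftrightarrow> compat \<rho> \<sigma>"
  by (auto simp: compat_def Int_commute)

lemma two_partitions_iff:
  "\<sigma> \<in> two_partitions X \<longleftrightarrow> (\<exists>P. P \<subseteq> X \<and> P \<noteq> {} \<and> X - P \<noteq> {} \<and> \<sigma> = {P, X - P})"
proof
  assume "\<sigma> \<in> two_partitions X"
  then obtain P Q where "\<sigma> = {P, Q}" "P \<noteq> Q" "partition_on X \<sigma>"
    by (auto simp: two_partitions_def card_2_iff)
  moreover from this have "P \<union> Q = X" "P \<inter> Q = {}" "P \<noteq> {}" "Q \<noteq> {}"
    by (auto simp: partition_on_def disjoint_def)
  moreover from this have "Q = X - P" by blast
  ultimately show "\<exists>P. P \<subseteq> X \<and> P \<noteq> {} \<and> X - P \<noteq> {} \<and> \<sigma> = {P, X - P}" by blast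
next
  assume "\<exists>P. P \<subseteq> X \<and> P \<noteq> {} \<and> X - P \<noteq> {} \<and> \<sigma> = {P, X - P}"
  then obtain P where P: "P \<subseteq> X" "P \<noteq> {}" "X - P \<noteq> {}" "\<sigma> = {P, X - P}" by blast
  have "P \<noteq> X - P" using P by blast
  then show "\<sigma> \<in> two_partitions X"
    using P by (auto simp: two_partitions_def partition_on_def disjoint_def)
qed

lemma stable_partitions_iff:
  "\<sigma> \<in> stable_partitions S W \<longleftrightarrow> (\<exists>P. P \<subseteq> S \<and> \<sigma> = {P, S - P} \<and> 2 \<le> card P \<and> 2 \<le> card (S - P) \<and>
     P \<inter> W \<noteq> {} \<and> (S - P) \<inter> W \<noteq> {})"
proof
  assume "\<sigma> \<in> stable_partitions S W"
  then show "\<exists>P. P \<subseteq> S \<and> \<sigma> = {P, S - P} \<and> 2 \<le> card P \<and> 2 \<le> card (S - P) \<and>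
     P \<inter> W \<noteq> {} \<and> (S - P) \<inter> W \<noteq> {}"
    unfolding stable_partitions_def two_partitions_iff by fastforce
next
  assume "\<exists>P. P \<subseteq> S \<and> \<sigma> = {P, S - P} \<and> 2 \<le> card P \<and> 2 \<le> card (S - P) \<and>
     P \<inter> W \<noteq> {} \<and> (S - P) \<inter> W \<noteq> {}"
  then obtain P where P: "P \<subseteq> S" "\<sigma> = {P, S - P}" "2 \<le> card P" "2 \<le> card (S - P)"
     "P \<inter> W \<noteq> {}" "(S - P) \<inter> W \<noteq> {}" by blast
  moreover have "P \<noteq> {}" "S - P \<noteq> {}" using P(5,6) by auto
  ultimately show "\<sigma> \<in> stable_partitions S W"
    unfolding stable_partitions_def two_partitions_iff by auto
qed

lemma (in painted) finite_partitions: "finite (stable_partitions S W)"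
proof (rule finite_subset)
  show "stable_partitions S W \<subseteq> Pow (Pow S)" by (auto simp: stable_partitions_iff)
qed (use finite_S in simp)

definition splits :: "'a set \<Rightarrow> 'a stree \<Rightarrow> 'a set set set" where
  "splits S \<tau> = edge_partition S \<tau> ` halves \<tau>"

context stable_tree
begin

lemma edge_partition_branch: "f \<in> halves \<tau> \<Longrightarrow> edge_partition S \<tau> f = {B f, S - B f}"
  by (simp add: edge_partition_eq branch_opp)

lemma splits_eq: "splits S \<tau> = (\<lambda>f. {B f, S - B f}) ` halves \<tau>"
  unfolding splits_def by (intro image_cong refl edge_partition_branch)

lemma edge_partition_stable:
  assumes "f \<in> halves \<tau>" shows "{B f, S - B f} \<in> stable_partitions S W"
  using branch_card[of f] branch_card[of "opp \<tau> f"] branch_white_half[of f]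
    branch_white_half[of "opp \<tau> f"] branch_opp[of f] branch_subset[of f] assms
  unfolding stable_partitions_iff by (intro exI[of _ "B f"]) simp

lemma splits_stable: "splits S \<tau> \<subseteq> stable_partitions S W"
  using edge_partition_stable by (auto simp: splits_eq)

lemma branch_within:
  assumes "h \<in> flags \<tau>" "v \<in> verts \<tau>" "v \<notin> side \<tau> h"
  shows "\<exists>k\<in>flags_at \<tau> v. B h \<subseteq> B k"
proof (cases "base \<tau> h = v")
  case True
  then show ?thesis using assms by (auto simp: flags_at_def)
next
  case False
  then obtain k where "k \<in> halves \<tau>" "base \<tau> k = v" "B h \<subseteq> B k"
    using branch_outward[OF assms] by blast
  then show ?thesis by (intro bexI[of _ k]) (auto simp: flags_at_def)
qed

text \<open>The side of the edge that does not contain \<open>v\<close> is cut off by a single flag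
  at \<open>v\<close>. Compatibility of splits and the translation between flag partitions and
  splits rest on this position fact.\<close>

lemma edge_within:
  assumes "h \<in> halves \<tau>" "v \<in> verts \<tau>"
  shows "\<exists>k\<in>flags_at \<tau> v. B h \<subseteq> B k \<or> S - B h \<subseteq> B k"
proof (cases "v \<in> side \<tau> h")
  case True
  then have "v \<notin> side \<tau> (opp \<tau> h)" using sides_disjoint by blast
  then obtain k where "k \<in> flags_at \<tau> v" "B (opp \<tau> h) \<subseteq> B k"
    using branch_within[of "opp \<tau> h" v] assms by auto
  then show ?thesis using branch_opp[OF assms(1)] by auto
next
  case False
  then show ?thesis using branch_within[of h v] assms by auto
qed

text \<open>By \<open>edge_within\<close> at the base of one edge, a part of the other split lies in
  a single branch there, and each branch there misses one part of the first split.\<close>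

lemma splits_compat:
  assumes "\<sigma> \<in> splits S \<tau>" "\<rho> \<in> splits S \<tau>" shows "compat \<sigma> \<rho>"
proof -
  obtain f h where f: "f \<in> halves \<tau>" "\<sigma> = {B f, S - B f}" and h: "h \<in> halves \<tau>" "\<rho> = {B h, S - B h}"
    using assms by (auto simp: splits_eq)
  obtain k where k: "k \<in> flags \<tau>" "base \<tau> k = base \<tau> f" and sub: "B h \<subseteq> B k \<or> S - B h \<subseteq> B k"
    using edge_within[OF h(1), of "base \<tau> f"] f(1) by (auto simp: flags_at_def)
  have "B k \<inter> (S - B f) = {} \<or> B k \<inter> B f = {}"
    using branch_disjoint[of k f] k f(1) by auto
  then show ?thesis using sub unfolding compat_def f h by blast
qed

lemma edge_partition_eqD:
  assumes "f \<in> halves \<tau>" "h \<in> halves \<tau>" "edge_partition S \<tau> f = edge_partition S \<tau> h"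
  shows "h = f \<or> h = opp \<tau> f"
proof -
  have "B h = B f \<or> B h = B (opp \<tau> f)"
    using assms by (auto simp: edge_partition_eq doubleton_eq_iff)
  then show ?thesis using branch_inj assms by auto
qed

end

section \<open>Splitting a vertex along a new split whose parts are unions of branches\<close>

locale splitting = stable_tree +
  fixes v n a b :: nat and P
  assumes v: "v \<in> verts \<tau>" and P: "{P, S - P} \<in> stable_partitions S W" "P \<subseteq> S"
    and new: "{P, S - P} \<notin> splits S \<tau>"
    and branches: "\<And>f. f \<in> flags_at \<tau> v \<Longrightarrow> B f \<subseteq> P \<or> B f \<subseteq> S - P"
    and fresh: "n \<notin> verts \<tau>" "a \<notin> flags \<tau>" "b \<notin> flags \<tau>" "a \<noteq> b"
begin

definition part :: "'a set \<Rightarrow> nat set" where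
  "part X = {f \<in> flags_at \<tau> v. B f \<subseteq> X}"

text \<open>The old vertex keeps the flags of \<open>P\<close> and the new one takes those of
  \<open>S - P\<close>; \<open>vert\<close> allows one argument for both parts.\<close>

definition vert :: "'a set \<Rightarrow> nat" where
  "vert X = (if X = P then v else n)"

text \<open>The flags at \<open>v\<close> whose branches lie in \<open>S - P\<close> are moved to the new vertex \<open>n\<close>, and the new edge
  \<open>{a, b}\<close> joins \<open>v\<close> to \<open>n\<close>.\<close>

definition split :: "'a stree" where
  "split = \<lparr>verts = insert n (verts \<tau>), flags = insert a (insert b (flags \<tau>)),
     base = (\<lambda>f. if f = a then v else if f = b then n else if f \<in> part (S - P) then n else base \<tau> f),
     opp = (\<lambda>f. if f = a then b else if f = b then a else opp \<tau> f), lab = lab \<tau>\<rparr>"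

lemma P_sizes: "X = P \<or> X = S - P \<Longrightarrow> X \<subseteq> S \<and> 2 \<le> card X \<and> X \<inter> W \<noteq> {} \<and> {X, S - X} = {P, S - P}"
  using P unfolding stable_partitions_def by (auto simp: double_diff)

lemma parts_disjoint: "part P \<inter> part (S - P) = {}"
proof (rule ccontr)
  assume "\<not> ?thesis"
  then obtain f where "f \<in> flags_at \<tau> v" "B f \<subseteq> P" "B f \<subseteq> S - P" by (auto simp: part_def)
  then show False using branch_nonempty[of f] by (auto simp: flags_at_def)
qed

lemma parts_cover: "f \<in> flags_at \<tau> v \<Longrightarrow> f \<in> part P \<or> f \<in> part (S - P)"
  using branches by (auto simp: part_def)

lemma part_label:
  assumes "X = P \<or> X = S - P" "s \<in> X" shows "\<exists>f\<in>part X. s \<in> B f"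
proof -
  have "s \<in> S" using assms P by auto
  then obtain f where f: "f \<in> flags_at \<tau> v" "s \<in> B f" using branch_cover[OF v] by blast
  then have "B f \<subseteq> X" using branches[of f] assms by auto
  then show ?thesis using f by (auto simp: part_def)
qed

lemma part_finite: "finite (part X)"
  using flags_at_finite by (simp add: part_def)

lemma part_flags: "part X \<subseteq> flags \<tau>"
  by (auto simp: part_def flags_at_def)

text \<open>A part made of one flag would be the branch of that flag: for a half-edge the partition
  would already be a split of the tree, for a tail the part would have one element only.\<close>

lemma part_card:
  assumes X: "X = P \<or> X = S - P" shows "2 \<le> card (part X)"
proof (rule ccontr)
  assume "\<not> ?thesis"
  then have "card (part X) = 0 \<or> card (part X) = 1" by linarith
  then show False
  proof
    assume "card (part X) = 0"
    then show False using part_finite part_label[OF X] P_sizes[OF X] by auto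
  next
    assume "card (part X) = 1"
    then obtain f where f: "part X = {f}" by (auto simp: card_1_singleton_iff)
    have Xf: "X = B f"
    proof
      show "X \<subseteq> B f" using part_label[OF X] f by auto
      show "B f \<subseteq> X" using f by (auto simp: part_def)
    qed
    have "f \<in> flags \<tau>" using f part_flags by blast
    then consider "f \<in> halves \<tau>" | "f \<in> tails \<tau>" using tail_or_half by blast
    then show False
    proof cases
      case 1
      then have "{X, S - X} \<in> splits S \<tau>" by (auto simp: splits_eq Xf)
      then show False using P_sizes[OF X] new by simp
    next
      case 2
      then obtain s where "B f = {s}" using tail_labE branch_tail by metis
      then show False using P_sizes[OF X] Xf by simp
    qed
  qed
qed

text \<open>A white label of the part lies on the branch of some flag of the part, and with no
  half-edges available this flag is the tail of the label.\<close>

lemma part_white: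
  assumes X: "X = P \<or> X = S - P" and tails: "part X \<inter> halves \<tau> = {}"
  shows "\<exists>s\<in>W. lab \<tau> s \<in> part X"
proof -
  obtain s where s: "s \<in> W" "s \<in> X" using P_sizes[OF X] by blast
  obtain f where f: "f \<in> part X" "s \<in> B f" using part_label[OF X s(2)] by blast
  then have "f \<in> tails \<tau>" using tails tail_or_half part_flags by blast
  then have "lab \<tau> s = f" using f(2) by (simp add: branch_labels_def)
  then show ?thesis using s f by blast
qed

lemma split_sel [simp]:
  "verts split = insert n (verts \<tau>)" "flags split = insert a (insert b (flags \<tau>))"
  "lab split = lab \<tau>" "base split a = v" "base split b = n" "opp split a = b" "opp split b = a"
  using fresh by (auto simp: split_def)

lemma split_opp [simp]: "f \<in> flags \<tau> \<Longrightarrow> opp split f = opp \<tau> f"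
  using fresh by (auto simp: split_def)

lemma split_base:
  "f \<in> flags \<tau> \<Longrightarrow> base split f = (if f \<in> part (S - P) then n else base \<tau> f)"
  using fresh by (auto simp: split_def)

lemma split_halves: "halves split = insert a (insert b (halves \<tau>))"
proof -
  have "f \<in> halves split \<longleftrightarrow> f \<in> halves \<tau>" if "f \<in> flags \<tau>" for f
    using that by (simp add: halves_iff del: half)
  moreover have "f \<notin> halves split" if "f \<notin> insert a (insert b (flags \<tau>))" for f
    using that by (simp add: halves_iff del: half)
  moreover have "a \<in> halves split" "b \<in> halves split" using fresh by (auto simp: halves_iff simp del: half)
  ultimately show ?thesis using half(6) by blast
qed

lemma split_graph: "is_graph split"
proof -
  have "base split f \<in> verts split" if "f \<in> flags split" for f
    using that v fresh by (cases "f = a \<or> f = b") (auto simp: split_base)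
  moreover have "opp split f \<in> flags split \<and> opp split (opp split f) = f" if "f \<in> flags split" for f
    using that graph_opp[OF graph, of f] fresh by (cases "f = a \<or> f = b") auto
  ultimately show ?thesis using finite_flags finite_verts unfolding is_graph_def by simp
qed

text \<open>Contraction of the new edge on vertices: the vertex map of the morphism from
  \<open>split\<close> to \<tau>.\<close>

definition proj :: "nat \<Rightarrow> nat" where
  "proj u = (if u = n then v else u)"

lemma proj_base: "f \<in> flags \<tau> \<Longrightarrow> proj (base split f) = base \<tau> f"
proof -
  assume f: "f \<in> flags \<tau>"
  then have "base \<tau> f \<noteq> n" using fresh base_verts by metis
  then show ?thesis using f by (auto simp: split_base proj_def part_def flags_at_def)
qed

lemma proj_joined: "(u, w) \<in> joined split A \<Longrightarrow> (proj u, proj w) \<in> joined \<tau> A"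
proof (induction rule: joined_induct)
  case (edge f)
  show ?case
  proof (cases "f = a \<or> f = b")
    case True
    then have "proj (base split (opp split f)) = proj (base split f)" using fresh v by (auto simp: proj_def)
    then show ?thesis using edge by simp
  next
    case False
    then have f: "f \<in> halves \<tau>" using edge(1) by (simp add: split_halves)
    then have st: "(base \<tau> f, base \<tau> (opp \<tau> f)) \<in> joined \<tau> A" using edge(2) by (intro joined_edge)
    have "(proj u, base \<tau> f) \<in> joined \<tau> A" using edge(4) f proj_base[of f] by simp
    then have "(proj u, base \<tau> (opp \<tau> f)) \<in> joined \<tau> A" using st by (rule joined_trans)
    then show ?thesis using f proj_base[of "opp \<tau> f"] by simp
  qed
qed simp

text \<open>A candidate for the component of \<open>vert X\<close> after deletion of the new edge.
  Closedness under the remaining edges is enough to see that the new edge is a bridge.\<close>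

definition zone :: "'a set \<Rightarrow> nat set" where
  "zone X = insert (vert X) (\<Union>f\<in>part X. side \<tau> f)"

lemma vert_P: "vert P = v" "vert (S - P) = n"
  using P_sizes[of P] by (auto simp: vert_def)

lemma part_base: "X = P \<or> X = S - P \<Longrightarrow> f \<in> part X \<Longrightarrow> base split f = vert X"
  using parts_disjoint part_flags vert_P split_base[of f] by (auto simp: part_def flags_at_def)

lemma not_part_base: "f \<in> flags \<tau> \<Longrightarrow> base \<tau> f \<noteq> v \<Longrightarrow> base split f = base \<tau> f"
  by (simp add: split_base part_def flags_at_def)

lemma base_vertD:
  assumes "X = P \<or> X = S - P" "f \<in> flags \<tau>" "base split f = vert X"
  shows "f \<in> part X"
proof -
  have "base \<tau> f = v"
    using assms fresh v vert_P not_part_base[of f] base_verts[of f] by metis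
  then have "f \<in> part P \<or> f \<in> part (S - P)" using parts_cover assms by (auto simp: flags_at_def)
  moreover have "v \<noteq> n" using v fresh by auto
  ultimately show ?thesis using assms(1,3) part_base[of P f] part_base[of "S - P" f] vert_P by auto
qed

lemma zone_cases:
  assumes X: "X = P \<or> X = S - P" and f: "f \<in> flags \<tau>" "base split f \<in> zone X"
  shows "f \<in> part X \<or> (\<exists>h\<in>part X. base \<tau> f \<in> side \<tau> h \<and> base split f = base \<tau> f)"
proof (cases "base split f = vert X")
  case True
  then show ?thesis using base_vertD[OF X f(1)] by simp
next
  case False
  then obtain h where h: "h \<in> part X" "base split f \<in> side \<tau> h" using f by (auto simp: zone_def)
  then have "base split f \<noteq> n" using side_verts[of h] fresh(1) by (metis subsetD)
  then have "base split f = base \<tau> f" using f(1) by (auto simp: split_base split: if_splits)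
  then show ?thesis using h by auto
qed

lemma zone_closed:
  assumes X: "X = P \<or> X = S - P" and g: "g \<in> halves \<tau>" "base split g \<in> zone X"
  shows "base split (opp \<tau> g) \<in> zone X"
  using zone_cases[OF X half(6)[OF g(1)] g(2)]
proof
  assume gX: "g \<in> part X"
  then have "base \<tau> (opp \<tau> g) \<noteq> v" using base_opp_neq[OF g(1)] by (auto simp: part_def flags_at_def)
  then have "base split (opp \<tau> g) = base \<tau> (opp \<tau> g)" using not_part_base g by simp
  then show ?thesis using base_opp_side[OF g(1)] gX by (auto simp: zone_def)
next
  assume "\<exists>h\<in>part X. base \<tau> g \<in> side \<tau> h \<and> base split g = base \<tau> g"
  then obtain h where h: "h \<in> part X" "base \<tau> g \<in> side \<tau> h" by blast
  have hv: "base \<tau> h = v" using h by (auto simp: part_def flags_at_def)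
  show ?thesis
  proof (cases "g = opp \<tau> h")
    \<comment> \<open>Stepping back along \<open>h\<close> returns to that end of the new edge which
      received \<open>h\<close>.\<close>
    case True
    have "h \<in> halves \<tau>" using h(2) by (simp add: side_def)
    then have "opp \<tau> g = h" using True by simp
    then show ?thesis using part_base[OF X h(1)] by (simp add: zone_def)
  next
    case False
    have "g \<noteq> h" using h base_notin_side by blast
    then have *: "base \<tau> (opp \<tau> g) \<in> side \<tau> h" using side_step g False h by blast
    then have "base \<tau> (opp \<tau> g) \<noteq> v" using hv base_notin_side[of h] by metis
    then have "base split (opp \<tau> g) = base \<tau> (opp \<tau> g)" using not_part_base g by simp
    then show ?thesis using * h by (auto simp: zone_def)
  qed
qed

lemma zone_joined:
  assumes X: "X = P \<or> X = S - P" and "(vert X, u) \<in> joined split (flags split - {a, b})"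
  shows "u \<in> zone X"
  using assms(2)
proof (induction rule: joined_induct)
  case refl
  then show ?case by (simp add: zone_def)
next
  case (edge f)
  then have "f \<in> halves \<tau>" by (simp add: split_halves)
  then show ?case using zone_closed[OF X] edge by simp
qed

lemma zone_label:
  assumes X: "X = P \<or> X = S - P" and s: "s \<in> S" "base split (lab \<tau> s) \<in> zone X"
  shows "s \<in> X"
  using zone_cases[OF X lab_flag[OF s(1)] s(2)]
proof
  assume "lab \<tau> s \<in> part X"
  moreover have "s \<in> B (lab \<tau> s)" using branch_iff s by simp
  ultimately show ?thesis by (auto simp: part_def)
next
  assume "\<exists>h\<in>part X. base \<tau> (lab \<tau> s) \<in> side \<tau> h \<and> base split (lab \<tau> s) = base \<tau> (lab \<tau> s)"
  then obtain h where h: "h \<in> part X" "base \<tau> (lab \<tau> s) \<in> side \<tau> h" by blast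
  then have "s \<in> B h" using branch_iff part_flags s by blast
  then show ?thesis using h by (auto simp: part_def)
qed

lemma n_notin_zone: "n \<notin> zone P"
  using side_verts fresh v by (auto simp: zone_def vert_P)

text \<open>Bridges are checked separately: the new edge by means of \<open>zone\<close>, an old
  edge because contraction maps a path avoiding it to such a path in \<tau>.\<close>

lemma split_tree: "is_tree split"
proof -
  let ?J = "joined split (flags split)"
  have reach: "(v, u) \<in> ?J" if "u \<in> verts split" for u
  proof -
    have vn: "(v, n) \<in> ?J" using joined_edge[of a split "flags split"] by (simp add: split_halves)
    have "(v, u) \<in> ?J" if "u \<in> verts \<tau>" for u
      using that v
    proof (induction rule: verts_induct)
      case (edge f)
      have ff: "f \<in> flags \<tau>" "opp \<tau> f \<in> flags \<tau>" using edge by auto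
      have "(v, base split f) \<in> ?J" using edge vn ff by (simp add: split_base)
      moreover have "(base split f, base split (opp \<tau> f)) \<in> ?J"
        using joined_edge[of f split "flags split"] edge ff by (simp add: split_halves)
      ultimately have *: "(v, base split (opp \<tau> f)) \<in> ?J" by (rule joined_trans)
      show ?case
      proof (cases "opp \<tau> f \<in> part (S - P)")
        case True
        then show ?thesis by (simp add: part_def flags_at_def)
      next
        case False
        then show ?thesis using * ff by (simp add: split_base)
      qed
    qed simp
    then show ?thesis using that vn by auto
  qed
  have sym: "(w, u) \<in> joined split A"
    if "(u, w) \<in> joined split A" "\<And>f. f \<in> halves split \<Longrightarrow> f \<in> A \<Longrightarrow> opp split f \<in> A" for u w A
    using joined_sym[OF split_graph that(2,1)] .
  have "(u, w) \<in> ?J" if "u \<in> verts split" "w \<in> verts split" for u w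
  proof -
    have "(u, v) \<in> ?J" by (rule sym[OF reach[OF that(1)]]) (use graph_half[OF split_graph] in blast)
    then show ?thesis using reach[OF that(2)] by (rule joined_trans)
  qed
  moreover have "\<not> is_loop split fs" for fs
  proof (rule no_loop_if_bridges[OF split_graph])
    fix f assume "f \<in> halves split"
    then consider "f = a" | "f = b" | "f \<in> halves \<tau>" by (auto simp: split_halves)
    then show "(base split f, base split (opp split f)) \<notin> joined split (flags split - {f, opp split f})"
    proof cases
      case 1
      then show ?thesis using zone_joined[of P n] n_notin_zone by (auto simp: vert_P)
    next
      case 2
      have "(n, v) \<notin> joined split (flags split - {a, b})"
      proof
        assume "(n, v) \<in> joined split (flags split - {a, b})"
        then have "(v, n) \<in> joined split (flags split - {a, b})"
        proof (rule sym)
          fix f assume "f \<in> halves split" "f \<in> flags split - {a, b}"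
          then have f: "f \<in> halves \<tau>" "f \<noteq> a" "f \<noteq> b" by (auto simp: split_halves)
          then have "opp \<tau> f \<in> flags \<tau>" by simp
          then have "opp \<tau> f \<noteq> a" "opp \<tau> f \<noteq> b" using fresh by metis+
          then show "opp split f \<in> flags split - {a, b}" using f by simp
        qed
        then show False using zone_joined[of P n] n_notin_zone by (auto simp: vert_P)
      qed
      then show ?thesis using 2 by (simp add: insert_commute)
    next
      case 3
      show ?thesis
      proof
        assume "(base split f, base split (opp split f)) \<in> joined split (flags split - {f, opp split f})"
        then have "(base \<tau> f, base \<tau> (opp \<tau> f)) \<in> joined \<tau> (flags split - {f, opp split f})"
          using proj_joined proj_base[of f] proj_base[of "opp \<tau> f"] 3 by fastforce
        moreover have "joined \<tau> (flags split - {f, opp split f}) \<subseteq> joined \<tau> (flags \<tau> - {f, opp \<tau> f})"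
          by (rule joined_mono) (use 3 in auto)
        ultimately show False using tree_bridge[OF is_tree 3] by blast
      qed
    qed
  qed
  ultimately show ?thesis using split_graph v unfolding is_tree_def by auto
qed

lemma split_flags_at:
  assumes "u \<in> verts \<tau>" "u \<noteq> v" shows "flags_at split u = flags_at \<tau> u"
proof -
  have "u \<noteq> n" using assms fresh by auto
  moreover have "base split f = u \<longleftrightarrow> base \<tau> f = u" if "f \<in> flags \<tau>" for f
    using that assms \<open>u \<noteq> n\<close> by (auto simp: split_base part_def flags_at_def)
  ultimately show ?thesis using assms by (auto simp: flags_at_def)
qed

lemma split_flags_at_new:
  assumes X: "X = P \<or> X = S - P"
  shows "flags_at split (vert X) = insert (if X = P then a else b) (part X)"
proof -
  have "v \<noteq> n" "P \<noteq> S - P" using v fresh P_sizes[of P] by auto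
  moreover have "f \<in> flags \<tau> \<Longrightarrow> base split f = vert X \<longleftrightarrow> f \<in> part X" for f
    using base_vertD[OF X] part_base[OF X] by blast
  ultimately show ?thesis
    using X part_flags[of X] vert_P by (auto simp: flags_at_def)
qed

lemma split_edges: "edges split = insert {a, b} (edges \<tau>)"
proof -
  have "(\<lambda>f. {f, opp split f}) ` halves \<tau> = (\<lambda>f. {f, opp \<tau> f}) ` halves \<tau>"
    by (intro image_cong) auto
  then show ?thesis unfolding edges_def split_halves by (auto simp: insert_commute)
qed

lemma split_lab: "bij_betw (lab split) S (tails split)"
proof -
  have "f \<in> tails split \<longleftrightarrow> f \<in> tails \<tau>" for f
    using fresh by (cases "f = a \<or> f = b") (auto simp: tails_def)
  then have "tails split = tails \<tau>" by blast
  then show ?thesis using lab_bij by simp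
qed

lemma split_vertex_stable:
  assumes u: "u \<in> verts split"
  shows "3 \<le> card (flags_at split u)"
    and "card {e \<in> edges split. e \<inter> flags_at split u \<noteq> {}} \<le> 1 \<Longrightarrow> \<exists>s\<in>W. lab split s \<in> flags_at split u"
proof -
  have ab: "a \<notin> flags_at \<tau> u" "b \<notin> flags_at \<tau> u" using fresh by (auto simp: flags_at_def)
  show "3 \<le> card (flags_at split u)"
  proof (cases "u = v \<or> u = n")
    case True
    then obtain X where X: "X = P \<or> X = S - P" "u = vert X" using vert_P by metis
    have "(if X = P then a else b) \<notin> part X" using part_flags fresh by auto
    then show ?thesis
      using part_card[OF X(1)] part_finite by (simp add: X(2) split_flags_at_new[OF X(1)])
  next
    case False
    then show ?thesis using u split_flags_at three_flags by simp
  qed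
  assume c: "card {e \<in> edges split. e \<inter> flags_at split u \<noteq> {}} \<le> 1"
  have fin: "finite {e \<in> edges split. e \<inter> flags_at split u \<noteq> {}}"
    using finite_flags by (simp add: edges_def split_halves halves_def del: half)
  show "\<exists>s\<in>W. lab split s \<in> flags_at split u"
  proof (cases "u = v \<or> u = n")
    case True
    then obtain X where X: "X = P \<or> X = S - P" "u = vert X" using vert_P by metis
    \<comment> \<open>A half-edge in the part would give a second edge at \<open>u\<close> besides
      the new one.\<close>
    have "part X \<inter> halves \<tau> = {}"
    proof (rule ccontr)
      assume "\<not> ?thesis"
      then obtain f where f: "f \<in> part X" "f \<in> halves \<tau>" by blast
      have e: "{f, opp \<tau> f} \<in> edges \<tau>" using f by (auto simp: edges_def)
      have "{{a, b}, {f, opp \<tau> f}} \<subseteq> {e \<in> edges split. e \<inter> flags_at split u \<noteq> {}}"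
        using f e by (simp add: split_edges X(2) split_flags_at_new[OF X(1)])
      moreover have "{a, b} \<noteq> {f, opp \<tau> f}" using f fresh part_flags[of X] by (auto simp: doubleton_eq_iff)
      ultimately have "2 \<le> card {e \<in> edges split. e \<inter> flags_at split u \<noteq> {}}"
        using card_mono[OF fin] by (metis (no_types, lifting) card_2_iff)
      then show False using c by simp
    qed
    then show ?thesis using part_white[OF X(1)] by (auto simp: X(2) split_flags_at_new[OF X(1)])
  next
    case False
    then have u': "u \<in> verts \<tau>" "flags_at split u = flags_at \<tau> u" using u split_flags_at by auto
    then have "{e \<in> edges split. e \<inter> flags_at split u \<noteq> {}} = {e \<in> edges \<tau>. e \<inter> flags_at \<tau> u \<noteq> {}}"
      using ab by (auto simp: split_edges)
    then show ?thesis using c u' stable by (simp add: stable_trees_def)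
  qed
qed

lemma split_stable: "split \<in> stable_trees S W"
  unfolding stable_trees_def is_stree_def using split_tree split_lab split_vertex_stable by blast

lemma split_smorphism: "is_smorphism S split \<tau> proj id"
proof -
  have "proj u = proj w \<longleftrightarrow> (u, w) \<in> joined split {a, b}"
    if "u \<in> verts split" "w \<in> verts split" for u w
  proof
    assume "proj u = proj w"
    then have "u = w \<or> u = v \<and> w = n \<or> u = n \<and> w = v" by (auto simp: proj_def split: if_splits)
    then show "(u, w) \<in> joined split {a, b}"
      using joined_edge[of a split "{a, b}"] joined_edge[of b split "{a, b}"]
      by (auto simp: split_halves)
  next
    assume "(u, w) \<in> joined split {a, b}"
    then have "(proj u, proj w) \<in> joined \<tau> {a, b}" by (rule proj_joined)
    then show "proj u = proj w"
    proof (induction rule: joined_induct)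
      case (edge f)
      then show ?case using fresh half(6) by blast
    qed simp
  qed
  moreover have "flags split - id ` flags \<tau> = {a, b}" using fresh by auto
  moreover have "proj ` verts split = verts \<tau>" using v fresh(1) by (auto simp: proj_def image_iff)
  ultimately show ?thesis
    unfolding is_smorphism_def using proj_base graph_opp[OF graph] by (auto simp: inj_on_def)
qed

text \<open>It suffices to include each of the two branches in a part: the branches are
  complementary and so are the parts, which forces equality.\<close>

lemma split_edge_partition: "edge_partition S split a = {P, S - P}"
proof -
  interpret split: stable_tree S W split
    using split_stable by unfold_locales
  have sub: "split.B f \<subseteq> X"
    if "f = a \<and> X = S - P \<or> f = b \<and> X = P" for f X
  proof
    fix s assume s: "s \<in> split.B f"
    have X: "X = P \<or> X = S - P" using that by auto
    have f: "f \<in> halves split" using that by (auto simp: split_halves)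
    have "s \<in> S" "base split (lab split s) \<in> side split f"
      using s by (auto simp: split.branch_half[OF f])
    moreover have "base split (opp split f) = vert X" "flags split - {f, opp split f} = flags split - {a, b}"
      using that vert_P by auto
    ultimately show "s \<in> X"
      using zone_label[OF X] zone_joined[OF X] by (simp add: side_def)
  qed
  have a: "a \<in> halves split" by (simp add: split_halves)
  have "split.B b = S - split.B a" "split.B a \<subseteq> S"
    using split.branch_opp[OF a] split.branch_subset[of a] by auto
  moreover have "split.B a \<subseteq> S - P" "split.B b \<subseteq> P" using sub by auto
  ultimately have "split.B a = S - P" "split.B b = P" using P(2) by blast+
  then show ?thesis using split.edge_partition_eq[OF a] by auto
qed

lemma split_breaking: "vertex_breaking S W {P, S - P} \<tau> v split"
proof -
  have "flags split - id ` flags \<tau> = {a, b}" "proj (base split a) = v" using fresh by (auto simp: proj_def)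
  moreover have "a \<in> halves split" by (simp add: split_halves)
  ultimately show ?thesis
    unfolding vertex_breaking_def
    using split_stable split_smorphism split_edge_partition
    by (metis split_sel(6))
qed

end

text \<open>Call a set small if it lies in one part of \<sigma>. Compatibility makes one side of
  every edge small, and a vertex all of whose branches are small can be split along
  \<sigma>.\<close>

lemma (in stable_tree) breaking_exists:
  assumes \<sigma>: "\<sigma> \<in> stable_partitions S W" and new: "\<sigma> \<notin> splits S \<tau>"
    and comp: "\<And>\<rho>. \<rho> \<in> splits S \<tau> \<Longrightarrow> compat \<sigma> \<rho>"
  shows "\<exists>v\<in>verts \<tau>. \<exists>\<tau>'. vertex_breaking S W \<sigma> \<tau> v \<tau>'"
proof -
  obtain P where PS: "P \<subseteq> S" "\<sigma> = {P, S - P}" using \<sigma> unfolding stable_partitions_iff by blast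
  have "\<exists>v\<in>verts \<tau>. \<forall>f\<in>flags_at \<tau> v. B f \<subseteq> P \<or> B f \<subseteq> S - P"
  proof (rule center_exists)
    fix f assume f: "f \<in> halves \<tau>"
    then have "compat \<sigma> {B f, S - B f}" using comp by (simp add: splits_eq)
    then have "P \<inter> B f = {} \<or> P \<inter> (S - B f) = {} \<or> (S - P) \<inter> B f = {} \<or> (S - P) \<inter> (S - B f) = {}"
      unfolding compat_def PS by blast
    then show "(B f \<subseteq> P \<or> B f \<subseteq> S - P) \<or> B (opp \<tau> f) \<subseteq> P \<or> B (opp \<tau> f) \<subseteq> S - P"
      using branch_opp[OF f] branch_subset[OF half(6)[OF f]] PS by blast
  qed auto
  then obtain v where v: "v \<in> verts \<tau>" "\<And>f. f \<in> flags_at \<tau> v \<Longrightarrow> B f \<subseteq> P \<or> B f \<subseteq> S - P" by blast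
  obtain n where n: "n \<notin> verts \<tau>" using ex_new_if_finite[OF infinite_UNIV_nat finite_verts] by blast
  obtain a where a: "a \<notin> flags \<tau>" using ex_new_if_finite[OF infinite_UNIV_nat finite_flags] by blast
  obtain b where b: "b \<notin> insert a (flags \<tau>)"
    using ex_new_if_finite[OF infinite_UNIV_nat, of "insert a (flags \<tau>)"] finite_flags by blast
  interpret splitting S W \<tau> v n a b P
    using v n a b PS \<sigma> new by unfold_locales auto
  show ?thesis using split_breaking v(1) PS(2) by blast
qed


section \<open>Trees are determined by their splits\<close>

locale smorphism = source: stable_tree S W \<tau>' + target: stable_tree S W \<tau>
  for S W :: "'a set" and \<tau>' \<tau> :: "'a stree" +
  fixes p q :: "nat \<Rightarrow> nat"
  assumes smorphism: "is_smorphism S \<tau>' \<tau> p q"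
begin

lemma q_flag: "f \<in> flags \<tau> \<Longrightarrow> q f \<in> flags \<tau>'"
  and q_base: "f \<in> flags \<tau> \<Longrightarrow> p (base \<tau>' (q f)) = base \<tau> f"
  and q_opp: "f \<in> flags \<tau> \<Longrightarrow> opp \<tau>' (q f) = q (opp \<tau> f)"
  and q_lab: "s \<in> S \<Longrightarrow> q (lab \<tau> s) = lab \<tau>' s"
  and p_eq: "u \<in> verts \<tau>' \<Longrightarrow> w \<in> verts \<tau>' \<Longrightarrow>
    p u = p w \<longleftrightarrow> (u, w) \<in> joined \<tau>' (flags \<tau>' - q ` flags \<tau>)"
  using smorphism unfolding is_smorphism_def by blast+

lemma q_inj: "inj_on q (flags \<tau>)"
  using smorphism unfolding is_smorphism_def by blast

lemma q_eqD: "f \<in> flags \<tau> \<Longrightarrow> g \<in> flags \<tau> \<Longrightarrow> q f = q g \<Longrightarrow> f = g"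
  using q_inj by (meson inj_onD)

lemma q_half_iff: "f \<in> flags \<tau> \<Longrightarrow> q f \<in> halves \<tau>' \<longleftrightarrow> f \<in> halves \<tau>"
  using q_flag[of f] q_opp[of f] q_eqD[of "opp \<tau> f" f] graph_opp(1)[OF target.graph, of f]
  unfolding halves_iff by auto

text \<open>Paths avoiding the edge correspond. Downwards, contracted edges become constant;
  upwards, a path is lifted edge by edge and the gaps are closed inside fibres, which are connected
  by contracted edges alone.\<close>

lemma edge_partition_q:
  assumes g: "g \<in> halves \<tau>"
  shows "edge_partition S \<tau>' (q g) = edge_partition S \<tau> g"
proof -
  let ?A' = "flags \<tau>' - {q g, opp \<tau>' (q g)}" and ?A = "flags \<tau> - {g, opp \<tau> g}"
  have gf: "g \<in> flags \<tau>" "opp \<tau> g \<in> flags \<tau>" using g by auto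
  have A': "?A' = flags \<tau>' - {q g, q (opp \<tau> g)}" using q_opp gf by simp
  have down: "(p u, p w) \<in> joined \<tau> ?A" if "(u, w) \<in> joined \<tau>' ?A'" for u w
    using that
  proof (induction rule: joined_induct)
    case (edge h)
    have hb: "base \<tau>' h \<in> verts \<tau>'" "base \<tau>' (opp \<tau>' h) \<in> verts \<tau>'" using edge(1) by auto
    show ?case
    proof (cases "h \<in> q ` flags \<tau>")
      case True
      then obtain h' where h': "h = q h'" "h' \<in> flags \<tau>" by blast
      then have hh: "h' \<in> halves \<tau>" using q_half_iff edge by simp
      moreover have "h' \<in> ?A" using edge(2) h' unfolding A' by auto
      ultimately have "(base \<tau> h', base \<tau> (opp \<tau> h')) \<in> joined \<tau> ?A" by (rule joined_edge)
      moreover have "p (base \<tau>' h) = base \<tau> h'" "p (base \<tau>' (opp \<tau>' h)) = base \<tau> (opp \<tau> h')"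
        using h' hh by (simp_all add: q_base q_opp)
      ultimately show ?thesis using joined_trans[OF edge(4)] by simp
    next
      case False
      have "(base \<tau>' h, base \<tau>' (opp \<tau>' h)) \<in> joined \<tau>' (flags \<tau>' - q ` flags \<tau>)"
        by (rule joined_edge[OF edge(1)]) (use edge(1) False in simp)
      then have "p (base \<tau>' h) = p (base \<tau>' (opp \<tau>' h))" using p_eq[OF hb] by blast
      then show ?thesis using edge(4) by simp
    qed
  qed simp
  have fibre: "(u, w) \<in> joined \<tau>' ?A'" if "u \<in> verts \<tau>'" "w \<in> verts \<tau>'" "p u = p w" for u w
  proof -
    have "joined \<tau>' (flags \<tau>' - q ` flags \<tau>) \<subseteq> joined \<tau>' ?A'"
      unfolding A' by (rule joined_mono) (use gf in blast)
    then show ?thesis using p_eq that by blast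
  qed
  have up: "\<forall>w\<in>verts \<tau>'. p w = y \<longrightarrow> (u, w) \<in> joined \<tau>' ?A'"
    if "(p u, y) \<in> joined \<tau> ?A" "u \<in> verts \<tau>'" for u y
    using that(1)
  proof (induction rule: joined_induct)
    case refl
    then show ?case using fibre that(2) by simp
  next
    case (edge h)
    have hf: "h \<in> flags \<tau>" "opp \<tau> h \<in> flags \<tau>" using edge(1) by auto
    have bv: "base \<tau>' (q h) \<in> verts \<tau>'" "base \<tau>' (q (opp \<tau> h)) \<in> verts \<tau>'" using q_flag hf by auto
    have "(u, base \<tau>' (q h)) \<in> joined \<tau>' ?A'" using edge(4) bv q_base hf by blast
    moreover have "(base \<tau>' (q h), base \<tau>' (q (opp \<tau> h))) \<in> joined \<tau>' ?A'"
    proof -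
      have "q h \<in> halves \<tau>'" using q_half_iff hf edge by simp
      moreover have "q h \<in> ?A'" unfolding A' using edge(2) q_flag hf gf q_eqD by auto
      ultimately show ?thesis using joined_edge[of "q h" \<tau>' ?A'] q_opp hf by simp
    qed
    ultimately have *: "(u, base \<tau>' (q (opp \<tau> h))) \<in> joined \<tau>' ?A'" by (rule joined_trans)
    show ?case
    proof (intro ballI impI)
      fix w assume w: "w \<in> verts \<tau>'" "p w = base \<tau> (opp \<tau> h)"
      have "(base \<tau>' (q (opp \<tau> h)), w) \<in> joined \<tau>' ?A'"
        by (rule fibre) (use bv w q_base hf in auto)
      with * show "(u, w) \<in> joined \<tau>' ?A'" by (rule joined_trans)
    qed
  qed
  have iff: "(base \<tau>' (lab \<tau>' s), base \<tau>' (lab \<tau>' t)) \<in> joined \<tau>' ?A' \<longleftrightarrow>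
      (base \<tau> (lab \<tau> s), base \<tau> (lab \<tau> t)) \<in> joined \<tau> ?A" if "s \<in> S" "t \<in> S" for s t
  proof -
    have "p (base \<tau>' (lab \<tau>' r)) = base \<tau> (lab \<tau> r) \<and> base \<tau>' (lab \<tau>' r) \<in> verts \<tau>'" if "r \<in> S" for r
      using q_base[of "lab \<tau> r"] q_lab[of r] that by simp
    then show ?thesis using that down up by metis
  qed
  have "{(s, t). s \<in> S \<and> t \<in> S \<and> (base \<tau>' (lab \<tau>' s), base \<tau>' (lab \<tau>' t)) \<in> joined \<tau>' ?A'} =
    {(s, t). s \<in> S \<and> t \<in> S \<and> (base \<tau> (lab \<tau> s), base \<tau> (lab \<tau> t)) \<in> joined \<tau> ?A}"
    using iff by (intro Collect_cong) auto
  then show ?thesis unfolding edge_partition_def by simp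
qed

lemma splits_q: "edge_partition S \<tau>' ` (q ` halves \<tau>) = splits S \<tau>"
  unfolding splits_def image_image by (intro image_cong refl edge_partition_q)

end

text \<open>The half-edges of \<tau>' are those kept from \<tau> and the two of the contracted edge.
  The split is new because distinct edges of \<tau>' have distinct splits.\<close>

lemma (in stable_tree) vertex_breakingD:
  assumes "vertex_breaking S W \<sigma> \<tau> v \<tau>'"
  shows "\<tau>' \<in> stable_trees S W" "splits S \<tau>' = insert \<sigma> (splits S \<tau>)" "\<sigma> \<notin> splits S \<tau>"
proof -
  from assms obtain p q f where st: "\<tau>' \<in> stable_trees S W" and f: "f \<in> halves \<tau>'"
    and m: "is_smorphism S \<tau>' \<tau> p q" and fl: "flags \<tau>' - q ` flags \<tau> = {f, opp \<tau>' f}"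
    and \<sigma>: "\<sigma> = edge_partition S \<tau>' f"
    unfolding vertex_breaking_def by blast
  show "\<tau>' \<in> stable_trees S W" by fact
  interpret \<tau>': stable_tree S W \<tau>' using st by unfold_locales
  interpret smorphism S W \<tau>' \<tau> p q using m by unfold_locales
  have oppf: "edge_partition S \<tau>' (opp \<tau>' f) = \<sigma>"
    using f \<sigma> by (simp add: edge_partition_def insert_commute)
  have "halves \<tau>' = insert f (insert (opp \<tau>' f) (q ` halves \<tau>))"
  proof -
    have "h \<in> q ` halves \<tau>" if "h \<in> halves \<tau>'" "h \<noteq> f" "h \<noteq> opp \<tau>' f" for h
    proof -
      have "h \<in> q ` flags \<tau>" using that fl \<tau>'.half(6) by blast
      then show ?thesis using that q_half_iff by blast
    qed
    moreover have "q h \<in> halves \<tau>'" if "h \<in> halves \<tau>" for h using q_half_iff that by simp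
    ultimately show ?thesis using f \<tau>'.half(1)[OF f] by blast
  qed
  then show "splits S \<tau>' = insert \<sigma> (splits S \<tau>)"
    using splits_q oppf \<sigma> by (simp add: splits_def[of S \<tau>'])
  show "\<sigma> \<notin> splits S \<tau>"
  proof
    assume "\<sigma> \<in> splits S \<tau>"
    then obtain g where g: "g \<in> halves \<tau>" "\<sigma> = edge_partition S \<tau> g" by (auto simp: splits_def)
    then have "edge_partition S \<tau>' f = edge_partition S \<tau>' (q g)" using \<sigma> edge_partition_q by simp
    then have "q g = f \<or> q g = opp \<tau>' f" using \<tau>'.edge_partition_eqD[OF f, of "q g"] q_half_iff g by auto
    moreover have "q g \<in> q ` flags \<tau>" using g(1) by simp
    moreover have "f \<notin> q ` flags \<tau>" "opp \<tau>' f \<notin> q ` flags \<tau>" using fl by auto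
    ultimately show False by auto
  qed
qed

lemma breaks_at_vertex_iff:
  assumes "painted S W" "\<tau> \<in> stable_trees S W" and \<sigma>: "\<sigma> \<in> stable_partitions S W"
  shows "(\<exists>v. breaks_at_vertex S W \<sigma> \<tau> v) \<longleftrightarrow> \<sigma> \<notin> splits S \<tau> \<and> (\<forall>\<rho>\<in>splits S \<tau>. compat \<sigma> \<rho>)"
proof -
  interpret stable_tree S W \<tau>
    using assms by (simp add: stable_tree_def stable_tree_axioms_def)
  show ?thesis
  proof
    assume "\<exists>v. breaks_at_vertex S W \<sigma> \<tau> v"
    then obtain v \<tau>' where br: "vertex_breaking S W \<sigma> \<tau> v \<tau>'" by (auto simp: breaks_at_vertex_def)
    note D = vertex_breakingD[OF br]
    interpret \<tau>': stable_tree S W \<tau>' using D(1) by unfold_locales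
    show "\<sigma> \<notin> splits S \<tau> \<and> (\<forall>\<rho>\<in>splits S \<tau>. compat \<sigma> \<rho>)"
      using D \<tau>'.splits_compat by blast
  next
    assume "\<sigma> \<notin> splits S \<tau> \<and> (\<forall>\<rho>\<in>splits S \<tau>. compat \<sigma> \<rho>)"
    then show "\<exists>v. breaks_at_vertex S W \<sigma> \<tau> v"
      using breaking_exists[OF \<sigma>] by (auto simp: breaks_at_vertex_def)
  qed
qed

lemma star_splits:
  assumes "painted S W" "\<tau> \<in> stable_trees S W" "\<sigma> \<in> stable_partitions S W"
    and "\<sigma> \<notin> splits S \<tau>" "\<And>\<rho>. \<rho> \<in> splits S \<tau> \<Longrightarrow> compat \<sigma> \<rho>"
  shows "star S W \<sigma> \<tau> \<in> stable_trees S W" "splits S (star S W \<sigma> \<tau>) = insert \<sigma> (splits S \<tau>)"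
proof -
  interpret stable_tree S W \<tau>
    using assms by (simp add: stable_tree_def stable_tree_axioms_def)
  have "\<exists>\<tau>'. \<exists>v\<in>verts \<tau>. vertex_breaking S W \<sigma> \<tau> v \<tau>'"
    using breaking_exists[OF assms(3-5)] by blast
  then have "\<exists>v\<in>verts \<tau>. vertex_breaking S W \<sigma> \<tau> v (star S W \<sigma> \<tau>)"
    unfolding star_def by (rule someI_ex)
  then obtain v where "vertex_breaking S W \<sigma> \<tau> v (star S W \<sigma> \<tau>)" by blast
  from vertex_breakingD(1,2)[OF this]
  show "star S W \<sigma> \<tau> \<in> stable_trees S W" "splits S (star S W \<sigma> \<tau>) = insert \<sigma> (splits S \<tau>)" .
qed

section \<open>Reconstruction of a tree from its set of branches\<close>

context stable_tree
begin

text \<open>The condition under which two flags share their vertex, expressed in terms of their branches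
  only: it allows one to recover the tree from its splits.\<close>

definition adjacent :: "'a set \<Rightarrow> 'a set \<Rightarrow> bool" where
  "adjacent X Y \<longleftrightarrow> X = Y \<or> X \<inter> Y = {} \<and> X \<noteq> S - Y \<and> (\<forall>Z\<in>B ` flags \<tau>. \<not> (X \<subset> Z \<and> Z \<subset> S - Y))"

text \<open>When the vertices agree, \<open>edge_within\<close> at this vertex rules out a branch
  strictly between \<open>B f\<close> and \<open>S - B g\<close>. When they differ, the flag at the
  vertex of \<open>g\<close> pointing to \<open>f\<close> has such a branch; a third flag there
  makes the second inclusion strict.\<close>

lemma base_eq_iff:
  assumes f: "f \<in> flags \<tau>" and g: "g \<in> flags \<tau>"
  shows "base \<tau> f = base \<tau> g \<longleftrightarrow> adjacent (B f) (B g)"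
proof
  assume eq: "base \<tau> f = base \<tau> g"
  let ?v = "base \<tau> f"
  have v: "?v \<in> verts \<tau>" using f by simp
  show "adjacent (B f) (B g)"
  proof (cases "f = g")
    case False
    have dis: "B f \<inter> B g = {}" by (rule branch_disjoint[OF f g eq False])
    have third: "\<exists>m\<in>flags \<tau>. base \<tau> m = ?v \<and> m \<noteq> x \<and> m \<noteq> y" for x y
      using third_flag[OF v, of x y] by (auto simp: flags_at_def)
    have "B f \<noteq> S - B g"
    proof
      assume fg: "B f = S - B g"
      obtain m where m: "m \<in> flags \<tau>" "base \<tau> m = ?v" "m \<noteq> f" "m \<noteq> g" using third by blast
      have "B m \<inter> B f = {}" "B m \<inter> B g = {}" "B m \<noteq> {}" "B m \<subseteq> S"
        using branch_disjoint[of m] branch_nonempty[of m] branch_subset[of m] m f g eq by auto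
      then show False using fg by blast
    qed
    moreover have "\<not> (B f \<subset> B h \<and> B h \<subset> S - B g)" if h: "h \<in> flags \<tau>" for h
    proof
      assume sub: "B f \<subset> B h \<and> B h \<subset> S - B g"
      have "h \<in> halves \<tau>"
      proof (rule ccontr)
        assume "h \<notin> halves \<tau>"
        then obtain s where "B h = {s}" using tail_or_half[OF h] tail_labE branch_tail by metis
        then show False using sub branch_nonempty[OF f] by auto
      qed
      then obtain k where k: "k \<in> flags \<tau>" "base \<tau> k = ?v" "B h \<subseteq> B k \<or> S - B h \<subseteq> B k"
        using edge_within[of h ?v] v by (auto simp: flags_at_def)
      from k(3) show False
      proof
        assume hk: "B h \<subseteq> B k"
        have "k = f"
        proof (rule ccontr)
          assume "k \<noteq> f"
          then show False using branch_disjoint[OF k(1) f k(2)] hk sub branch_nonempty[OF f] by auto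
        qed
        then show False using hk sub by blast
      next
        assume hk: "S - B h \<subseteq> B k"
        have "B g \<subseteq> S - B h" using sub branch_subset[OF g] by blast
        then have "B g \<subseteq> B k" using hk by blast
        have "k = g"
        proof (rule ccontr)
          assume "k \<noteq> g"
          then show False
            using branch_disjoint[OF k(1) g] k(2) eq branch_nonempty[OF g] \<open>B g \<subseteq> B k\<close> by auto
        qed
        then show False using hk sub by blast
      qed
    qed
    ultimately show ?thesis using dis by (auto simp: adjacent_def)
  qed (simp add: adjacent_def)
next
  assume adj: "adjacent (B f) (B g)"
  show "base \<tau> f = base \<tau> g"
  proof (rule ccontr)
    assume ne: "base \<tau> f \<noteq> base \<tau> g"
    then have "B f \<noteq> B g" using branch_inj f g by metis
    then have dis: "B f \<inter> B g = {}" and ncomp: "B f \<noteq> S - B g"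
      and nbet: "\<And>h. h \<in> flags \<tau> \<Longrightarrow> \<not> (B f \<subset> B h \<and> B h \<subset> S - B g)"
      using adj by (auto simp: adjacent_def)
    let ?u = "base \<tau> f" and ?v = "base \<tau> g"
    have u: "?u \<in> verts \<tau>" and v: "?v \<in> verts \<tau>" using f g by auto
    \<comment> \<open>Otherwise the two flags would point at each other, and disjointness would make
      their branches complementary.\<close>
    have vf: "?v \<notin> side \<tau> f"
    proof
      assume vf: "?v \<in> side \<tau> f"
      then have fh: "f \<in> halves \<tau>" by (simp add: side_def)
      have "?u \<in> side \<tau> g"
      proof (rule ccontr)
        assume "?u \<notin> side \<tau> g"
        then obtain k where k: "k \<in> halves \<tau>" "base \<tau> k = ?u" "?v \<in> side \<tau> k" "B g \<subseteq> B k"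
          using branch_outward[OF g u] ne by metis
        have "k = f" using sides_at_disjoint[OF k(1) fh k(2)] k(3) vf by auto
        then show False using k dis branch_nonempty[OF g] by blast
      qed
      then have gh: "g \<in> halves \<tau>" by (simp add: side_def)
      have "?v \<notin> side \<tau> (opp \<tau> f)" using vf sides_disjoint by blast
      then obtain k where k: "k \<in> flags \<tau>" "base \<tau> k = ?v" "B (opp \<tau> f) \<subseteq> B k"
        using branch_within[of "opp \<tau> f" ?v] fh v by (auto simp: flags_at_def)
      have "B g \<subseteq> B (opp \<tau> f)" using dis branch_opp[OF fh] branch_subset[OF g] by blast
      then have "k = g" using k(3) branch_disjoint[OF k(1) g k(2)] branch_nonempty[OF g] by auto
      then show False using k(3) branch_opp[OF fh] dis ncomp branch_subset[OF g] branch_subset[OF f] by blast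
    qed
    then obtain h where h: "h \<in> halves \<tau>" "base \<tau> h = ?v" "?u \<in> side \<tau> h" "B f \<subseteq> B h"
      using branch_outward[OF f v _ ne] by blast
    have hf: "h \<in> flags \<tau>" using h by simp
    have "B f \<noteq> B h" using branch_inj[OF f hf] h(2) ne by metis
    have "h \<noteq> g"
    proof
      assume "h = g"
      then show False using h dis branch_nonempty[OF f] by blast
    qed
    then have hg: "B h \<inter> B g = {}" using branch_disjoint[OF hf g] h by blast
    obtain m where m: "m \<in> flags \<tau>" "base \<tau> m = ?v" "m \<noteq> h" "m \<noteq> g"
      using third_flag[OF v, of h g] by (auto simp: flags_at_def)
    have "B m \<inter> B h = {}" "B m \<inter> B g = {}" "B m \<noteq> {}" "B m \<subseteq> S"
      using branch_disjoint[of m] branch_nonempty[of m] branch_subset[of m] m h g hf by auto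
    then have "B h \<subset> S - B g" using hg branch_subset[OF hf] by blast
    then show False using nbet[OF hf] h(4) \<open>B f \<noteq> B h\<close> by blast
  qed
qed

text \<open>Hence the set of branches, and with it the relation \<open>adjacent\<close>, depends
  only on the splits.\<close>

lemma branches_eq: "B ` flags \<tau> = (\<lambda>s. {s}) ` S \<union> \<Union>(splits S \<tau>)"
proof -
  have "flags \<tau> = tails \<tau> \<union> halves \<tau>" using tail_or_half by (auto simp: tails_def)
  moreover have "B ` tails \<tau> = (\<lambda>s. {s}) ` S"
  proof -
    have "B ` (lab \<tau> ` S) = (\<lambda>s. {s}) ` S"
      unfolding image_image by (intro image_cong refl branch_tail[OF lab_tail]) auto
    then show ?thesis using lab_bij by (simp add: bij_betw_def)
  qed
  moreover have "B ` halves \<tau> = \<Union>(splits S \<tau>)"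
  proof -
    have "S - B f \<in> B ` halves \<tau>" if "f \<in> halves \<tau>" for f
      using branch_opp[OF that] half(1)[OF that] by (metis imageI)
    then show ?thesis by (auto simp: splits_eq)
  qed
  ultimately show ?thesis by (simp add: image_Un)
qed

end

text \<open>An isomorphism is a morphism that contracts nothing, so the splits agree. Conversely,
  flags of the two trees are matched by their branches: opposite halves correspond to complements
  and common vertices to \<open>adjacent\<close>.\<close>

lemma siso_rel_iff:
  assumes "painted S W" "\<tau> \<in> stable_trees S W" "\<tau>' \<in> stable_trees S W"
  shows "(\<tau>, \<tau>') \<in> siso_rel S W \<longleftrightarrow> splits S \<tau> = splits S \<tau>'"
proof -
  interpret t: stable_tree S W \<tau>
    using assms by (simp add: stable_tree_def stable_tree_axioms_def)
  interpret t': stable_tree S W \<tau>'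
    using assms by (simp add: stable_tree_def stable_tree_axioms_def)
  show ?thesis
  proof
    assume "(\<tau>, \<tau>') \<in> siso_rel S W"
    then obtain p q where pq: "is_siso S \<tau> \<tau>' p q" by (auto simp: siso_rel_def)
    then have bp: "bij_betw p (verts \<tau>) (verts \<tau>')" and bq: "bij_betw q (flags \<tau>) (flags \<tau>')"
      and e: "\<And>f. f \<in> flags \<tau> \<Longrightarrow> base \<tau>' (q f) = p (base \<tau> f) \<and> opp \<tau>' (q f) = q (opp \<tau> f)"
      and l: "\<And>s. s \<in> S \<Longrightarrow> q (lab \<tau> s) = lab \<tau>' s"
      by (auto simp: is_siso_def)
    \<comment> \<open>Morphisms are covariant on vertices but contravariant on flags, so the inverse
      of \<open>p\<close> has to be paired with \<open>q\<close>.\<close>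
    define r where "r = the_inv_into (verts \<tau>) p"
    have br: "bij_betw r (verts \<tau>') (verts \<tau>)" unfolding r_def by (rule bij_betw_the_inv_into[OF bp])
    have rp: "r (p u) = u" if "u \<in> verts \<tau>" for u
      unfolding r_def using that bp by (simp add: bij_betw_def the_inv_into_f_f)
    have empty: "(u, w) \<in> joined \<tau>' {} \<longleftrightarrow> u = w" for u w
      by (auto simp: joined_def)
    have fl: "flags \<tau>' - q ` flags \<tau> = {}" using bq by (simp add: bij_betw_def)
    have "is_smorphism S \<tau>' \<tau> r q"
      unfolding is_smorphism_def fl empty
      using br bq e l rp by (auto simp: bij_betw_def inj_on_def)
    then interpret smorphism S W \<tau>' \<tau> r q by unfold_locales
    have "halves \<tau>' = q ` halves \<tau>"
    proof (intro equalityI subsetI)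
      fix h assume "h \<in> halves \<tau>'"
      moreover from this have "h \<in> q ` flags \<tau>" using fl t'.half(6) by blast
      ultimately show "h \<in> q ` halves \<tau>" using q_half_iff by blast
    qed (use q_half_iff in auto)
    then show "splits S \<tau> = splits S \<tau>'" using splits_q by (simp add: splits_def[of S \<tau>'])
  next
    assume eq: "splits S \<tau> = splits S \<tau>'"
    have img: "t.B ` flags \<tau> = t'.B ` flags \<tau>'" by (simp add: t.branches_eq t'.branches_eq eq)
    have inj: "inj_on t.B (flags \<tau>)" "inj_on t'.B (flags \<tau>')"
      using t.branch_inj t'.branch_inj by (auto intro: inj_onI)
    define q where "q f = the_inv_into (flags \<tau>') t'.B (t.B f)" for f
    have qB: "t'.B (q f) = t.B f" and qf: "q f \<in> flags \<tau>'" if "f \<in> flags \<tau>" for f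
    proof -
      have "t.B f \<in> t'.B ` flags \<tau>'" using img that by blast
      then show "t'.B (q f) = t.B f" "q f \<in> flags \<tau>'" unfolding q_def
        using inj(2) the_inv_into_into[OF inj(2), of "t.B f"] by (auto simp: f_the_inv_into_f)
    qed
    have qI: "q f = g" if "f \<in> flags \<tau>" "g \<in> flags \<tau>'" "t'.B g = t.B f" for f g
      using t'.branch_inj qB qf that by metis
    have qsurj: "\<exists>f\<in>flags \<tau>. q f = g" if "g \<in> flags \<tau>'" for g
    proof -
      have "t'.B g \<in> t.B ` flags \<tau>" using img that by blast
      then show ?thesis using qI that by (metis imageE)
    qed
    have bq: "bij_betw q (flags \<tau>) (flags \<tau>')"
    proof (rule bij_betwI')
      fix f g assume fg: "f \<in> flags \<tau>" "g \<in> flags \<tau>"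
      show "q f = q g \<longleftrightarrow> f = g"
        using qB[OF fg(1)] qB[OF fg(2)] t.branch_inj[OF fg] by auto
    next
      fix g assume "g \<in> flags \<tau>'"
      from qsurj[OF this] show "\<exists>f\<in>flags \<tau>. g = q f" by auto
    qed (rule qf)
    have qlab: "q (lab \<tau> s) = lab \<tau>' s" if "s \<in> S" for s
    proof (rule qI)
      show "t'.B (lab \<tau>' s) = t.B (lab \<tau> s)"
        using t.branch_tail[OF t.lab_tail[OF that] that refl]
          t'.branch_tail[OF t'.lab_tail[OF that] that refl] by simp
    qed (use that in simp_all)
    have qopp: "opp \<tau>' (q f) = q (opp \<tau> f)" if f: "f \<in> flags \<tau>" for f
    proof (cases "f \<in> tails \<tau>")
      case True
      then obtain s where "s \<in> S" "lab \<tau> s = f" using t.tail_labE by blast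
      then have "q f \<in> tails \<tau>'" using qlab t'.lab_tail by auto
      then show ?thesis using True by (simp add: tails_def)
    next
      case False
      then have fh: "f \<in> halves \<tau>" using t.tail_or_half f by blast
      \<comment> \<open>Tails are recognized by having branches of one element.\<close>
      have "q f \<in> halves \<tau>'"
      proof (rule ccontr)
        assume "q f \<notin> halves \<tau>'"
        then obtain s where "t'.B (q f) = {s}" using t'.tail_or_half[OF qf[OF f]] t'.tail_labE t'.branch_tail by metis
        then show False using t.branch_card[OF fh] qB[OF f] by simp
      qed
      then have "t'.B (opp \<tau>' (q f)) = t.B (opp \<tau> f)" "opp \<tau>' (q f) \<in> flags \<tau>'"
        using t'.branch_opp t.branch_opp[OF fh] qB[OF f] by auto
      then show ?thesis using qI[of "opp \<tau> f" "opp \<tau>' (q f)"] fh by simp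
    qed
    have adj: "t.adjacent X Y = t'.adjacent X Y" for X Y
      by (simp add: t.adjacent_def t'.adjacent_def img)
    have qbase: "base \<tau>' (q f) = base \<tau>' (q g) \<longleftrightarrow> base \<tau> f = base \<tau> g"
      if "f \<in> flags \<tau>" "g \<in> flags \<tau>" for f g
      using t.base_eq_iff[OF that] t'.base_eq_iff[OF qf[OF that(1)] qf[OF that(2)]] qB that adj by simp
    \<comment> \<open>Any flag at \<open>u\<close> determines the image vertex; by
      \<open>qbase\<close> the choice does not affect it.\<close>
    define p where "p u = base \<tau>' (q (SOME f. f \<in> flags_at \<tau> u))" for u
    have pbase: "p (base \<tau> f) = base \<tau>' (q f)" if "f \<in> flags \<tau>" for f
    proof -
      have "f \<in> flags_at \<tau> (base \<tau> f)" using that by (simp add: flags_at_def)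
      then have "(SOME g. g \<in> flags_at \<tau> (base \<tau> f)) \<in> flags_at \<tau> (base \<tau> f)" by (rule someI)
      then show ?thesis unfolding p_def using qbase that by (auto simp: flags_at_def)
    qed
    have ex: "\<exists>f\<in>flags \<tau>. base \<tau> f = u" if "u \<in> verts \<tau>" for u
      using t.third_flag[OF that] by (auto simp: flags_at_def)
    have ex': "\<exists>f\<in>flags \<tau>'. base \<tau>' f = u" if "u \<in> verts \<tau>'" for u
      using t'.third_flag[OF that] by (auto simp: flags_at_def)
    have "bij_betw p (verts \<tau>) (verts \<tau>')"
      unfolding bij_betw_def
    proof
      show "inj_on p (verts \<tau>)"
      proof (rule inj_onI)
        fix u w assume "u \<in> verts \<tau>" "w \<in> verts \<tau>" "p u = p w"
        moreover from this obtain f g where "f \<in> flags \<tau>" "base \<tau> f = u" "g \<in> flags \<tau>" "base \<tau> g = w"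
          using ex by metis
        ultimately show "u = w" using pbase qbase by metis
      qed
      show "p ` verts \<tau> = verts \<tau>'"
      proof (intro equalityI subsetI)
        fix u assume "u \<in> p ` verts \<tau>"
        then obtain w where w: "w \<in> verts \<tau>" "u = p w" by blast
        then obtain f where "f \<in> flags \<tau>" "base \<tau> f = w" using ex by blast
        then show "u \<in> verts \<tau>'" using pbase qf w by auto
      next
        fix u assume "u \<in> verts \<tau>'"
        then obtain g where "g \<in> flags \<tau>'" "base \<tau>' g = u" using ex' by blast
        then obtain f where f: "f \<in> flags \<tau>" "base \<tau>' (q f) = u" using qsurj by blast
        then have "u = p (base \<tau> f)" using pbase by simp
        then show "u \<in> p ` verts \<tau>" using f by simp
      qed
    qed
    then have "is_siso S \<tau> \<tau>' p q"
      using bq pbase qopp qlab by (simp add: is_siso_def)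
    then show "(\<tau>, \<tau>') \<in> siso_rel S W" using assms by (auto simp: siso_rel_def)
  qed
qed

section \<open>A tree for every compatible family of splits\<close>

lemma corolla_exists:
  assumes "painted S W"
  shows "\<exists>\<tau>\<in>stable_trees S W. splits S \<tau> = {}"
proof -
  interpret painted S W by fact
  obtain l where l: "bij_betw l S {0..<card S}" using ex_bij_betw_finite_nat[OF finite_S] by blast
  define \<tau> :: "'a stree" where
    "\<tau> = \<lparr>verts = {0}, flags = {0..<card S}, base = (\<lambda>f. 0), opp = id, lab = l\<rparr>"
  have h: "halves \<tau> = {}" "tails \<tau> = {0..<card S}" "flags_at \<tau> 0 = {0..<card S}"
    by (auto simp: \<tau>_def halves_def tails_def flags_at_def)
  obtain w where w: "w \<in> W" using card_W by fastforce
  then have "l w \<in> {0..<card S}" using bij_betwE[OF l] W_subset by blast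
  then have "lab \<tau> w \<in> flags_at \<tau> 0" unfolding h by (simp add: \<tau>_def)
  moreover have "is_tree \<tau>"
    using h(1) by (auto simp: is_tree_def is_graph_def is_loop_def \<tau>_def)
  moreover have "bij_betw (lab \<tau>) S (tails \<tau>)" using l h by (simp add: \<tau>_def)
  ultimately have "\<tau> \<in> stable_trees S W"
    using w h(3) card_S unfolding stable_trees_def is_stree_def by (auto simp: \<tau>_def)
  then show ?thesis using h(1) by (auto simp: splits_def)
qed

text \<open>Starting from the one-vertex tree, each further split breaks the tree obtained so far at
  a vertex.\<close>

lemma tree_exists:
  assumes "painted S W" and "finite T" "T \<subseteq> stable_partitions S W" "\<forall>\<sigma>\<in>T. \<forall>\<rho>\<in>T. compat \<sigma> \<rho>"
  shows "\<exists>\<tau>\<in>stable_trees S W. splits S \<tau> = T"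
  using assms(2-4)
proof (induction T)
  case empty
  then show ?case using corolla_exists[OF assms(1)] by blast
next
  case (insert \<sigma> T)
  then obtain \<tau> where "\<tau> \<in> stable_trees S W" "splits S \<tau> = T" by auto
  then show ?case using star_splits[OF assms(1), of \<tau> \<sigma>] insert by auto
qed


section \<open>Flag partitions and splits\<close>

lemma separates_pair:
  "separates {P, Q} X Y \<longleftrightarrow> P \<noteq> Q \<and> (X \<subseteq> P \<and> Y \<subseteq> Q \<or> X \<subseteq> Q \<and> Y \<subseteq> P)"
  by (auto simp: separates_def)

lemma separates_sym: "separates \<sigma> X Y \<longleftrightarrow> separates \<sigma> Y X"
  unfolding separates_def by metis

text \<open>In the language of fans, the rays of the link of \<open>T\<close>.\<close>

definition neighbours :: "'a set \<Rightarrow> 'a set \<Rightarrow> 'a set set set \<Rightarrow> 'a set set set" where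
  "neighbours S W T = {\<sigma> \<in> stable_partitions S W. \<sigma> \<notin> T \<and> (\<forall>\<rho>\<in>T. compat \<sigma> \<rho>)}"

lemma compat_iff:
  assumes "P \<subseteq> S" "X \<subseteq> S"
  shows "compat {P, S - P} {X, S - X} \<longleftrightarrow> X \<subseteq> S - P \<or> P \<subseteq> X \<or> X \<subseteq> P \<or> S - P \<subseteq> X"
proof -
  have "P \<inter> X = {} \<longleftrightarrow> X \<subseteq> S - P" "P \<inter> (S - X) = {} \<longleftrightarrow> P \<subseteq> X"
    "(S - P) \<inter> X = {} \<longleftrightarrow> X \<subseteq> P" "(S - P) \<inter> (S - X) = {} \<longleftrightarrow> S - P \<subseteq> X"
    using assms by blast+
  then show ?thesis unfolding compat_def by simp
qed

lemma neighboursD: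
  assumes "\<sigma> \<in> neighbours S W T"
  shows "\<sigma> \<in> stable_partitions S W" "\<sigma> \<notin> T" "\<rho> \<in> T \<Longrightarrow> compat \<sigma> \<rho>"
  using assms by (simp_all add: neighbours_def)

lemma stable_partition_parts:
  assumes "\<sigma> \<in> stable_partitions S W"
  shows "\<exists>P. P \<subseteq> S \<and> \<sigma> = {P, S - P} \<and> P \<noteq> S - P"
proof -
  obtain P where "P \<subseteq> S" "\<sigma> = {P, S - P}" "P \<inter> W \<noteq> {}"
    using assms unfolding stable_partitions_iff by blast
  moreover from this have "P \<noteq> S - P" by blast
  ultimately show ?thesis by blast
qed

lemma stable_partition_part_of:
  assumes "\<sigma> \<in> stable_partitions S W" "i \<in> S"
  shows "\<exists>P. P \<subseteq> S \<and> \<sigma> = {P, S - P} \<and> i \<in> P"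
proof -
  obtain P where P: "P \<subseteq> S" "\<sigma> = {P, S - P}" using stable_partition_parts[OF assms(1)] by blast
  show ?thesis
  proof (cases "i \<in> P")
    case True
    then show ?thesis using P by blast
  next
    case False
    then have "S - P \<subseteq> S \<and> \<sigma> = {S - P, S - (S - P)} \<and> i \<in> S - P"
      using P assms(2) by (simp add: double_diff insert_commute)
    then show ?thesis by (rule exI)
  qed
qed

lemma separates_part_of:
  assumes "i \<in> P"
  shows "separates {P, S - P} {i, j} Y \<longleftrightarrow> j \<in> P \<and> Y \<subseteq> S - P"
proof -
  have "P \<noteq> S - P" "i \<notin> S - P" using assms by auto
  then show ?thesis using assms by (simp add: separates_pair)
qed

text \<open>If \<open>P\<close> separates the labels, compatibility leaves only
  \<open>E \<subseteq> S - P\<close> and \<open>S - E \<subseteq> P\<close>, and both together would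
  make the splits equal. This merges the two sums of rule (3), one for each end of the edge, into a
  single sum.\<close>

lemma separates_compat_cases:
  assumes P: "P \<subseteq> S" "i \<in> P" and E: "E \<subseteq> S" "i \<in> S - E" "j \<in> S - E" "k \<in> E" "l \<in> E"
    and comp: "compat {P, S - P} {E, S - E}" and ne: "{P, S - P} \<noteq> {E, S - E}"
  shows "separates {P, S - P} {i, j} {k, l} \<longleftrightarrow>
      separates {P, S - P} {i, j} E \<or> separates {P, S - P} {k, l} (S - E)"
    and "\<not> (separates {P, S - P} {i, j} E \<and> separates {P, S - P} {k, l} (S - E))"
proof -
  have kl: "separates {P, S - P} {k, l} (S - E) \<longleftrightarrow> S - E \<subseteq> P \<and> k \<notin> P \<and> l \<notin> P"
  proof -
    have "P \<noteq> S - P" "\<not> S - E \<subseteq> S - P" using P E by auto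
    then show ?thesis using E by (auto simp: separates_pair)
  qed
  have c: "E \<subseteq> S - P \<or> P \<subseteq> E \<or> E \<subseteq> P \<or> S - P \<subseteq> E"
    using comp compat_iff[OF P(1) E(1)] by simp
  have SE: "S - P \<subseteq> E \<longleftrightarrow> S - E \<subseteq> P" using P(1) E(1) by blast
  show "separates {P, S - P} {i, j} {k, l} \<longleftrightarrow>
      separates {P, S - P} {i, j} E \<or> separates {P, S - P} {k, l} (S - E)"
    unfolding separates_part_of[OF P(2)] kl using c SE P E by auto
  have "E \<subseteq> S - P \<and> S - E \<subseteq> P \<longrightarrow> P = S - E" using P(1) by blast
  moreover have "P \<noteq> S - E" using ne E(1) by (auto simp: double_diff)
  ultimately show "\<not> (separates {P, S - P} {i, j} E \<and> separates {P, S - P} {k, l} (S - E))"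
    unfolding separates_part_of[OF P(2)] kl by blast
qed

section \<open>Sums over flag partitions as sums over compatible splits\<close>

context stable_tree
begin

definition splits_at :: "nat \<Rightarrow> 'a set set set" where
  "splits_at v = {\<sigma> \<in> neighbours S W (splits S \<tau>). \<forall>f\<in>flags_at \<tau> v. \<exists>P\<in>\<sigma>. B f \<subseteq> P}"

lemma flags_at_flag: "f \<in> flags_at \<tau> v \<Longrightarrow> f \<in> flags \<tau>"
  by (simp add: flags_at_def)

lemma branch_unique:
  assumes "f \<in> flags_at \<tau> v" "g \<in> flags_at \<tau> v" "s \<in> B f" "s \<in> B g"
  shows "f = g"
proof (rule ccontr)
  assume "f \<noteq> g"
  then show False using branch_disjoint[of f g] assms by (auto simp: flags_at_def)
qed

lemma flag_partitionE:
  assumes "\<alpha> \<in> stable_flag_partitions S W \<tau> v"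
  obtains P Q where "\<alpha> = {P, Q}" "P \<inter> Q = {}" "P \<union> Q = flags_at \<tau> v" "2 \<le> card P" "2 \<le> card Q"
    "induced_partition S \<tau> \<alpha> = {\<Union>(B ` P), \<Union>(B ` Q)}"
    "induced_partition S \<tau> \<alpha> \<in> stable_partitions S W"
proof -
  have "\<alpha> \<in> two_partitions (flags_at \<tau> v)" and c: "\<forall>P\<in>\<alpha>. 2 \<le> card P"
    and st: "induced_partition S \<tau> \<alpha> \<in> stable_partitions S W"
    using assms by (auto simp: stable_flag_partitions_def)
  then obtain P where P: "P \<subseteq> flags_at \<tau> v" "\<alpha> = {P, flags_at \<tau> v - P}"
    by (auto simp: two_partitions_iff)
  show ?thesis
  proof (rule that[OF P(2) _ _ _ _ _ st])
    show "induced_partition S \<tau> \<alpha> = {\<Union>(B ` P), \<Union>(B ` (flags_at \<tau> v - P))}"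
      by (simp add: induced_partition_def P(2))
  qed (use P c in auto)
qed

lemma Union_branch_iff:
  assumes "P \<subseteq> flags_at \<tau> v" "f \<in> flags_at \<tau> v" "s \<in> B f"
  shows "s \<in> \<Union>(B ` P) \<longleftrightarrow> f \<in> P"
  using branch_unique[OF assms(2) _ assms(3)] assms by blast

lemma flag_in_iff:
  assumes "P \<subseteq> flags_at \<tau> v" "f \<in> flags_at \<tau> v"
  shows "B f \<subseteq> \<Union>(B ` P) \<longleftrightarrow> f \<in> P"
proof -
  obtain s where "s \<in> B f" using branch_nonempty[OF flags_at_flag[OF assms(2)]] by blast
  then show ?thesis using Union_branch_iff[OF assms] by blast
qed

text \<open>Branches at \<open>v\<close> are nonempty and disjoint. Hence a set covered by the
  branches in \<open>F\<close> and meeting each of them lies in a union of branches exactly if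
  \<open>F\<close> is contained in the corresponding set of flags.\<close>

lemma separates_induced:
  assumes \<alpha>: "\<alpha> \<in> stable_flag_partitions S W \<tau> v" and sub: "F \<subseteq> flags_at \<tau> v" "G \<subseteq> flags_at \<tau> v"
    and X: "X \<subseteq> \<Union>(B ` F)" "\<And>f. f \<in> F \<Longrightarrow> X \<inter> B f \<noteq> {}"
    and Y: "Y \<subseteq> \<Union>(B ` G)" "\<And>f. f \<in> G \<Longrightarrow> Y \<inter> B f \<noteq> {}"
  shows "separates (induced_partition S \<tau> \<alpha>) X Y \<longleftrightarrow> separates \<alpha> F G"
proof -
  obtain P Q where PQ: "\<alpha> = {P, Q}" "P \<inter> Q = {}" "P \<union> Q = flags_at \<tau> v" "2 \<le> card P" "2 \<le> card Q"
    "induced_partition S \<tau> \<alpha> = {\<Union>(B ` P), \<Union>(B ` Q)}"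
    using \<alpha> by (rule flag_partitionE)
  have sb: "Z \<subseteq> \<Union>(B ` R) \<longleftrightarrow> H \<subseteq> R"
    if "R \<subseteq> flags_at \<tau> v" "H \<subseteq> flags_at \<tau> v" "Z \<subseteq> \<Union>(B ` H)" "\<And>f. f \<in> H \<Longrightarrow> Z \<inter> B f \<noteq> {}" for R H Z
  proof
    note meets = that(4)
    assume Z: "Z \<subseteq> \<Union>(B ` R)"
    show "H \<subseteq> R"
    proof
      fix f assume f: "f \<in> H"
      then obtain s where "s \<in> Z" "s \<in> B f" using meets[OF f] by blast
      then show "f \<in> R" using Union_branch_iff[OF that(1), of f s] that(2) f Z by blast
    qed
  qed (use that(3) in blast)
  have PQv: "P \<subseteq> flags_at \<tau> v" "Q \<subseteq> flags_at \<tau> v" using PQ by auto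
  obtain f where f: "f \<in> P" using PQ(4) by fastforce
  then have "\<Union>(B ` P) \<noteq> \<Union>(B ` Q)"
    using flag_in_iff[OF PQv(2), of f] PQ(2) PQv(1) by blast
  moreover have "P \<noteq> Q" using f PQ(2) by blast
  ultimately show ?thesis
    unfolding PQ(6) unfolding PQ(1) separates_pair
    using sb[OF PQv(1) sub(1) X] sb[OF PQv(2) sub(1) X] sb[OF PQv(1) sub(2) Y] sb[OF PQv(2) sub(2) Y]
    by simp
qed

text \<open>A part with two flags fits into no single branch at \<open>v\<close>, whereas every
  split of an edge has a part inside such a branch. So the induced split is new, and its part that
  misses this branch gives compatibility.\<close>

lemma induced_in_splits_at:
  assumes v: "v \<in> verts \<tau>" and \<alpha>: "\<alpha> \<in> stable_flag_partitions S W \<tau> v"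
  shows "induced_partition S \<tau> \<alpha> \<in> splits_at v"
proof -
  obtain P Q where PQ: "\<alpha> = {P, Q}" "P \<inter> Q = {}" "P \<union> Q = flags_at \<tau> v" "2 \<le> card P" "2 \<le> card Q"
    "induced_partition S \<tau> \<alpha> = {\<Union>(B ` P), \<Union>(B ` Q)}"
    "induced_partition S \<tau> \<alpha> \<in> stable_partitions S W"
    using \<alpha> by (rule flag_partitionE)
  have PQv: "P \<subseteq> flags_at \<tau> v" "Q \<subseteq> flags_at \<tau> v" using PQ by auto
  have big: "\<not> \<Union>(B ` R) \<subseteq> B k"
    if R: "R \<subseteq> flags_at \<tau> v" "2 \<le> card R" and k: "k \<in> flags_at \<tau> v" for R k
  proof
    assume sub: "\<Union>(B ` R) \<subseteq> B k"
    have "\<not> R \<subseteq> {k}" using R(2) card_mono[of "{k}" R] by auto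
    then obtain f where f: "f \<in> R" "f \<noteq> k" by blast
    then have fl: "f \<in> flags_at \<tau> v" using R by blast
    obtain s where "s \<in> B f" using branch_nonempty[OF flags_at_flag[OF fl]] by blast
    then show False using branch_unique[OF fl k] sub f by blast
  qed
  have edge: "\<exists>X\<in>\<rho>. \<exists>k\<in>flags_at \<tau> v. X \<subseteq> B k" if \<rho>: "\<rho> \<in> splits S \<tau>" for \<rho>
  proof -
    obtain h where "h \<in> halves \<tau>" "\<rho> = {B h, S - B h}" using \<rho> by (auto simp: splits_eq)
    then show ?thesis using edge_within[of h v] v by auto
  qed
  have "induced_partition S \<tau> \<alpha> \<notin> splits S \<tau>"
  proof
    assume "induced_partition S \<tau> \<alpha> \<in> splits S \<tau>"
    from edge[OF this] obtain X k where X: "X \<in> induced_partition S \<tau> \<alpha>" "k \<in> flags_at \<tau> v" "X \<subseteq> B k"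
      by (elim bexE)
    from X(1) have "X = \<Union>(B ` P) \<or> X = \<Union>(B ` Q)" unfolding PQ(6) by simp
    then show False using big[OF PQv(1) PQ(4) X(2)] big[OF PQv(2) PQ(5) X(2)] X(3) by metis
  qed
  moreover have "compat (induced_partition S \<tau> \<alpha>) \<rho>" if \<rho>: "\<rho> \<in> splits S \<tau>" for \<rho>
  proof -
    obtain X k where X: "X \<in> \<rho>" "k \<in> flags_at \<tau> v" "X \<subseteq> B k" using edge[OF \<rho>] by blast
    have dis: "\<Union>(B ` R) \<inter> X = {}" if "R \<subseteq> flags_at \<tau> v" "k \<notin> R" for R
      using Union_branch_iff[OF that(1) X(2)] X(3) that(2) by blast
    have "k \<notin> P \<or> k \<notin> Q" using PQ(2) by blast
    then have "\<Union>(B ` P) \<inter> X = {} \<or> \<Union>(B ` Q) \<inter> X = {}" using dis PQv by blast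
    then show ?thesis unfolding compat_def PQ(6) using X(1) by blast
  qed
  moreover have "\<exists>U\<in>induced_partition S \<tau> \<alpha>. B f \<subseteq> U" if "f \<in> flags_at \<tau> v" for f
  proof -
    have "f \<in> P \<or> f \<in> Q" using that PQ(3) by blast
    then show ?thesis unfolding PQ(6) by blast
  qed
  ultimately show ?thesis using PQ(7) by (simp add: splits_at_def neighbours_def)
qed

lemma splits_at_induced:
  assumes v: "v \<in> verts \<tau>" and \<sigma>: "\<sigma> \<in> splits_at v"
  shows "\<exists>\<alpha>\<in>stable_flag_partitions S W \<tau> v. induced_partition S \<tau> \<alpha> = \<sigma>"
proof -
  have st: "\<sigma> \<in> stable_partitions S W" "\<sigma> \<notin> splits S \<tau>" and at: "\<forall>f\<in>flags_at \<tau> v. \<exists>P\<in>\<sigma>. B f \<subseteq> P"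
    using \<sigma> by (auto simp: splits_at_def neighbours_def)
  obtain P where PS: "P \<subseteq> S" "\<sigma> = {P, S - P}" using st(1) unfolding stable_partitions_iff by blast
  \<comment> \<open>Fresh names are chosen in order to enter the locale \<open>splitting\<close>,
    whose \<open>part P\<close> and \<open>part (S - P)\<close> form the wanted flag
    partition.\<close>
  obtain n where n: "n \<notin> verts \<tau>" using ex_new_if_finite[OF infinite_UNIV_nat finite_verts] by blast
  obtain a where a: "a \<notin> flags \<tau>" using ex_new_if_finite[OF infinite_UNIV_nat finite_flags] by blast
  obtain b where b: "b \<notin> insert a (flags \<tau>)"
    using ex_new_if_finite[OF infinite_UNIV_nat, of "insert a (flags \<tau>)"] finite_flags by blast
  interpret splitting S W \<tau> v n a b P
    using v n a b PS st at by unfold_locales auto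
  let ?\<alpha> = "{part P, part (S - P)}"
  have co: "part (S - P) = flags_at \<tau> v - part P"
    using parts_disjoint parts_cover by (auto simp: part_def)
  have "2 \<le> card (part P)" "2 \<le> card (part (S - P))" using part_card by auto
  moreover from this have "part P \<noteq> {}" "part (S - P) \<noteq> {}" by auto
  moreover have "part P \<subseteq> flags_at \<tau> v" by (auto simp: part_def)
  ultimately have "?\<alpha> \<in> two_partitions (flags_at \<tau> v)"
    unfolding two_partitions_iff using co by metis
  moreover have "\<Union>(B ` part X) = X" if X: "X = P \<or> X = S - P" for X
    using part_label[OF X] by (auto simp: part_def)
  then have "induced_partition S \<tau> ?\<alpha> = \<sigma>" by (simp add: induced_partition_def PS(2))
  ultimately show ?thesis
    using st(1) part_card by (intro bexI[of _ ?\<alpha>]) (auto simp: stable_flag_partitions_def)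
qed

lemma induced_bij:
  assumes v: "v \<in> verts \<tau>"
  shows "bij_betw (induced_partition S \<tau>) (stable_flag_partitions S W \<tau> v) (splits_at v)"
  unfolding bij_betw_def
proof
  show "inj_on (induced_partition S \<tau>) (stable_flag_partitions S W \<tau> v)"
  proof (rule inj_on_inverseI)
    fix \<alpha> assume "\<alpha> \<in> stable_flag_partitions S W \<tau> v"
    then obtain P Q where PQ: "\<alpha> = {P, Q}" "P \<union> Q = flags_at \<tau> v"
      "induced_partition S \<tau> \<alpha> = {\<Union>(B ` P), \<Union>(B ` Q)}" by (rule flag_partitionE)
    have "{f \<in> flags_at \<tau> v. B f \<subseteq> \<Union>(B ` P)} = P" "{f \<in> flags_at \<tau> v. B f \<subseteq> \<Union>(B ` Q)} = Q"
      using flag_in_iff[of P v] flag_in_iff[of Q v] PQ(2) by blast+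
    then show "(\<lambda>U. {f \<in> flags_at \<tau> v. B f \<subseteq> U}) ` induced_partition S \<tau> \<alpha> = \<alpha>"
      unfolding PQ(3) by (simp add: PQ(1))
  qed
  show "induced_partition S \<tau> ` stable_flag_partitions S W \<tau> v = splits_at v"
    using induced_in_splits_at[OF v] splits_at_induced[OF v] by blast
qed

text \<open>The hypothesis \<open>at\<close> ensures that a split separating \<open>X\<close> from
  \<open>Y\<close> breaks the tree at \<open>v\<close> and not elsewhere. It concerns half-edges
  only, since a tail has a branch of one element.\<close>

lemma sum_split_trees:
  assumes v: "v \<in> verts \<tau>" and sub: "F \<subseteq> flags_at \<tau> v" "G \<subseteq> flags_at \<tau> v"
    and X: "X \<subseteq> \<Union>(B ` F)" "\<And>f. f \<in> F \<Longrightarrow> X \<inter> B f \<noteq> {}"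
    and Y: "Y \<subseteq> \<Union>(B ` G)" "\<And>f. f \<in> G \<Longrightarrow> Y \<inter> B f \<noteq> {}"
    and at: "\<And>\<sigma> f. \<sigma> \<in> neighbours S W (splits S \<tau>) \<Longrightarrow> separates \<sigma> X Y \<Longrightarrow> f \<in> halves \<tau> \<Longrightarrow>
      base \<tau> f = v \<Longrightarrow> \<exists>P\<in>\<sigma>. B f \<subseteq> P"
  shows "(\<Sum>\<alpha>\<in>{\<alpha> \<in> stable_flag_partitions S W \<tau> v. separates \<alpha> F G}. g (split_tree S W \<tau> \<alpha>)) =
    (\<Sum>\<sigma>\<in>{\<sigma> \<in> neighbours S W (splits S \<tau>). separates \<sigma> X Y}. g (star S W \<sigma> \<tau>))"
proof -
  let ?A = "{\<alpha> \<in> stable_flag_partitions S W \<tau> v. separates \<alpha> F G}"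
  let ?B = "{\<sigma> \<in> neighbours S W (splits S \<tau>). separates \<sigma> X Y}"
  note bij = induced_bij[OF v]
  have sep: "separates (induced_partition S \<tau> \<alpha>) X Y \<longleftrightarrow> separates \<alpha> F G"
    if "\<alpha> \<in> stable_flag_partitions S W \<tau> v" for \<alpha>
    by (rule separates_induced[OF that sub X Y])
  have "induced_partition S \<tau> ` ?A = {\<sigma> \<in> splits_at v. separates \<sigma> X Y}"
  proof (intro equalityI subsetI)
    fix \<sigma> assume "\<sigma> \<in> induced_partition S \<tau> ` ?A"
    then show "\<sigma> \<in> {\<sigma> \<in> splits_at v. separates \<sigma> X Y}"
      using sep bij by (auto simp: bij_betw_def)
  next
    fix \<sigma> assume \<sigma>: "\<sigma> \<in> {\<sigma> \<in> splits_at v. separates \<sigma> X Y}"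
    then obtain \<alpha> where "\<alpha> \<in> stable_flag_partitions S W \<tau> v" "induced_partition S \<tau> \<alpha> = \<sigma>"
      using splits_at_induced[OF v] by blast
    then show "\<sigma> \<in> induced_partition S \<tau> ` ?A" using sep \<sigma> by auto
  qed
  also have "{\<sigma> \<in> splits_at v. separates \<sigma> X Y} = ?B"
  proof -
    have "\<exists>P\<in>\<sigma>. B f \<subseteq> P" if \<sigma>: "\<sigma> \<in> ?B" and f: "f \<in> flags_at \<tau> v" for \<sigma> f
    proof (cases "f \<in> halves \<tau>")
      case True
      then show ?thesis using at[of \<sigma> f] \<sigma> f by (auto simp: flags_at_def)
    next
      case False
      then obtain s where s: "s \<in> S" "B f = {s}"
        using tail_or_half[OF flags_at_flag[OF f]] tail_labE branch_tail by metis
      have "\<sigma> \<in> stable_partitions S W" using \<sigma> by (simp add: neighbours_def)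
      then have "\<exists>P\<in>\<sigma>. s \<in> P" using s(1) unfolding stable_partitions_iff by blast
      then show ?thesis using s(2) by auto
    qed
    then show ?thesis by (auto simp: splits_at_def)
  qed
  finally have img: "induced_partition S \<tau> ` ?A = ?B" .
  have "inj_on (induced_partition S \<tau>) ?A"
    using bij by (rule inj_on_subset[OF bij_betw_imp_inj_on]) blast
  then have "bij_betw (induced_partition S \<tau>) ?A ?B" using img by (simp add: bij_betw_def)
  from sum.reindex_bij_betw[OF this, of "\<lambda>\<sigma>. g (star S W \<sigma> \<tau>)"]
  show ?thesis by (simp add: split_tree_def)
qed

lemma neighbour_branch_cases:
  assumes \<sigma>: "\<sigma> \<in> neighbours S W (splits S \<tau>)" and f: "f \<in> halves \<tau>"
  shows "\<exists>P\<in>\<sigma>. B f \<subseteq> P \<or> P \<subseteq> B f"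
proof -
  obtain P where P: "P \<subseteq> S" "\<sigma> = {P, S - P}"
    using stable_partition_parts[OF neighboursD(1)[OF \<sigma>]] by blast
  have "{B f, S - B f} \<in> splits S \<tau>" using f by (simp add: splits_eq)
  then have "compat \<sigma> {B f, S - B f}" using neighboursD(3)[OF \<sigma>] by blast
  then have "B f \<subseteq> S - P \<or> P \<subseteq> B f \<or> B f \<subseteq> P \<or> S - P \<subseteq> B f"
    unfolding P(2) using compat_iff[OF P(1) branch_subset[OF half(6)[OF f]]] by simp
  then show ?thesis unfolding P(2) by auto
qed

text \<open>A compatible split puts \<open>B f\<close> inside a part or a part inside
  \<open>B f\<close>. The latter is impossible because each part contains two of the labels, which
  lie on different branches.\<close>

lemma vertex_sum:
  assumes v: "v \<in> verts \<tau>" and fl: "{I, J, K, L} \<subseteq> flags_at \<tau> v" "distinct [I, J, K, L]"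
    and lab: "i \<in> B I" "j \<in> B J" "k \<in> B K" "l \<in> B L"
  shows "(\<Sum>\<alpha>\<in>{\<alpha> \<in> stable_flag_partitions S W \<tau> v. separates \<alpha> {I, J} {K, L}}. g (split_tree S W \<tau> \<alpha>)) =
    (\<Sum>\<sigma>\<in>{\<sigma> \<in> neighbours S W (splits S \<tau>). separates \<sigma> {i, j} {k, l}}. g (star S W \<sigma> \<tau>))"
proof (rule sum_split_trees[OF v])
  fix \<sigma> f assume \<sigma>: "\<sigma> \<in> neighbours S W (splits S \<tau>)" "separates \<sigma> {i, j} {k, l}"
    and f: "f \<in> halves \<tau>" "base \<tau> f = v"
  have fv: "f \<in> flags_at \<tau> v" using f by (simp add: flags_at_def)
  obtain P where P: "P \<subseteq> S" "\<sigma> = {P, S - P}"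
    using stable_partition_parts[OF neighboursD(1)[OF \<sigma>(1)]] by blast
  have "\<not> (i \<in> B f \<and> j \<in> B f)" "\<not> (k \<in> B f \<and> l \<in> B f)"
    using branch_unique[OF fv] lab fl by auto
  then have "\<not> X \<subseteq> B f" if "X \<in> \<sigma>" for X
    using that \<sigma>(2) unfolding P(2) separates_pair by blast
  then show "\<exists>P\<in>\<sigma>. B f \<subseteq> P" using neighbour_branch_cases[OF \<sigma>(1) f(1)] by blast
qed (use fl lab in auto)

text \<open>Now a part may lie inside \<open>B f\<close>, but only the one that contains
  \<open>B e\<close>. This forces \<open>f = e\<close>, and \<open>B e\<close> lies in one part
  anyway.\<close>

lemma half_sum:
  assumes e: "e \<in> halves \<tau>" "base \<tau> e = v"
    and fl: "I \<in> flags_at \<tau> v" "J \<in> flags_at \<tau> v" "I \<noteq> J"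
    and lab: "i \<in> B I" "j \<in> B J"
  shows "(\<Sum>\<alpha>\<in>{\<alpha> \<in> stable_flag_partitions S W \<tau> v. separates \<alpha> {I, J} {e}}. g (split_tree S W \<tau> \<alpha>)) =
    (\<Sum>\<sigma>\<in>{\<sigma> \<in> neighbours S W (splits S \<tau>). separates \<sigma> {i, j} (B e)}. g (star S W \<sigma> \<tau>))"
proof (rule sum_split_trees)
  have ev: "e \<in> flags_at \<tau> v" using e by (simp add: flags_at_def)
  show "v \<in> verts \<tau>" using e by auto
  show "{e} \<subseteq> flags_at \<tau> v" using ev by simp
  show "\<And>f. f \<in> {e} \<Longrightarrow> B e \<inter> B f \<noteq> {}" using branch_nonempty e by simp
  fix \<sigma> f assume \<sigma>: "\<sigma> \<in> neighbours S W (splits S \<tau>)" "separates \<sigma> {i, j} (B e)"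
    and f: "f \<in> halves \<tau>" "base \<tau> f = v"
  have fv: "f \<in> flags_at \<tau> v" using f by (simp add: flags_at_def)
  obtain P0 where P0: "P0 \<subseteq> S" "\<sigma> = {P0, S - P0}"
    using stable_partition_parts[OF neighboursD(1)[OF \<sigma>(1)]] by blast
  obtain P where P: "P \<subseteq> S" "\<sigma> = {P, S - P}" "{i, j} \<subseteq> P" "B e \<subseteq> S - P"
  proof (cases "{i, j} \<subseteq> P0 \<and> B e \<subseteq> S - P0")
    case True
    then show ?thesis using that P0 by blast
  next
    case False
    then have "{i, j} \<subseteq> S - P0" "B e \<subseteq> P0" using \<sigma>(2) unfolding P0(2) separates_pair by auto
    moreover have "\<sigma> = {S - P0, S - (S - P0)}" using P0 by (simp add: double_diff insert_commute)
    ultimately show ?thesis using that[of "S - P0"] P0(1) by (simp add: double_diff)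
  qed
  have nP: "\<not> P \<subseteq> B f" using branch_unique[OF fv] lab fl P(3) by blast
  show "\<exists>X\<in>\<sigma>. B f \<subseteq> X"
  proof (cases "S - P \<subseteq> B f")
    case True
    then have "B e \<subseteq> B f" using P(4) by blast
    moreover obtain s where "s \<in> B e" using branch_nonempty[OF half(6)[OF e(1)]] by blast
    ultimately have "f = e" using branch_unique[OF fv ev] by blast
    then show ?thesis using P(2,4) by blast
  next
    case False
    then show ?thesis using neighbour_branch_cases[OF \<sigma>(1) f(1)] nP P(2) by blast
  qed
qed (use fl lab in auto)

text \<open>The translation of rule (3): its two sums become one sum over the link, for labels that
  are separated by the given edge and by no other edge of the tree.\<close>

lemma edge_sum:
  assumes e: "e1 \<in> halves \<tau>" "e2 = opp \<tau> e1"
    and IJ: "I \<in> flags_at \<tau> (base \<tau> e1) - {e1}" "J \<in> flags_at \<tau> (base \<tau> e1) - {e1}" "I \<noteq> J"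
    and KL: "K \<in> flags_at \<tau> (base \<tau> e2) - {e2}" "L \<in> flags_at \<tau> (base \<tau> e2) - {e2}" "K \<noteq> L"
    and lab: "i \<in> B I" "j \<in> B J" "k \<in> B K" "l \<in> B L"
  shows "(\<Sum>\<alpha>\<in>{\<alpha> \<in> stable_flag_partitions S W \<tau> (base \<tau> e1). separates \<alpha> {I, J} {e1}}. g (split_tree S W \<tau> \<alpha>)) +
      (\<Sum>\<beta>\<in>{\<beta> \<in> stable_flag_partitions S W \<tau> (base \<tau> e2). separates \<beta> {e2} {K, L}}. g (split_tree S W \<tau> \<beta>)) =
    (\<Sum>\<sigma>\<in>{\<sigma> \<in> neighbours S W (splits S \<tau>). separates \<sigma> {i, j} {k, l}}. g (star S W \<sigma> \<tau>))" (is ?sum)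
    and "separates (edge_partition S \<tau> e1) {i, j} {k, l}" (is ?sep)
    and "\<And>\<rho>. \<rho> \<in> splits S \<tau> \<Longrightarrow> separates \<rho> {i, j} {k, l} \<Longrightarrow> \<rho> = edge_partition S \<tau> e1" (is "PROP ?only")
proof -
  have e2: "e2 \<in> halves \<tau>" "opp \<tau> e2 = e1" using e by auto
  have ev: "e1 \<in> flags_at \<tau> (base \<tau> e1)" "e2 \<in> flags_at \<tau> (base \<tau> e2)" using e(1) e2(1) by (auto simp: flags_at_def)
  have co: "B e2 = S - B e1" "B e1 \<subseteq> S" using branch_opp[OF e(1)] branch_subset[of e1] e by auto
  have "B I \<subseteq> B e2" "B J \<subseteq> B e2"
    using branch_subset_opp[OF e2(1)] IJ e2(2) by (auto simp: flags_at_def)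
  moreover have "B K \<subseteq> B e1" "B L \<subseteq> B e1"
    using branch_subset_opp[OF e(1)] KL e(2) by (auto simp: flags_at_def)
  ultimately have lab': "i \<in> B e2" "j \<in> B e2" "k \<in> B e1" "l \<in> B e1" using lab by auto
  have ep: "edge_partition S \<tau> e1 = {B e1, B e2}" using edge_partition_branch[OF e(1)] co by simp
  have "B e1 \<noteq> B e2" using lab'(1) co(1) by blast
  then show ?sep unfolding ep separates_pair using lab' by blast
  show "PROP ?only"
  proof -
    fix \<rho> assume \<rho>: "\<rho> \<in> splits S \<tau>" "separates \<rho> {i, j} {k, l}"
    then obtain h where h: "h \<in> halves \<tau>" "\<rho> = {B h, S - B h}" by (auto simp: splits_eq)
    have sub: "B h \<subseteq> S" using branch_subset h by auto
    obtain f where f: "f \<in> flags_at \<tau> (base \<tau> e1)" "B h \<subseteq> B f \<or> S - B h \<subseteq> B f"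
      using edge_within[OF h(1), of "base \<tau> e1"] e(1) by auto
    obtain f' where f': "f' \<in> flags_at \<tau> (base \<tau> e2)" "B h \<subseteq> B f' \<or> S - B h \<subseteq> B f'"
      using edge_within[OF h(1), of "base \<tau> e2"] e2(1) by auto
    have nij: "\<not> (i \<in> B f \<and> j \<in> B f)" using branch_unique[OF f(1)] IJ lab by auto
    have nkl: "\<not> (k \<in> B f' \<and> l \<in> B f')" using branch_unique[OF f'(1)] KL lab by auto
    \<comment> \<open>A part of \<rho> inside a branch at the base of \<open>e1\<close> cannot hold
      both \<open>i\<close> and \<open>j\<close>, which lie on different branches. So it holds
      \<open>k\<close> and \<open>l\<close>, and the branch is that of \<open>e1\<close>; the other
      end is symmetric.\<close>
    have "k \<in> B f" using f(2) nij \<rho>(2) unfolding h(2) separates_pair by blast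
    then have fe: "f = e1" using branch_unique[OF f(1) ev(1)] lab' by blast
    have "i \<in> B f'" using f'(2) nkl \<rho>(2) unfolding h(2) separates_pair by blast
    then have fe': "f' = e2" using branch_unique[OF f'(1) ev(2)] lab' by blast
    have "B h = B e1 \<or> B h = B e2"
      using f(2) f'(2) co sub lab' \<rho>(2) unfolding h(2) fe fe' separates_pair by blast
    then show "\<rho> = edge_partition S \<tau> e1"
      unfolding h(2) ep using co by (auto simp: double_diff)
  qed
  let ?N = "neighbours S W (splits S \<tau>)"
  have fin: "finite ?N" using finite_partitions by (simp add: neighbours_def)
  have part: "separates \<sigma> {i, j} {k, l} \<longleftrightarrow> separates \<sigma> {i, j} (B e1) \<or> separates \<sigma> {k, l} (B e2)"
    and dis: "\<not> (separates \<sigma> {i, j} (B e1) \<and> separates \<sigma> {k, l} (B e2))"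
    if \<sigma>: "\<sigma> \<in> ?N" for \<sigma>
  proof -
    have "i \<in> S" using lab' co by simp
    then obtain P where P: "P \<subseteq> S" "\<sigma> = {P, S - P}" "i \<in> P"
      using stable_partition_part_of[OF neighboursD(1)[OF \<sigma>]] by blast
    have es: "edge_partition S \<tau> e1 \<in> splits S \<tau>" using e(1) by (simp add: splits_def)
    have c: "compat {P, S - P} {B e1, S - B e1}" "{P, S - P} \<noteq> {B e1, S - B e1}"
      using neighboursD(2)[OF \<sigma>] neighboursD(3)[OF \<sigma> es] es P(2) ep co(1) by auto
    note cc = separates_compat_cases[OF P(1,3) co(2) _ _ lab'(3,4) c, of j]
    show "separates \<sigma> {i, j} {k, l} \<longleftrightarrow> separates \<sigma> {i, j} (B e1) \<or> separates \<sigma> {k, l} (B e2)"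
      and "\<not> (separates \<sigma> {i, j} (B e1) \<and> separates \<sigma> {k, l} (B e2))"
      unfolding P(2) co(1) using cc lab'(1,2) unfolding co(1) by blast+
  qed
  have "{\<sigma> \<in> ?N. separates \<sigma> {i, j} {k, l}} =
      {\<sigma> \<in> ?N. separates \<sigma> {i, j} (B e1)} \<union> {\<sigma> \<in> ?N. separates \<sigma> {k, l} (B e2)}"
    using part by auto
  moreover have "{\<sigma> \<in> ?N. separates \<sigma> {i, j} (B e1)} \<inter> {\<sigma> \<in> ?N. separates \<sigma> {k, l} (B e2)} = {}"
    using dis by auto
  ultimately have *: "(\<Sum>\<sigma>\<in>{\<sigma> \<in> ?N. separates \<sigma> {i, j} {k, l}}. g (star S W \<sigma> \<tau>)) =
      (\<Sum>\<sigma>\<in>{\<sigma> \<in> ?N. separates \<sigma> {i, j} (B e1)}. g (star S W \<sigma> \<tau>)) +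
      (\<Sum>\<sigma>\<in>{\<sigma> \<in> ?N. separates \<sigma> {k, l} (B e2)}. g (star S W \<sigma> \<tau>))"
    using fin by (simp add: sum.union_disjoint)
  show ?sum
    unfolding * using half_sum[OF e(1) refl, of I J i j g] half_sum[OF e2(1) refl, of K L k l g] IJ KL lab
    by (simp add: separates_sym[of _ "{e2}"])
qed

text \<open>One part of \<rho> lies in a single branch at \<open>v\<close>, which cannot hold two of
  the labels.\<close>

lemma not_separated_at:
  assumes v: "v \<in> verts \<tau>" and fl: "{I, J, K, L} \<subseteq> flags_at \<tau> v" "distinct [I, J, K, L]"
    and lab: "i \<in> B I" "j \<in> B J" "k \<in> B K" "l \<in> B L" and \<rho>: "\<rho> \<in> splits S \<tau>"
  shows "\<not> separates \<rho> {i, j} {k, l}"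
proof
  assume sep: "separates \<rho> {i, j} {k, l}"
  obtain h where h: "h \<in> halves \<tau>" "\<rho> = {B h, S - B h}" using \<rho> by (auto simp: splits_eq)
  obtain f where f: "f \<in> flags_at \<tau> v" "B h \<subseteq> B f \<or> S - B h \<subseteq> B f"
    using edge_within[OF h(1) v] by blast
  have "\<not> (i \<in> B f \<and> j \<in> B f)" "\<not> (k \<in> B f \<and> l \<in> B f)"
    using branch_unique[OF f(1)] lab fl by auto
  then show False using f(2) sep unfolding h(2) separates_pair by blast
qed

text \<open>Call a set small if it contains at most one of the four labels. If no edge separates
  them two against two, every edge has a small side, and a vertex with only small branches sees the
  labels behind four different flags.\<close>

lemma quadruple_center:
  assumes q: "{i, j, k, l} \<subseteq> S" "distinct [i, j, k, l]"
    and ns: "\<And>\<rho>. \<rho> \<in> splits S \<tau> \<Longrightarrow> \<not> separates \<rho> {i, j} {k, l} \<and> \<not> separates \<rho> {k, j} {i, l} \<and>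
      \<not> separates \<rho> {i, k} {j, l}"
  shows "\<exists>v\<in>verts \<tau>. \<exists>I J K L. {I, J, K, L} \<subseteq> flags_at \<tau> v \<and> distinct [I, J, K, L] \<and>
    i \<in> B I \<and> j \<in> B J \<and> k \<in> B K \<and> l \<in> B L"
proof -
  define small where "small X \<longleftrightarrow> (\<forall>x\<in>{i, j, k, l}. \<forall>y\<in>{i, j, k, l}. x \<in> X \<longrightarrow> y \<in> X \<longrightarrow> x = y)" for X
  have "\<exists>v\<in>verts \<tau>. \<forall>f\<in>flags_at \<tau> v. small (B f)"
  proof (rule center_exists)
    fix f assume f: "f \<in> halves \<tau>"
    then have "{B f, S - B f} \<in> splits S \<tau>" by (simp add: splits_eq)
    note n = ns[OF this, unfolded separates_pair]
    have "B f \<noteq> S - B f" using branch_nonempty[of f] f by auto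
    then have "\<not> (i \<in> B f \<and> j \<in> B f \<and> k \<notin> B f \<and> l \<notin> B f)" "\<not> (i \<notin> B f \<and> j \<notin> B f \<and> k \<in> B f \<and> l \<in> B f)"
      "\<not> (k \<in> B f \<and> j \<in> B f \<and> i \<notin> B f \<and> l \<notin> B f)" "\<not> (k \<notin> B f \<and> j \<notin> B f \<and> i \<in> B f \<and> l \<in> B f)"
      "\<not> (i \<in> B f \<and> k \<in> B f \<and> j \<notin> B f \<and> l \<notin> B f)" "\<not> (i \<notin> B f \<and> k \<notin> B f \<and> j \<in> B f \<and> l \<in> B f)"
      using n q(1) by auto
    then show "small (B f) \<or> small (B (opp \<tau> f))"
      unfolding small_def branch_opp[OF f] by auto
  qed (auto simp: small_def)
  then obtain v where v: "v \<in> verts \<tau>" "\<forall>f\<in>flags_at \<tau> v. small (B f)" by blast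
  obtain I J K L where fl: "I \<in> flags_at \<tau> v" "J \<in> flags_at \<tau> v" "K \<in> flags_at \<tau> v" "L \<in> flags_at \<tau> v"
    and lab: "i \<in> B I" "j \<in> B J" "k \<in> B K" "l \<in> B L"
    using branch_cover[OF v(1)] q(1) by (metis insert_subset)
  have sm: "x = y" if "f \<in> flags_at \<tau> v" "x \<in> B f" "y \<in> B f" "x \<in> {i, j, k, l}" "y \<in> {i, j, k, l}" for f x y
    using v(2) that unfolding small_def by blast
  have "distinct [I, J, K, L]"
    using sm[of I i j] sm[of I i k] sm[of I i l] sm[of J j k] sm[of J j l] sm[of K k l] fl lab q(2) by auto
  then show ?thesis using v(1) fl lab by (intro bexI[of _ v] exI[of _ I] exI[of _ J] exI[of _ K] exI[of _ L]) auto
qed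

end


section \<open>Linear relations modulo local relations\<close>

definition families :: "'a set \<Rightarrow> 'a set \<Rightarrow> 'a set set set set" where
  "families S W = {T. T \<subseteq> stable_partitions S W \<and> (\<forall>\<sigma>\<in>T. \<forall>\<rho>\<in>T. compat \<sigma> \<rho>)}"

lemma familiesD:
  assumes "T \<in> families S W"
  shows "\<sigma> \<in> T \<Longrightarrow> \<sigma> \<in> stable_partitions S W" "\<sigma> \<in> T \<Longrightarrow> \<rho> \<in> T \<Longrightarrow> compat \<sigma> \<rho>"
  using assms by (auto simp: families_def)

lemma separates_iff:
  assumes "P \<subseteq> S" "{i, j, k, l} \<subseteq> S"
  shows "separates {P, S - P} {i, j} {k, l} \<longleftrightarrow>
    i \<in> P \<and> j \<in> P \<and> k \<notin> P \<and> l \<notin> P \<or> i \<notin> P \<and> j \<notin> P \<and> k \<in> P \<and> l \<in> P"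
proof -
  have "P \<noteq> S - P" using assms by blast
  then show ?thesis using assms(2) unfolding separates_pair by auto
qed

text \<open>The four points witness that all four intersections of parts are nonempty.\<close>

lemma compat_points:
  assumes "P \<subseteq> S" "Q \<subseteq> S" "compat {P, S - P} {Q, S - Q}"
    and "x \<in> P" "x \<in> Q" "y \<in> P" "y \<notin> Q" "z \<in> Q" "z \<notin> P" "w \<in> S" "w \<notin> P" "w \<notin> Q"
  shows False
  using assms(3) unfolding compat_iff[OF assms(1,2)] using assms(4-) by blast

lemma separates_subset:
  assumes "separates \<sigma> {i, j} {k, l}" "\<sigma> \<in> stable_partitions S W"
  shows "{i, j, k, l} \<subseteq> S"
proof -
  obtain P where "P \<subseteq> S" "\<sigma> = {P, S - P}" using stable_partition_parts[OF assms(2)] by blast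
  then show ?thesis using assms(1) unfolding separates_def by auto
qed

lemma separates_distinct:
  assumes "separates \<sigma> {i, j} {k, l}" "\<sigma> \<in> stable_partitions S W"
  shows "i \<noteq> k" "i \<noteq> l" "j \<noteq> k" "j \<noteq> l"
proof -
  obtain P where P: "P \<subseteq> S" "\<sigma> = {P, S - P}" using stable_partition_parts[OF assms(2)] by blast
  show "i \<noteq> k" "i \<noteq> l" "j \<noteq> k" "j \<noteq> l"
    using assms(1) unfolding P(2) separates_iff[OF P(1) separates_subset[OF assms]] by auto
qed

text \<open>The four labels occupy the four intersections of parts.\<close>

lemma separates_incompatible:
  assumes \<sigma>: "separates \<sigma> {i, j} {k, l}" "\<sigma> \<in> stable_partitions S W"
    and \<rho>: "separates \<rho> {k, j} {i, l}" "\<rho> \<in> stable_partitions S W"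
  shows "\<not> compat \<sigma> \<rho>"
proof
  assume c: "compat \<sigma> \<rho>"
  have sub: "{i, j, k, l} \<subseteq> S" "{k, j, i, l} \<subseteq> S" "{j, i, k, l} \<subseteq> S" "{j, k, i, l} \<subseteq> S"
    using separates_subset[OF \<sigma>] by auto
  obtain P where P: "P \<subseteq> S" "\<sigma> = {P, S - P}" "j \<in> P"
    using stable_partition_part_of[OF \<sigma>(2), of j] sub by blast
  obtain Q where Q: "Q \<subseteq> S" "\<rho> = {Q, S - Q}" "j \<in> Q"
    using stable_partition_part_of[OF \<rho>(2), of j] sub by blast
  have "i \<in> P" "k \<notin> P" "l \<notin> P"
    using \<sigma>(1) P(3) unfolding P(2) separates_iff[OF P(1) sub(1)] by auto
  moreover have "k \<in> Q" "i \<notin> Q" "l \<notin> Q"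
    using \<rho>(1) Q(3) unfolding Q(2) separates_iff[OF Q(1) sub(2)] by auto
  ultimately show False
    using compat_points[OF P(1) Q(1), of j i k l] c P(2,3) Q(2,3) sub by auto
qed

text \<open>The pairs that must contain a white element are the sides of the 4-cycle
  \<open>i\<close>, \<open>j\<close>, \<open>k\<close>, \<open>l\<close>, and a vertex cover of a
  4-cycle contains two opposite vertices.\<close>

lemma allowed_iff:
  "allowed S W i j k l \<longleftrightarrow>
    {i, j, k, l} \<subseteq> S \<and> distinct [i, j, k, l] \<and> (i \<in> W \<and> k \<in> W \<or> j \<in> W \<and> l \<in> W)"
proof -
  let ?X = "{i, j, k, l}"
  have st: "{{a, b}, {c, d}} \<in> stable_partitions ?X (W \<inter> ?X) \<longleftrightarrow> (a \<in> W \<or> b \<in> W) \<and> (c \<in> W \<or> d \<in> W)"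
    if "distinct [a, b, c, d]" "{a, b, c, d} = ?X" for a b c d
  proof -
    have X: "?X - {a, b} = {c, d}" unfolding that(2)[symmetric] using that(1) by auto
    have "{{a, b}, {c, d}} \<in> two_partitions ?X"
      unfolding two_partitions_iff using that X by (intro exI[of _ "{a, b}"]) auto
    then show ?thesis using that by (auto simp: stable_partitions_def)
  qed
  show ?thesis
  proof (cases "distinct [i, j, k, l]")
    case True
    then have "distinct [k, j, i, l]" "{k, j, i, l} = ?X" by auto
    then show ?thesis unfolding allowed_def using st[of i j k l] st[of k j i l] True by auto
  qed (unfold allowed_def, blast)
qed

text \<open>Here \<open>E T\<close> stands for the generator of the tree with splits
  \<open>T\<close>, kept abstract, and \<open>N T X Y\<close> for the sum over those splits in the
  link that separate \<open>X\<close> from \<open>Y\<close>. The assumption \<open>J_rel\<close> is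
  the relation of homology in this language.\<close>

locale link_relations = painted S W for S W :: "'a set" +
  fixes E :: "'a set set set \<Rightarrow> 'm::ab_group_add" and J :: "'m set"
    and N :: "'a set set set \<Rightarrow> 'a set \<Rightarrow> 'a set \<Rightarrow> 'm"
  assumes J_zero: "0 \<in> J" and J_add: "x \<in> J \<Longrightarrow> y \<in> J \<Longrightarrow> x + y \<in> J" and J_minus: "x \<in> J \<Longrightarrow> - x \<in> J"
    and N_def: "N T X Y = (\<Sum>\<rho>\<in>{\<rho> \<in> neighbours S W T. separates \<rho> X Y}. E (insert \<rho> T))"
    and J_rel: "T \<in> families S W \<Longrightarrow> allowed S W i j k l \<Longrightarrow>
      (\<And>\<rho>. \<rho> \<in> T \<Longrightarrow> \<not> separates \<rho> {i, j} {k, l} \<and> \<not> separates \<rho> {k, j} {i, l} \<and>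
        \<not> separates \<rho> {i, k} {j, l}) \<Longrightarrow>
      N T {i, j} {k, l} - N T {k, j} {i, l} \<in> J"
begin

lemma finite_neighbours: "finite (neighbours S W T)"
  using finite_partitions by (simp add: neighbours_def)

lemma finite_family: "T \<in> families S W \<Longrightarrow> finite T"
  using finite_partitions finite_subset by (auto simp: families_def)

lemma N_sum: "N T X Y = (\<Sum>\<rho>\<in>neighbours S W T. if separates \<rho> X Y then E (insert \<rho> T) else 0)"
  unfolding N_def by (rule sum.inter_filter[OF finite_neighbours])

lemma N_sym: "N T X Y = N T Y X"
  unfolding N_def by (simp add: separates_sym)

lemma N_zero: "(\<And>\<rho>. \<rho> \<in> neighbours S W T \<Longrightarrow> \<not> separates \<rho> X Y) \<Longrightarrow> N T X Y = 0"
  unfolding N_sum by (rule sum.neutral) simp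

lemma J_trans: "x - y \<in> J \<Longrightarrow> y - z \<in> J \<Longrightarrow> x - z \<in> J"
  using J_add[of "x - y" "y - z"] by simp

lemma neighbour_not_crossing:
  assumes "\<sigma> \<in> T" "separates \<sigma> {i, j} {k, l}" "T \<in> families S W" "\<rho> \<in> neighbours S W T"
  shows "\<not> separates \<rho> {k, j} {i, l}"
proof
  assume "separates \<rho> {k, j} {i, l}"
  then have "\<not> compat \<sigma> \<rho>"
    using separates_incompatible[OF assms(2) familiesD(1)[OF assms(3,1)] _ neighboursD(1)[OF assms(4)]] by metis
  then show False using neighboursD(3)[OF assms(4,1)] compat_sym by metis
qed

text \<open>If a member of \<open>T\<close> separates the third pairing, a neighbour separating one
  of the other two would be incompatible with it, so both sums are empty.\<close>

lemma J_rel':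
  assumes T: "T \<in> families S W" and q: "allowed S W i j k l"
    and ns: "\<And>\<rho>. \<rho> \<in> T \<Longrightarrow> \<not> separates \<rho> {i, j} {k, l} \<and> \<not> separates \<rho> {k, j} {i, l}"
  shows "N T {i, j} {k, l} - N T {k, j} {i, l} \<in> J"
proof (cases "\<exists>\<sigma>\<in>T. separates \<sigma> {i, k} {j, l}")
  case True
  then obtain \<sigma> where \<sigma>: "\<sigma> \<in> T" "separates \<sigma> {i, k} {j, l}" by blast
  have "\<not> separates \<rho> {k, j} {i, l}" "\<not> separates \<rho> {i, j} {k, l}" if "\<rho> \<in> neighbours S W T" for \<rho>
    using neighbour_not_crossing[OF \<sigma>(1) _ T that, of i k j l]
      neighbour_not_crossing[OF \<sigma>(1) _ T that, of k i j l] \<sigma>(2) by (simp_all add: insert_commute)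
  then have "N T {i, j} {k, l} = 0" "N T {k, j} {i, l} = 0" by (simp_all add: N_zero)
  then show ?thesis using J_zero by simp
next
  case False
  then show ?thesis using J_rel[OF T q] ns by blast
qed

text \<open>The data permitted for rule (3) at \<sigma>. With a white element in each pair, the
  labels can be ordered into an allowed quadruple.\<close>

definition simple :: "'a set set set \<Rightarrow> 'a set set \<Rightarrow> 'a set \<Rightarrow> 'a set \<Rightarrow> bool" where
  "simple T \<sigma> X Y \<longleftrightarrow> \<sigma> \<in> T \<and> separates \<sigma> X Y \<and> (\<forall>\<rho>\<in>T. separates \<rho> X Y \<longrightarrow> \<rho> = \<sigma>) \<and>
    card X = 2 \<and> card Y = 2 \<and> X \<inter> W \<noteq> {} \<and> Y \<inter> W \<noteq> {}"

lemma simpleD: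
  assumes "simple T \<sigma> X Y"
  shows "\<sigma> \<in> T" "separates \<sigma> X Y" "\<rho> \<in> T \<Longrightarrow> separates \<rho> X Y \<Longrightarrow> \<rho> = \<sigma>"
    "card X = 2" "card Y = 2" "X \<inter> W \<noteq> {}" "Y \<inter> W \<noteq> {}"
  using assms unfolding simple_def by blast+

lemma card_pair_neq: "card {x, y} = 2 \<Longrightarrow> x \<noteq> y"
  by auto

lemma simple_sym: "simple T \<sigma> X Y \<longleftrightarrow> simple T \<sigma> Y X"
  by (auto simp: simple_def separates_sym[of _ X Y])

lemma white_pair:
  assumes "card X = 2" "X \<inter> W \<noteq> {}" obtains i j where "X = {i, j}" "i \<noteq> j" "i \<in> W"
  using assms by (auto simp: card_2_iff)

text \<open>On splits compatible with \<open>\<sigma>\<close> one has \<open>[xy|kl] - [xz|kl] = [yx|zk] - [zx|yk]\<close>, and the right-hand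
  side comes from an allowed quadruple that \<open>T\<close> does not separate in the relevant ways.\<close>

lemma simple_move:
  assumes T: "T \<in> families S W" and s1: "simple T \<sigma> {x, y} Y" and s2: "simple T \<sigma> {x, z} Y"
    and W: "x \<in> W \<or> y \<in> W \<and> z \<in> W"
  shows "N T {x, y} Y - N T {x, z} Y \<in> J"
proof (cases "y = z")
  case True
  then show ?thesis using J_zero by simp
next
  case False
  obtain k l where Y: "Y = {k, l}" "k \<noteq> l" "k \<in> W" using white_pair[of Y] simpleD[OF s1] by metis
  have \<sigma>: "\<sigma> \<in> T" "separates \<sigma> {x, y} {k, l}" "separates \<sigma> {x, z} {k, l}"
    and u1: "\<And>\<rho>. \<rho> \<in> T \<Longrightarrow> separates \<rho> {x, y} {k, l} \<Longrightarrow> \<rho> = \<sigma>"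
    and u2: "\<And>\<rho>. \<rho> \<in> T \<Longrightarrow> separates \<rho> {x, z} {k, l} \<Longrightarrow> \<rho> = \<sigma>"
    and xy: "x \<noteq> y" "x \<noteq> z"
    using simpleD[OF s1[unfolded Y(1)]] simpleD[OF s2[unfolded Y(1)]] card_pair_neq by metis+
  have \<sigma>V: "\<sigma> \<in> stable_partitions S W" using familiesD(1)[OF T \<sigma>(1)] .
  have xS: "x \<in> S" "y \<in> S" "z \<in> S" "k \<in> S" "l \<in> S"
    using separates_subset[OF \<sigma>(2) \<sigma>V] separates_subset[OF \<sigma>(3) \<sigma>V] by auto
  obtain P where P: "P \<subseteq> S" "\<sigma> = {P, S - P}" "x \<in> P"
    using stable_partition_part_of[OF \<sigma>V xS(1)] by blast
  have mem: "y \<in> P" "z \<in> P" "k \<notin> P" "l \<notin> P"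
    using \<sigma>(2,3) P(3) unfolding P(2) by (simp_all add: separates_iff[OF P(1)] xS)
  have cross: "separates \<rho> {x, y} {k, l} \<longleftrightarrow> y \<in> Q \<and> k \<notin> Q \<and> l \<notin> Q"
    "separates \<rho> {x, z} {k, l} \<longleftrightarrow> z \<in> Q \<and> k \<notin> Q \<and> l \<notin> Q"
    "separates \<rho> {y, x} {z, k} \<longleftrightarrow> y \<in> Q \<and> z \<notin> Q \<and> k \<notin> Q"
    "separates \<rho> {z, x} {y, k} \<longleftrightarrow> z \<in> Q \<and> y \<notin> Q \<and> k \<notin> Q"
    if "Q \<subseteq> S" "\<rho> = {Q, S - Q}" "x \<in> Q" for \<rho> Q
    using that xS by (auto simp: separates_iff)
  \<comment> \<open>Compatibility with \<sigma>: a split with \<open>x\<close> and \<open>l\<close>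
    but not \<open>k\<close> on one side must contain all of \<open>P\<close> there, in particular
    \<open>y\<close> and \<open>z\<close>.\<close>
  have comp: "y \<in> Q \<and> z \<in> Q \<or> k \<in> Q \<or> l \<notin> Q"
    if "Q \<subseteq> S" "\<rho> = {Q, S - Q}" "x \<in> Q" "compat \<sigma> \<rho>" for \<rho> Q
    using compat_points[OF P(1) that(1), of x y l k] compat_points[OF P(1) that(1), of x z l k]
      that P(2,3) mem xS by blast
  \<comment> \<open>The opposite pairs of this quadruple are \<open>y\<close>, \<open>z\<close> and
    \<open>x\<close>, \<open>k\<close>. As \<open>k\<close> is white, the colour hypothesis is just
    what makes it allowed.\<close>
  have all: "allowed S W y x z k"
    unfolding allowed_iff using xS xy False mem P(3) W Y(3) by auto
  have "N T {y, x} {z, k} - N T {z, x} {y, k} \<in> J"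
  proof (rule J_rel'[OF T all])
    fix \<rho> assume \<rho>: "\<rho> \<in> T"
    obtain Q where Q: "Q \<subseteq> S" "\<rho> = {Q, S - Q}" "x \<in> Q"
      using stable_partition_part_of[OF familiesD(1)[OF T \<rho>] xS(1)] by blast
    note c = comp[OF Q familiesD(2)[OF T \<sigma>(1) \<rho>]] and s = cross[OF Q]
    have n: "\<rho> = \<sigma> \<Longrightarrow> y \<in> Q \<and> z \<in> Q \<and> k \<notin> Q \<and> l \<notin> Q"
      using \<sigma>(2,3) s(1,2) by simp
    show "\<not> separates \<rho> {y, x} {z, k} \<and> \<not> separates \<rho> {z, x} {y, k}"
      using c n u1[OF \<rho>] u2[OF \<rho>] unfolding s by argo
  qed
  moreover have "N T {x, y} Y - N T {x, z} Y = N T {y, x} {z, k} - N T {z, x} {y, k}"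
    unfolding N_sum Y(1) sum_subtractf[symmetric]
  proof (rule sum.cong[OF refl])
    fix \<rho> assume \<rho>: "\<rho> \<in> neighbours S W T"
    obtain Q where Q: "Q \<subseteq> S" "\<rho> = {Q, S - Q}" "x \<in> Q"
      using stable_partition_part_of[OF neighboursD(1)[OF \<rho>] xS(1)] by blast
    have "compat \<sigma> \<rho>" using neighboursD(3)[OF \<rho> \<sigma>(1)] compat_sym by blast
    note c = comp[OF Q this] and s = cross[OF Q]
    show "(if separates \<rho> {x, y} {k, l} then E (insert \<rho> T) else 0) -
        (if separates \<rho> {x, z} {k, l} then E (insert \<rho> T) else 0) =
      (if separates \<rho> {y, x} {z, k} then E (insert \<rho> T) else 0) -
        (if separates \<rho> {z, x} {y, k} then E (insert \<rho> T) else 0)"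
      unfolding s using c by (cases "y \<in> Q"; cases "z \<in> Q"; cases "k \<in> Q"; cases "l \<in> Q"; simp)
  qed
  ultimately show ?thesis by simp
qed

text \<open>Two moves connect the pairs, passing through \<open>{i', j}\<close> or
  \<open>{i, i'}\<close>; with \<open>i\<close> and \<open>i'\<close> white the colour conditions
  hold. If a split of \<open>T\<close> blocks the first route, none blocks the second, since two
  blocking splits would be incompatible.\<close>

lemma simple_left:
  assumes T: "T \<in> families S W" and s: "simple T \<sigma> X Y" and s': "simple T \<sigma> X' Y"
  shows "N T X Y - N T X' Y \<in> J"
proof -
  obtain i j where X: "X = {i, j}" "i \<noteq> j" "i \<in> W" using white_pair[of X] simpleD[OF s] by metis
  obtain i' j' where X': "X' = {i', j'}" "i' \<noteq> j'" "i' \<in> W" using white_pair[of X'] simpleD[OF s'] by metis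
  have X2: "X = {j, i}" and X2': "X' = {j', i'}" using X X' by auto
  show ?thesis
  proof (cases "simple T \<sigma> {i', j} Y")
    case True
    have "N T {j, i} Y - N T {j, i'} Y \<in> J"
      by (rule simple_move[OF T]) (use s True X X' in \<open>auto simp: insert_commute\<close>)
    moreover have "N T {i', j} Y - N T {i', j'} Y \<in> J"
      by (rule simple_move[OF T True]) (use s' X' in auto)
    ultimately show ?thesis unfolding X2 X'(1) using J_trans by (simp add: insert_commute)
  next
    case False
    have "simple T \<sigma> {i, i'} Y"
    proof (cases "i' = j")
      case True
      then show ?thesis using s X by simp
    next
      case ij: False
      obtain k l where Y: "Y = {k, l}" "k \<noteq> l" "k \<in> W" using white_pair[of Y] simpleD[OF s] by metis
      have \<sigma>: "\<sigma> \<in> T" "separates \<sigma> {i, j} {k, l}" "separates \<sigma> {i', j'} {k, l}"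
        and u: "\<And>\<rho>. \<rho> \<in> T \<Longrightarrow> separates \<rho> {i, j} {k, l} \<Longrightarrow> \<rho> = \<sigma>"
        using simpleD(1-3)[OF s[unfolded X(1) Y(1)]] simpleD(2)[OF s'[unfolded X'(1) Y(1)]] by metis+
      have \<sigma>V: "\<sigma> \<in> stable_partitions S W" using familiesD(1)[OF T \<sigma>(1)] .
      have xS: "i \<in> S" "j \<in> S" "i' \<in> S" "j' \<in> S" "k \<in> S" "l \<in> S"
        using separates_subset[OF \<sigma>(2) \<sigma>V] separates_subset[OF \<sigma>(3) \<sigma>V] by auto
      obtain P where P: "P \<subseteq> S" "\<sigma> = {P, S - P}" "i' \<in> P"
        using stable_partition_part_of[OF \<sigma>V xS(3)] by blast
      have mem: "i \<in> P" "j \<in> P" "k \<notin> P" "l \<notin> P"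
        using \<sigma>(2,3) P(3) unfolding P(2) by (auto simp add: separates_iff[OF P(1)] xS)
      have sep\<sigma>: "separates \<sigma> {i, i'} {k, l}" "separates \<sigma> {i', j} {k, l}"
        unfolding P(2) using mem P(3) by (simp_all add: separates_iff[OF P(1)] xS)
      have "\<not> (\<forall>\<rho>\<in>T. separates \<rho> {i', j} {k, l} \<longrightarrow> \<rho> = \<sigma>)"
        using False s sep\<sigma> ij X' unfolding simple_def Y(1) by auto
      then obtain \<kappa> where \<kappa>: "\<kappa> \<in> T" "separates \<kappa> {i', j} {k, l}" "\<kappa> \<noteq> \<sigma>" by blast
      obtain Q where Q: "Q \<subseteq> S" "\<kappa> = {Q, S - Q}" "i' \<in> Q"
        using stable_partition_part_of[OF familiesD(1)[OF T \<kappa>(1)] xS(3)] by blast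
      have memQ: "j \<in> Q" "k \<notin> Q" "l \<notin> Q"
        using \<kappa>(2) Q(3) unfolding Q(2) by (auto simp add: separates_iff[OF Q(1)] xS)
      have "\<not> separates \<kappa> {i, j} {k, l}" using u \<kappa> by blast
      then have iQ: "i \<notin> Q" using memQ unfolding Q(2) by (simp add: separates_iff[OF Q(1)] xS)
      have "\<rho> = \<sigma>" if \<rho>: "\<rho> \<in> T" "separates \<rho> {i, i'} {k, l}" for \<rho>
      proof (rule ccontr)
        assume "\<rho> \<noteq> \<sigma>"
        obtain R where R: "R \<subseteq> S" "\<rho> = {R, S - R}" "i' \<in> R"
          using stable_partition_part_of[OF familiesD(1)[OF T \<rho>(1)] xS(3)] by blast
        have memR: "i \<in> R" "k \<notin> R" "l \<notin> R"
          using \<rho>(2) R(3) unfolding R(2) by (auto simp add: separates_iff[OF R(1)] xS)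
        have "\<not> separates \<rho> {i, j} {k, l}" using u \<rho> \<open>\<rho> \<noteq> \<sigma>\<close> by blast
        then have "j \<notin> R" using memR unfolding R(2) by (simp add: separates_iff[OF R(1)] xS)
        then show False
          using compat_points[OF Q(1) R(1), of i' j i k] familiesD(2)[OF T \<kappa>(1) \<rho>(1)] Q(2,3) R(2,3) memQ memR iQ xS
          by blast
      qed
      then have un: "\<forall>\<rho>\<in>T. separates \<rho> {i, i'} Y \<longrightarrow> \<rho> = \<sigma>" unfolding Y(1) by blast
      have "i \<noteq> i'" using iQ Q(3) by auto
      then show ?thesis using s un sep\<sigma>(1) X'(3) unfolding simple_def Y(1) by auto
    qed
    note b = this
    have b': "simple T \<sigma> {i', i} Y" using b by (simp add: insert_commute)
    have "N T {i, j} Y - N T {i, i'} Y \<in> J"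
      by (rule simple_move[OF T _ b]) (use s X in auto)
    moreover have "N T {i', i} Y - N T {i', j'} Y \<in> J"
      by (rule simple_move[OF T b']) (use s' X' in auto)
    ultimately show ?thesis unfolding X(1) X'(1) using J_trans by (simp add: insert_commute)
  qed
qed

text \<open>A further split between \<open>X'\<close> and \<open>Y\<close> would be nested with
  \<sigma>. If its part containing \<open>X'\<close> contains \<open>P\<close>, it also separates
  \<open>X\<close> from \<open>Y\<close>; if that part is contained in \<open>P\<close>, it also
  separates \<open>X'\<close> from \<open>Y'\<close>.\<close>

lemma simple_mixed:
  assumes T: "T \<in> families S W" and s: "simple T \<sigma> X Y" and s': "simple T \<sigma> X' Y'"
    and PX: "\<sigma> = {P, S - P}" "P \<subseteq> S" "X \<subseteq> P" "Y \<subseteq> S - P" "X' \<subseteq> P" "Y' \<subseteq> S - P"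
  shows "simple T \<sigma> X' Y"
proof -
  have P: "P \<noteq> S - P" using simpleD(2)[OF s] unfolding PX(1) separates_pair by blast
  have "\<rho> = \<sigma>" if \<rho>: "\<rho> \<in> T" "separates \<rho> X' Y" for \<rho>
  proof (rule ccontr)
    assume ne: "\<rho> \<noteq> \<sigma>"
    have ne': "X \<noteq> {}" "X' \<noteq> {}" "Y \<noteq> {}" "Y' \<noteq> {}" using simpleD(6,7)[OF s] simpleD(6,7)[OF s'] by auto
    then obtain x where x: "x \<in> X'" by blast
    then have xS: "x \<in> S" using PX by blast
    obtain Q where Q: "Q \<subseteq> S" "\<rho> = {Q, S - Q}" "x \<in> Q"
      using stable_partition_part_of[OF familiesD(1)[OF T \<rho>(1)] xS] by blast
    have QX: "X' \<subseteq> Q" "Y \<subseteq> S - Q" "Q \<noteq> S - Q"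
      using \<rho>(2) x Q(3) unfolding Q(2) separates_pair by auto
    have "compat \<sigma> \<rho>" by (rule familiesD(2)[OF T simpleD(1)[OF s] \<rho>(1)])
    then have "Q \<subseteq> S - P \<or> P \<subseteq> Q \<or> Q \<subseteq> P \<or> S - P \<subseteq> Q"
      unfolding PX(1) Q(2) compat_iff[OF PX(2) Q(1)] .
    moreover have "\<not> Q \<subseteq> S - P" using x Q(3) PX(5) by blast
    moreover have "\<not> S - P \<subseteq> Q" using QX(2) PX(4) ne'(3) by blast
    moreover have "\<not> P \<subseteq> Q"
    proof
      assume "P \<subseteq> Q"
      then have "separates \<rho> X Y" unfolding Q(2) separates_pair using QX PX(3) by blast
      then show False using simpleD(3)[OF s \<rho>(1)] ne by metis
    qed
    moreover have "\<not> Q \<subseteq> P"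
    proof
      assume "Q \<subseteq> P"
      then have "separates \<rho> X' Y'" unfolding Q(2) separates_pair using QX PX(6) by blast
      then show False using simpleD(3)[OF s' \<rho>(1)] ne by metis
    qed
    ultimately show False by blast
  qed
  moreover have "separates \<sigma> X' Y" unfolding PX(1) separates_pair using PX P by blast
  ultimately show ?thesis
    unfolding simple_def using simpleD(1,5,7)[OF s] simpleD(4,6)[OF s'] by blast
qed

text \<open>This is the independence of rule (3) from the quadruple: exchange the pair on one side
  of \<sigma>, then the pair on the other side.\<close>

lemma simple_independent:
  assumes T: "T \<in> families S W" and s: "simple T \<sigma> X Y" and s': "simple T \<sigma> X' Y'"
  shows "N T X Y - N T X' Y' \<in> J"
proof -
  have main: "N T X Y - N T X' Y' \<in> J"
    if s: "simple T \<sigma> X Y" and s': "simple T \<sigma> X' Y'"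
      and PX: "\<sigma> = {P, S - P}" "P \<subseteq> S" "X \<subseteq> P" "Y \<subseteq> S - P" "X' \<subseteq> P" "Y' \<subseteq> S - P" for X Y X' Y' P
  proof -
    have m: "simple T \<sigma> X' Y" by (rule simple_mixed[OF T s s' PX])
    have "N T Y X' - N T Y' X' \<in> J"
      by (rule simple_left[OF T]) (use m s' simple_sym in blast)+
    then show ?thesis
      using J_trans[OF simple_left[OF T s m]] by (simp add: N_sym[of T X'])
  qed
  have "\<sigma> \<in> stable_partitions S W" by (rule familiesD(1)[OF T simpleD(1)[OF s]])
  then obtain P0 where P0: "P0 \<subseteq> S" "\<sigma> = {P0, S - P0}" using stable_partition_parts by blast
  have "separates \<sigma> X Y" by (rule simpleD(2)[OF s])
  then obtain P where P: "P \<subseteq> S" "\<sigma> = {P, S - P}" "X \<subseteq> P" "Y \<subseteq> S - P"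
    using P0 unfolding P0(2) separates_pair by (metis Diff_subset double_diff insert_commute order_refl)
  \<comment> \<open>Relative to the part containing \<open>X\<close>, the second two pairs may come
    in either order.\<close>
  have "separates {P, S - P} X' Y'" using simpleD(2)[OF s'] P(2) by metis
  then consider "X' \<subseteq> P" "Y' \<subseteq> S - P" | "Y' \<subseteq> P" "X' \<subseteq> S - P" unfolding separates_pair by blast
  then show ?thesis
  proof cases
    case 1
    then show ?thesis using main[OF s s' P(2,1,3,4)] by blast
  next
    case 2
    have "simple T \<sigma> Y' X'" using s' simple_sym by blast
    then show ?thesis using main[OF s _ P(2,1,3,4) 2] N_sym[of T X' Y'] by simp
  qed
qed

text \<open>If \<open>x\<close> lies between two splits separating \<open>ij\<close> from \<open>kl\<close>, then \<open>[ij|kl] = [ij|xk] + [ix|kl]\<close> on all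
  splits compatible with both. Induction on the number of separating splits reduces every quadruple
  to simple ones.\<close>

lemma N_refine:
  assumes T: "T \<in> families S W" and card: "i \<noteq> j" "k \<noteq> l"
    and \<sigma>1: "\<sigma>1 \<in> T" "separates \<sigma>1 {i, j} {x, k}" "separates \<sigma>1 {i, j} {k, l}"
    and \<sigma>2: "\<sigma>2 \<in> T" "separates \<sigma>2 {i, x} {k, l}" "separates \<sigma>2 {i, j} {k, l}"
  shows "\<rho> \<in> T \<or> \<rho> \<in> neighbours S W T \<Longrightarrow> separates \<rho> {i, j} {k, l} \<longleftrightarrow>
      separates \<rho> {i, j} {x, k} \<or> separates \<rho> {i, x} {k, l}"
    and "\<rho> \<in> T \<or> \<rho> \<in> neighbours S W T \<Longrightarrow>
      \<not> (separates \<rho> {i, j} {x, k} \<and> separates \<rho> {i, x} {k, l})"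
    and "N T {i, j} {k, l} = N T {i, j} {x, k} + N T {i, x} {k, l}"
proof -
  have V: "\<sigma>1 \<in> stable_partitions S W" "\<sigma>2 \<in> stable_partitions S W"
    using familiesD(1)[OF T] \<sigma>1(1) \<sigma>2(1) by auto
  have xS: "i \<in> S" "j \<in> S" "x \<in> S" "k \<in> S" "l \<in> S"
    using separates_subset[OF \<sigma>1(2) V(1)] separates_subset[OF \<sigma>2(2) V(2)] by auto
  obtain P where P: "P \<subseteq> S" "\<sigma>1 = {P, S - P}" "i \<in> P"
    using stable_partition_part_of[OF V(1) xS(1)] by blast
  obtain P' where P': "P' \<subseteq> S" "\<sigma>2 = {P', S - P'}" "i \<in> P'"
    using stable_partition_part_of[OF V(2) xS(1)] by blast
  have m: "j \<in> P" "x \<notin> P" "k \<notin> P" "l \<notin> P" "j \<in> P'" "x \<in> P'" "k \<notin> P'" "l \<notin> P'"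
    using \<sigma>1(2,3) \<sigma>2(2,3) P(3) P'(3) unfolding P(2) P'(2)
    by (simp_all add: separates_iff[OF P(1)] separates_iff[OF P'(1)] xS)
  have *: "(separates \<rho> {i, j} {k, l} \<longleftrightarrow> separates \<rho> {i, j} {x, k} \<or> separates \<rho> {i, x} {k, l}) \<and>
      \<not> (separates \<rho> {i, j} {x, k} \<and> separates \<rho> {i, x} {k, l})"
    if \<rho>: "\<rho> \<in> stable_partitions S W" "compat \<sigma>1 \<rho>" "compat \<sigma>2 \<rho>" for \<rho>
  proof -
    obtain Q where Q: "Q \<subseteq> S" "\<rho> = {Q, S - Q}" "i \<in> Q"
      using stable_partition_part_of[OF \<rho>(1) xS(1)] by blast
    have s: "separates \<rho> {i, j} {k, l} \<longleftrightarrow> j \<in> Q \<and> k \<notin> Q \<and> l \<notin> Q"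
      "separates \<rho> {i, j} {x, k} \<longleftrightarrow> j \<in> Q \<and> x \<notin> Q \<and> k \<notin> Q"
      "separates \<rho> {i, x} {k, l} \<longleftrightarrow> x \<in> Q \<and> k \<notin> Q \<and> l \<notin> Q"
      using Q xS by (auto simp: separates_iff)
    have c1: "\<not> (j \<notin> Q \<and> x \<in> Q \<and> k \<notin> Q)"
      using compat_points[OF P(1) Q(1), of i j x k] \<rho>(2) P(2,3) Q(2,3) m xS by blast
    have c2: "\<not> (x \<notin> Q \<and> l \<in> Q \<and> k \<notin> Q)"
      using compat_points[OF P'(1) Q(1), of i x l k] \<rho>(3) P'(2,3) Q(2,3) m xS by blast
    show ?thesis unfolding s using c1 c2 by blast
  qed
  have st: "\<rho> \<in> stable_partitions S W \<and> compat \<sigma>1 \<rho> \<and> compat \<sigma>2 \<rho>" if "\<rho> \<in> T \<or> \<rho> \<in> neighbours S W T" for \<rho>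
    using that
  proof
    assume "\<rho> \<in> T"
    then show ?thesis using familiesD[OF T] \<sigma>1(1) \<sigma>2(1) by simp
  next
    assume "\<rho> \<in> neighbours S W T"
    then show ?thesis
      using neighboursD(1)[of \<rho>] neighboursD(3)[of \<rho> S W T] \<sigma>1(1) \<sigma>2(1) compat_sym by metis
  qed
  show a: "\<rho> \<in> T \<or> \<rho> \<in> neighbours S W T \<Longrightarrow> separates \<rho> {i, j} {k, l} \<longleftrightarrow>
      separates \<rho> {i, j} {x, k} \<or> separates \<rho> {i, x} {k, l}"
    and b: "\<rho> \<in> T \<or> \<rho> \<in> neighbours S W T \<Longrightarrow>
      \<not> (separates \<rho> {i, j} {x, k} \<and> separates \<rho> {i, x} {k, l})" for \<rho>
    using * st by metis+
  show "N T {i, j} {k, l} = N T {i, j} {x, k} + N T {i, x} {k, l}"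
    unfolding N_sum sum.distrib[symmetric]
  proof (rule sum.cong[OF refl])
    fix \<rho> assume "\<rho> \<in> neighbours S W T"
    then have "\<rho> \<in> T \<or> \<rho> \<in> neighbours S W T" by simp
    from a[OF this] b[OF this]
    show "(if separates \<rho> {i, j} {k, l} then E (insert \<rho> T) else 0) =
      (if separates \<rho> {i, j} {x, k} then E (insert \<rho> T) else 0) +
      (if separates \<rho> {i, x} {k, l} then E (insert \<rho> T) else 0)" by auto
  qed
qed

text \<open>The parts containing \<open>i\<close> are strictly nested, and \<open>x\<close> is any
  element of their difference; which part is the smaller one decides the alternative.\<close>

lemma between_exists:
  assumes T: "T \<in> families S W"
    and \<sigma>1: "\<sigma>1 \<in> T" "separates \<sigma>1 {i, j} {k, l}" and \<sigma>2: "\<sigma>2 \<in> T" "separates \<sigma>2 {i, j} {k, l}"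
    and ne: "\<sigma>1 \<noteq> \<sigma>2"
  shows "\<exists>x. separates \<sigma>1 {i, j} {x, k} \<and> separates \<sigma>2 {i, x} {k, l} \<or>
    separates \<sigma>2 {i, j} {x, k} \<and> separates \<sigma>1 {i, x} {k, l}"
proof -
  have V: "\<sigma>1 \<in> stable_partitions S W" "\<sigma>2 \<in> stable_partitions S W"
    using familiesD(1)[OF T] \<sigma>1(1) \<sigma>2(1) by auto
  have xS: "i \<in> S" "j \<in> S" "k \<in> S" "l \<in> S" using separates_subset[OF \<sigma>1(2) V(1)] by auto
  obtain P where P: "P \<subseteq> S" "\<sigma>1 = {P, S - P}" "i \<in> P"
    using stable_partition_part_of[OF V(1) xS(1)] by blast
  obtain P' where P': "P' \<subseteq> S" "\<sigma>2 = {P', S - P'}" "i \<in> P'"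
    using stable_partition_part_of[OF V(2) xS(1)] by blast
  have m: "j \<in> P" "k \<notin> P" "l \<notin> P" "j \<in> P'" "k \<notin> P'" "l \<notin> P'"
    using \<sigma>1(2) \<sigma>2(2) P(3) P'(3) unfolding P(2) P'(2)
    by (simp_all add: separates_iff[OF P(1)] separates_iff[OF P'(1)] xS)
  have "compat \<sigma>1 \<sigma>2" by (rule familiesD(2)[OF T \<sigma>1(1) \<sigma>2(1)])
  then have "P' \<subseteq> S - P \<or> P \<subseteq> P' \<or> P' \<subseteq> P \<or> S - P \<subseteq> P'"
    unfolding P(2) P'(2) compat_iff[OF P(1) P'(1)] .
  then have "P \<subset> P' \<or> P' \<subset> P" using ne P P' m xS by auto
  then obtain x where x: "x \<in> P' \<and> x \<notin> P \<or> x \<in> P \<and> x \<notin> P'" by blast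
  then have "x \<in> S" using P(1) P'(1) by blast
  then show ?thesis
    using x m P(3) P'(3) xS unfolding P(2) P'(2)
    by (intro exI[of _ x]) (auto simp: separates_iff[OF P(1)] separates_iff[OF P'(1)])
qed

text \<open>The base case is \<open>simple_independent\<close>. Otherwise cutting at
  \<open>x\<close> distributes the separating splits over two quadruples, each of which misses one
  of \<open>\<sigma>1\<close>, \<open>\<sigma>2\<close>, so both counts drop.\<close>

lemma N_decompose:
  assumes T: "T \<in> families S W" and pick: "\<And>\<sigma>. \<sigma> \<in> T \<Longrightarrow> simple T \<sigma> (X \<sigma>) (Y \<sigma>)"
    and "card A = 2" "card B = 2" "A \<inter> W \<noteq> {}" "B \<inter> W \<noteq> {}" "\<exists>\<sigma>\<in>T. separates \<sigma> A B"
  shows "N T A B - (\<Sum>\<sigma>\<in>{\<sigma> \<in> T. separates \<sigma> A B}. N T (X \<sigma>) (Y \<sigma>)) \<in> J"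
  using assms(3-7)
proof (induction "card {\<sigma> \<in> T. separates \<sigma> A B}" arbitrary: A B rule: less_induct)
  case less
  let ?Q = "\<lambda>A B. {\<sigma> \<in> T. separates \<sigma> A B}"
  have fin: "finite (?Q A B)" for A B using finite_family[OF T] by simp
  obtain \<sigma> where \<sigma>: "\<sigma> \<in> T" "separates \<sigma> A B" using less.prems by blast
  show ?case
  proof (cases "\<forall>\<rho>\<in>T. separates \<rho> A B \<longrightarrow> \<rho> = \<sigma>")
    case True
    then have "?Q A B = {\<sigma>}" using \<sigma> by blast
    moreover have "simple T \<sigma> A B" unfolding simple_def using True \<sigma> less.prems by blast
    ultimately show ?thesis using simple_independent[OF T _ pick[OF \<sigma>(1)]] by simp
  next
    case False
    then obtain \<rho> where \<rho>: "\<rho> \<in> T" "separates \<rho> A B" "\<rho> \<noteq> \<sigma>" by blast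
    \<comment> \<open>White labels are placed first, so that the new pairs \<open>{x, k}\<close> and
      \<open>{i, x}\<close> contain a white label whatever the colour of \<open>x\<close>.\<close>
    obtain i j where A: "A = {i, j}" "i \<noteq> j" "i \<in> W" using white_pair[of A] less.prems by metis
    obtain k l where B: "B = {k, l}" "k \<noteq> l" "k \<in> W" using white_pair[of B] less.prems by metis
    have "\<exists>x \<sigma>1 \<sigma>2. \<sigma>1 \<in> ?Q A B \<and> \<sigma>2 \<in> ?Q A B \<and> separates \<sigma>1 {i, j} {x, k} \<and> separates \<sigma>2 {i, x} {k, l}"
      using between_exists[OF T \<rho>(1) _ \<sigma>(1), of i j k l] \<rho> \<sigma> unfolding A(1) B(1) by blast
    then obtain x \<sigma>1 \<sigma>2 where *: "\<sigma>1 \<in> T" "separates \<sigma>1 {i, j} {x, k}" "separates \<sigma>1 {i, j} {k, l}"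
      "\<sigma>2 \<in> T" "separates \<sigma>2 {i, x} {k, l}" "separates \<sigma>2 {i, j} {k, l}"
      unfolding A(1) B(1) by blast
    note r = N_refine[OF T A(2) B(2) *]
    have V: "\<sigma>1 \<in> stable_partitions S W" "\<sigma>2 \<in> stable_partitions S W"
      using familiesD(1)[OF T] * by auto
    have xn: "i \<noteq> x" "x \<noteq> k"
      using separates_distinct[OF *(2) V(1)] separates_distinct[OF *(5) V(2)] by auto
    have un: "?Q A B = ?Q {i, j} {x, k} \<union> ?Q {i, x} {k, l}" and dis: "?Q {i, j} {x, k} \<inter> ?Q {i, x} {k, l} = {}"
      using r(1,2) unfolding A(1) B(1) by auto
    have "\<sigma>1 \<notin> ?Q {i, x} {k, l}" "\<sigma>2 \<notin> ?Q {i, j} {x, k}" using r(2) * by blast+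
    then have "?Q {i, j} {x, k} \<subset> ?Q A B" "?Q {i, x} {k, l} \<subset> ?Q A B" using un * by blast+
    then have "card (?Q {i, j} {x, k}) < card (?Q A B)" "card (?Q {i, x} {k, l}) < card (?Q A B)"
      using psubset_card_mono[OF fin] by blast+
    note IH = less.hyps[OF this(1)] less.hyps[OF this(2)]
    have "N T {i, j} {x, k} - (\<Sum>\<sigma>\<in>?Q {i, j} {x, k}. N T (X \<sigma>) (Y \<sigma>)) \<in> J"
      by (rule IH(1)) (use A B xn *(1,2) in auto)
    moreover have "N T {i, x} {k, l} - (\<Sum>\<sigma>\<in>?Q {i, x} {k, l}. N T (X \<sigma>) (Y \<sigma>)) \<in> J"
      by (rule IH(2)) (use A B xn *(4,5) in auto)
    ultimately have "N T {i, j} {x, k} - (\<Sum>\<sigma>\<in>?Q {i, j} {x, k}. N T (X \<sigma>) (Y \<sigma>)) +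
        (N T {i, x} {k, l} - (\<Sum>\<sigma>\<in>?Q {i, x} {k, l}. N T (X \<sigma>) (Y \<sigma>))) \<in> J" by (rule J_add)
    moreover have "(\<Sum>\<sigma>\<in>?Q A B. N T (X \<sigma>) (Y \<sigma>)) =
      (\<Sum>\<sigma>\<in>?Q {i, j} {x, k}. N T (X \<sigma>) (Y \<sigma>)) + (\<Sum>\<sigma>\<in>?Q {i, x} {k, l}. N T (X \<sigma>) (Y \<sigma>))"
      unfolding un by (rule sum.union_disjoint[OF fin fin dis])
    ultimately show ?thesis using r(3) unfolding A(1) B(1) by (simp add: algebra_simps)
  qed
qed

text \<open>The relation at an arbitrary allowed quadruple. A member of \<open>T\<close> separating
  one pairing removes all terms of the other, and the remaining ones cancel by
  \<open>N_decompose\<close>; if neither pairing is separated, no terms of rule (3) occur.\<close>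

lemma linear_relation_link:
  assumes T: "T \<in> families S W" and pick: "\<And>\<sigma>. \<sigma> \<in> T \<Longrightarrow> simple T \<sigma> (X \<sigma>) (Y \<sigma>)"
    and q: "allowed S W i j k l"
  shows "(N T {i, j} {k, l} - (\<Sum>\<sigma>\<in>{\<sigma> \<in> T. separates \<sigma> {i, j} {k, l}}. N T (X \<sigma>) (Y \<sigma>))) -
    (N T {k, j} {i, l} - (\<Sum>\<sigma>\<in>{\<sigma> \<in> T. separates \<sigma> {k, j} {i, l}}. N T (X \<sigma>) (Y \<sigma>))) \<in> J"
proof -
  have one: "(N T {i, j} {k, l} - (\<Sum>\<sigma>\<in>{\<sigma> \<in> T. separates \<sigma> {i, j} {k, l}}. N T (X \<sigma>) (Y \<sigma>))) -
    (N T {k, j} {i, l} - (\<Sum>\<sigma>\<in>{\<sigma> \<in> T. separates \<sigma> {k, j} {i, l}}. N T (X \<sigma>) (Y \<sigma>))) \<in> J"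
    if q: "allowed S W i j k l" and \<sigma>: "\<sigma> \<in> T" "separates \<sigma> {i, j} {k, l}" for i j k l \<sigma>
  proof -
    have w: "i \<noteq> j" "k \<noteq> l" "{i, j} \<inter> W \<noteq> {}" "{k, l} \<inter> W \<noteq> {}" using q unfolding allowed_iff by auto
    have "N T {k, j} {i, l} = 0"
      by (rule N_zero) (rule neighbour_not_crossing[OF \<sigma> T])
    moreover have "{\<sigma> \<in> T. separates \<sigma> {k, j} {i, l}} = {}"
      using separates_incompatible[OF \<sigma>(2) familiesD(1)[OF T \<sigma>(1)]] familiesD[OF T] \<sigma>(1) by blast
    moreover have "N T {i, j} {k, l} - (\<Sum>\<sigma>\<in>{\<sigma> \<in> T. separates \<sigma> {i, j} {k, l}}. N T (X \<sigma>) (Y \<sigma>)) \<in> J"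
      by (rule N_decompose[OF T pick]) (use w \<sigma> in auto)
    ultimately show ?thesis by (simp only: sum.empty diff_zero)
  qed
  show ?thesis
  proof (cases "\<exists>\<sigma>\<in>T. separates \<sigma> {i, j} {k, l} \<or> separates \<sigma> {k, j} {i, l}")
    case True
    then obtain \<sigma> where \<sigma>: "\<sigma> \<in> T" "separates \<sigma> {i, j} {k, l} \<or> separates \<sigma> {k, j} {i, l}" by blast
    from \<sigma>(2) show ?thesis
    proof
      assume "separates \<sigma> {i, j} {k, l}"
      then show ?thesis by (rule one[OF q \<sigma>(1)])
    next
      assume s: "separates \<sigma> {k, j} {i, l}"
      have "allowed S W k j i l" using q unfolding allowed_iff by auto
      from J_minus[OF one[OF this \<sigma>(1) s]] show ?thesis by simp
    qed
  next
    case False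
    then have "{\<sigma> \<in> T. separates \<sigma> {i, j} {k, l}} = {}" "{\<sigma> \<in> T. separates \<sigma> {k, j} {i, l}} = {}" by blast+
    moreover have "N T {i, j} {k, l} - N T {k, j} {i, l} \<in> J" using J_rel'[OF T q] False by blast
    ultimately show ?thesis by (simp only: sum.empty diff_zero)
  qed
qed

end


section \<open>Formal properties of the operators\<close>

text \<open>Both sides of an edge carry white labels. One on each side serves as \<open>i\<close>
  and \<open>k\<close>, and then labels on any other suitable flags can serve as \<open>j\<close>
  and \<open>l\<close>.\<close>

lemma (in stable_tree) edge_quadruple:
  assumes e: "e1 \<in> halves \<tau>" "e2 = opp \<tau> e1"
  shows "\<exists>I J K L. I \<in> flags_at \<tau> (base \<tau> e1) - {e1} \<and> J \<in> flags_at \<tau> (base \<tau> e1) - {e1} \<and> I \<noteq> J \<and>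
    K \<in> flags_at \<tau> (base \<tau> e2) - {e2} \<and> L \<in> flags_at \<tau> (base \<tau> e2) - {e2} \<and> K \<noteq> L \<and>
    allowed_flags S W \<tau> I J K L"
proof -
  have two: "\<exists>I J i j. I \<in> flags_at \<tau> (base \<tau> f) - {f} \<and> J \<in> flags_at \<tau> (base \<tau> f) - {f} \<and> I \<noteq> J \<and>
    i \<in> B I \<and> j \<in> B J \<and> i \<in> W" if f: "f \<in> halves \<tau>" for f
  proof -
    have v: "base \<tau> f \<in> verts \<tau>" "f \<in> flags \<tau>" using f by auto
    obtain i where i: "i \<in> B (opp \<tau> f)" "i \<in> W" using branch_white_half[of "opp \<tau> f"] f by auto
    have "i \<in> S" using i W_subset by blast
    then obtain I where I: "I \<in> flags_at \<tau> (base \<tau> f)" "i \<in> B I" using branch_cover[OF v(1)] by blast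
    have If: "I \<noteq> f" using I i branch_opp[OF f] by auto
    obtain J where J: "J \<in> flags_at \<tau> (base \<tau> f)" "J \<noteq> I" "J \<noteq> f"
      using third_flag[OF v(1), of I f] by blast
    obtain j where "j \<in> B J" using branch_nonempty[OF flags_at_flag[OF J(1)]] by blast
    then show ?thesis using I If J i(2) by blast
  qed
  obtain I J i j where IJ: "I \<in> flags_at \<tau> (base \<tau> e1) - {e1}" "J \<in> flags_at \<tau> (base \<tau> e1) - {e1}" "I \<noteq> J"
    and ij: "i \<in> B I" "j \<in> B J" "i \<in> W" using two[OF e(1)] by blast
  have e2: "e2 \<in> halves \<tau>" "opp \<tau> e2 = e1" using e by auto
  obtain K L k l where KL: "K \<in> flags_at \<tau> (base \<tau> e2) - {e2}" "L \<in> flags_at \<tau> (base \<tau> e2) - {e2}" "K \<noteq> L"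
    and kl: "k \<in> B K" "l \<in> B L" "k \<in> W" using two[OF e2(1)] by blast
  have fl: "I \<in> flags \<tau>" "J \<in> flags \<tau>" "K \<in> flags \<tau>" "L \<in> flags \<tau>"
    using IJ KL by (auto simp: flags_at_def)
  have "B I \<subseteq> B e2" "B J \<subseteq> B e2"
    using branch_subset_opp[OF e2(1)] IJ e2(2) by (auto simp: flags_at_def)
  moreover have "B K \<subseteq> B e1" "B L \<subseteq> B e1"
    using branch_subset_opp[OF e(1)] KL e(2) by (auto simp: flags_at_def)
  moreover have "B e1 \<inter> B e2 = {}" using branch_opp[OF e(1)] e(2) by auto
  moreover have "B I \<inter> B J = {}" "B K \<inter> B L = {}"
    using branch_disjoint[of I J] branch_disjoint[of K L] IJ KL fl by (auto simp: flags_at_def)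
  ultimately have d: "distinct [i, j, k, l]" using ij kl by auto
  moreover have "base \<tau> e1 \<noteq> base \<tau> e2" using base_opp_neq[OF e(1)] e(2) by simp
  then have "distinct [I, J, K, L]" using IJ KL by (auto simp: flags_at_def)
  moreover have "{i, j, k, l} \<subseteq> S" using branch_subset fl ij kl by blast
  ultimately have "allowed_flags S W \<tau> I J K L"
    unfolding allowed_flags_def allowed_iff using ij kl by blast
  then show ?thesis using IJ KL by blast
qed

text \<open>The family is realized by a tree, whose edge with split \<sigma> supplies the labels.
  Thus rule (3) has a choice at every member of a compatible family.\<close>

lemma simple_quadruple:
  assumes p: "painted S W" and T: "T \<in> families S W" and \<sigma>: "\<sigma> \<in> T"
  shows "\<exists>i j k l. allowed S W i j k l \<and> separates \<sigma> {i, j} {k, l} \<and>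
    (\<forall>\<rho>\<in>T. separates \<rho> {i, j} {k, l} \<longrightarrow> \<rho> = \<sigma>)"
proof -
  interpret painted S W by fact
  have "finite T" using T finite_partitions finite_subset by (auto simp: families_def)
  then have "\<exists>\<tau>\<in>stable_trees S W. splits S \<tau> = T"
    by (rule tree_exists[OF p]) (use T in \<open>simp_all add: families_def\<close>)
  then obtain \<tau> where \<tau>: "\<tau> \<in> stable_trees S W" "splits S \<tau> = T" by blast
  interpret stable_tree S W \<tau> using \<tau>(1) by unfold_locales
  obtain e where e: "e \<in> halves \<tau>" "\<sigma> = edge_partition S \<tau> e" using \<sigma> \<tau>(2) by (auto simp: splits_def)
  obtain I J K L where IJ: "I \<in> flags_at \<tau> (base \<tau> e) - {e}" "J \<in> flags_at \<tau> (base \<tau> e) - {e}" "I \<noteq> J"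
    and KL: "K \<in> flags_at \<tau> (base \<tau> (opp \<tau> e)) - {opp \<tau> e}" "L \<in> flags_at \<tau> (base \<tau> (opp \<tau> e)) - {opp \<tau> e}" "K \<noteq> L"
    and al: "allowed_flags S W \<tau> I J K L"
    using edge_quadruple[OF e(1) refl] by blast
  obtain i j k l where q: "i \<in> B I" "j \<in> B J" "k \<in> B K" "l \<in> B L" "allowed S W i j k l"
    using al by (auto simp: allowed_flags_def)
  note es = edge_sum(2,3)[OF e(1) refl IJ KL q(1-4)]
  show ?thesis using q(5) es unfolding e(2)[symmetric] \<tau>(2) by blast
qed

section \<open>Linear extension of maps from a basis\<close>

definition scale :: "'k::{comm_ring,comm_monoid_mult} \<Rightarrow> ('b \<Rightarrow>\<^sub>0 'k) \<Rightarrow> ('b \<Rightarrow>\<^sub>0 'k)" where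
  "scale c = Poly_Mapping.map ((*) c)"

lemma lookup_scale [simp]: "Poly_Mapping.lookup (scale c x) b = c * Poly_Mapping.lookup x b"
  unfolding scale_def by transfer (auto simp: when_def)

lemma scale_simps [simp]: "scale c 0 = 0" "scale 0 x = 0" "scale 1 x = x"
  "scale c (- x) = - scale c x" "scale (- c) x = - scale c x"
  by (rule poly_mapping_eqI, simp)+

lemma scale_distribs: "scale c (x + y) = scale c x + scale c y" "scale (c + d) x = scale c x + scale d x"
  "scale c (x - y) = scale c x - scale c y" "scale (c - d) x = scale c x - scale d x"
  by (rule poly_mapping_eqI, simp add: lookup_add lookup_minus algebra_simps)+

lemma scale_scale: "scale c (scale d x) = scale (c * d) x"
  by (rule poly_mapping_eqI) (simp add: algebra_simps)

lemma scale_sum: "scale c (sum g A) = (\<Sum>a\<in>A. scale c (g a))"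
  by (induction A rule: infinite_finite_induct) (simp_all add: scale_distribs)

lemma scale_single [simp]: "scale c (Poly_Mapping.single b d) = Poly_Mapping.single b (c * d)"
  by (rule poly_mapping_eqI) (simp add: lookup_single when_def)

definition extend :: "('i \<Rightarrow> ('b \<Rightarrow>\<^sub>0 'k)) \<Rightarrow> ('i \<Rightarrow>\<^sub>0 'k::{comm_ring,comm_monoid_mult}) \<Rightarrow> ('b \<Rightarrow>\<^sub>0 'k)" where
  "extend g x = (\<Sum>b\<in>Poly_Mapping.keys x. scale (Poly_Mapping.lookup x b) (g b))"

lemma extend_superset:
  assumes "finite A" "Poly_Mapping.keys x \<subseteq> A"
  shows "extend g x = (\<Sum>b\<in>A. scale (Poly_Mapping.lookup x b) (g b))"
  unfolding extend_def
  by (rule sum.mono_neutral_left) (use assms in \<open>auto simp: in_keys_iff\<close>)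

lemma extend_zero [simp]: "extend g 0 = 0"
  by (simp add: extend_def)

lemma extend_add: "extend g (x + y) = extend g x + extend g y"
proof -
  let ?A = "Poly_Mapping.keys x \<union> Poly_Mapping.keys y"
  have "Poly_Mapping.keys (x + y) \<subseteq> ?A" by (rule keys_add)
  then show ?thesis
    using extend_superset[of ?A "x + y" g] extend_superset[of ?A x g] extend_superset[of ?A y g]
    by (simp add: lookup_add scale_distribs sum.distrib)
qed

lemma extend_scale: "extend g (scale c x) = scale c (extend g x)"
proof -
  have "Poly_Mapping.keys (scale c x) \<subseteq> Poly_Mapping.keys x" by (auto simp: in_keys_iff)
  then show ?thesis
    using extend_superset[of "Poly_Mapping.keys x" "scale c x" g]
    by (simp add: extend_def scale_scale scale_sum)
qed

lemma extend_single [simp]: "extend g (Poly_Mapping.single b c) = scale c (g b)"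
proof -
  have "Poly_Mapping.keys (Poly_Mapping.single b c) \<subseteq> {b}" by (cases "c = 0") auto
  then show ?thesis using extend_superset[of "{b}" "Poly_Mapping.single b c" g] by simp
qed

lemma extend_minus: "extend g (- x) = - extend g x"
  using extend_scale[of g "- 1" x] by simp

lemma extend_diff: "extend g (x - y) = extend g x - extend g y"
  using extend_add[of g x "- y"] by (simp add: extend_minus)

lemma extend_sum: "extend g (sum h A) = (\<Sum>a\<in>A. extend g (h a))"
  by (induction A rule: infinite_finite_induct) (simp_all add: extend_add)

locale linear_operator =
  fixes A :: "('b \<Rightarrow>\<^sub>0 'k::{comm_ring,comm_monoid_mult}) \<Rightarrow> ('c \<Rightarrow>\<^sub>0 'k)"
  assumes add: "A (x + y) = A x + A y" and scale: "A (scale c x) = scale c (A x)"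
begin

lemma zero [simp]: "A 0 = 0"
  using scale[of 0 0] by simp

lemma minus: "A (- x) = - A x"
  using scale[of "- 1" x] by simp

lemma diff: "A (x - y) = A x - A y"
  using add[of x "- y"] by (simp add: minus)

lemma sum: "A (sum g I) = (\<Sum>a\<in>I. A (g a))"
  by (induction I rule: infinite_finite_induct) (simp_all add: add)

end

lemma linear_extend: "linear_operator (extend g)"
  by unfold_locales (rule extend_add extend_scale)+

text \<open>The predicate expresses that \<open>J\<close> is a submodule; no generating set is
  specified.\<close>

locale span =
  fixes J :: "('b \<Rightarrow>\<^sub>0 'k::{comm_ring,comm_monoid_mult}) set"
  assumes zero: "0 \<in> J" and add: "x \<in> J \<Longrightarrow> y \<in> J \<Longrightarrow> x + y \<in> J" and scale: "x \<in> J \<Longrightarrow> scale c x \<in> J"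
begin

lemma minus: "x \<in> J \<Longrightarrow> - x \<in> J"
  using scale[of x "- 1"] by simp

lemma diff: "x \<in> J \<Longrightarrow> y \<in> J \<Longrightarrow> x - y \<in> J"
  using add[of x "- y"] minus by simp

lemma sum: "(\<And>i. i \<in> I \<Longrightarrow> g i \<in> J) \<Longrightarrow> sum g I \<in> J"
  by (induction I rule: infinite_finite_induct) (auto intro: zero add)

lemma trans: "x - y \<in> J \<Longrightarrow> y - z \<in> J \<Longrightarrow> x - z \<in> J"
  using add[of "x - y" "y - z"] by simp

lemma sym: "x - y \<in> J \<Longrightarrow> y - x \<in> J"
  using minus[of "x - y"] by simp

end

text \<open>\<open>C\<close> plays the role of a fan, \<open>Q\<close> of its linear functions, and \<open>m T \<sigma>\<close> is a linear function that is
  the indicator of \<open>\<sigma>\<close> on the cone \<open>T\<close>.\<close>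

locale fan_action = span J for J :: "('b \<Rightarrow>\<^sub>0 'k::{comm_ring,comm_monoid_mult}) set" +
  fixes V :: "'v set" and C :: "'v set set" and E :: "'v set \<Rightarrow> ('b \<Rightarrow>\<^sub>0 'k)"
    and A :: "'v \<Rightarrow> ('b \<Rightarrow>\<^sub>0 'k) \<Rightarrow> ('b \<Rightarrow>\<^sub>0 'k)"
    and Q :: "('v \<Rightarrow> 'k) set" and m :: "'v set \<Rightarrow> 'v \<Rightarrow> 'v \<Rightarrow> 'k"
  assumes V: "finite V" and C_V: "T \<in> C \<Longrightarrow> T \<subseteq> V" and C_down: "insert \<sigma> T \<in> C \<Longrightarrow> T \<in> C"
    and A_linear: "linear_operator (A \<sigma>)"
    and A_new: "T \<in> C \<Longrightarrow> \<sigma> \<in> V \<Longrightarrow> \<sigma> \<notin> T \<Longrightarrow> A \<sigma> (E T) = (if insert \<sigma> T \<in> C then E (insert \<sigma> T) else 0)"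
    and A_old: "T \<in> C \<Longrightarrow> \<sigma> \<in> T \<Longrightarrow> A \<sigma> (E T) = - (\<Sum>\<rho>\<in>V - T. scale (m T \<sigma> \<rho>) (A \<rho> (E T)))"
    and m_Q: "T \<in> C \<Longrightarrow> \<sigma> \<in> T \<Longrightarrow> m T \<sigma> \<in> Q"
    and m_one: "T \<in> C \<Longrightarrow> \<sigma> \<in> T \<Longrightarrow> m T \<sigma> \<sigma> = 1"
    and m_zero: "T \<in> C \<Longrightarrow> \<sigma> \<in> T \<Longrightarrow> \<rho> \<in> T \<Longrightarrow> \<rho> \<noteq> \<sigma> \<Longrightarrow> m T \<sigma> \<rho> = 0"
    and rel: "f \<in> Q \<Longrightarrow> T \<in> C \<Longrightarrow> (\<Sum>\<rho>\<in>V. scale (f \<rho>) (A \<rho> (E T))) \<in> J"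
begin

sublocale op: linear_operator "A \<sigma>" for \<sigma>
  by (rule A_linear)

text \<open>On \<open>T\<close> the function \<open>m T \<sigma>\<close> is the indicator of
  \<sigma>, so a single term survives there.\<close>

lemma sum_m:
  assumes T: "T \<in> C" and \<sigma>: "\<sigma> \<in> T"
  shows "(\<Sum>\<rho>\<in>V. scale (m T \<sigma> \<rho>) (x \<rho>)) = x \<sigma> + (\<Sum>\<rho>\<in>V - T. scale (m T \<sigma> \<rho>) (x \<rho>))"
proof -
  have fT: "finite T" using C_V[OF T] V finite_subset by blast
  have "(\<Sum>\<rho>\<in>V. scale (m T \<sigma> \<rho>) (x \<rho>)) =
      (\<Sum>\<rho>\<in>V - T. scale (m T \<sigma> \<rho>) (x \<rho>)) + (\<Sum>\<rho>\<in>T. scale (m T \<sigma> \<rho>) (x \<rho>))"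
    by (rule sum.subset_diff[OF C_V[OF T] V])
  also have "(\<Sum>\<rho>\<in>T. scale (m T \<sigma> \<rho>) (x \<rho>)) = (\<Sum>\<rho>\<in>T. if \<rho> = \<sigma> then x \<sigma> else 0)"
    by (rule sum.cong[OF refl]) (use T \<sigma> m_one m_zero in auto)
  also have "\<dots> = x \<sigma>" using fT \<sigma> by simp
  finally show ?thesis by (simp add: add.commute)
qed

lemma comm_new:
  assumes "T \<in> C" "\<sigma> \<in> V" "\<rho> \<in> V" "\<sigma> \<notin> T" "\<rho> \<notin> T"
  shows "A \<sigma> (A \<rho> (E T)) = A \<rho> (A \<sigma> (E T))"
proof (cases "\<sigma> = \<rho>")
  case False
  have "insert \<sigma> (insert \<rho> T) \<in> C \<Longrightarrow> insert \<sigma> T \<in> C"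
    using C_down[of \<rho> "insert \<sigma> T"] by (simp add: insert_commute)
  then show ?thesis
    using assms False C_down[of \<sigma> "insert \<rho> T"] by (simp add: A_new insert_commute)
qed simp

text \<open>Expanding by \<open>A_old\<close> and commuting new variables turns the commutator into
  the relation of \<open>m T \<sigma>\<close> at \<open>insert \<rho> T\<close>. This family
  contains \<sigma>, where the function has value 1, so the relation is needed beyond the defining
  ones.\<close>

lemma comm_mixed:
  assumes T: "T \<in> C" and \<sigma>: "\<sigma> \<in> T" and \<rho>: "\<rho> \<in> V" "\<rho> \<notin> T"
  shows "A \<sigma> (A \<rho> (E T)) - A \<rho> (A \<sigma> (E T)) \<in> J"
proof -
  let ?m = "m T \<sigma>"
  have "A \<rho> (A \<sigma> (E T)) = - (\<Sum>\<kappa>\<in>V - T. scale (?m \<kappa>) (A \<rho> (A \<kappa> (E T))))"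
    by (simp add: A_old[OF T \<sigma>] op.minus op.sum op.scale)
  also have "\<dots> = - (\<Sum>\<kappa>\<in>V - T. scale (?m \<kappa>) (A \<kappa> (A \<rho> (E T))))"
    using comm_new[OF T \<rho>(1)] \<rho>(2) by (intro arg_cong[of _ _ uminus] sum.cong) auto
  finally have "A \<sigma> (A \<rho> (E T)) - A \<rho> (A \<sigma> (E T)) = (\<Sum>\<kappa>\<in>V. scale (?m \<kappa>) (A \<kappa> (A \<rho> (E T))))"
    by (simp add: sum_m[OF T \<sigma>])
  also have "\<dots> \<in> J"
    using rel[OF m_Q[OF T \<sigma>], of "insert \<rho> T"] zero by (simp add: A_new[OF T \<rho>])
  finally show ?thesis .
qed

text \<open>Modulo \<open>J\<close> both products equal a double sum over new variables, which is
  symmetric because new variables commute exactly.\<close>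

lemma comm_old:
  assumes T: "T \<in> C" and \<sigma>: "\<sigma> \<in> T" and \<rho>: "\<rho> \<in> T"
  shows "A \<sigma> (A \<rho> (E T)) - A \<rho> (A \<sigma> (E T)) \<in> J"
proof -
  let ?D = "\<lambda>\<sigma> \<rho>. \<Sum>\<kappa>\<in>V - T. \<Sum>\<iota>\<in>V - T. scale (m T \<rho> \<kappa> * m T \<sigma> \<iota>) (A \<kappa> (A \<iota> (E T)))"
  have double: "A \<sigma> (A \<rho> (E T)) - ?D \<sigma> \<rho> \<in> J" if \<sigma>: "\<sigma> \<in> T" and \<rho>: "\<rho> \<in> T" for \<sigma> \<rho>
  proof -
    have "?D \<sigma> \<rho> = - (\<Sum>\<kappa>\<in>V - T. scale (m T \<rho> \<kappa>) (A \<kappa> (A \<sigma> (E T))))"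
      by (simp add: A_old[OF T \<sigma>] op.minus op.sum op.scale scale_sum scale_scale sum_negf)
    moreover have "A \<sigma> (A \<rho> (E T)) = - (\<Sum>\<kappa>\<in>V - T. scale (m T \<rho> \<kappa>) (A \<sigma> (A \<kappa> (E T))))"
      by (simp add: A_old[OF T \<rho>] op.minus op.sum op.scale)
    ultimately have "A \<sigma> (A \<rho> (E T)) - ?D \<sigma> \<rho> =
        - (\<Sum>\<kappa>\<in>V - T. scale (m T \<rho> \<kappa>) (A \<sigma> (A \<kappa> (E T)) - A \<kappa> (A \<sigma> (E T))))"
      by (simp add: scale_distribs sum_subtractf)
    also have "\<dots> \<in> J"
      by (rule minus, rule sum, rule scale, rule comm_mixed[OF T \<sigma>]) auto
    finally show ?thesis .
  qed
  have "?D \<sigma> \<rho> = ?D \<rho> \<sigma>"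
    by (subst sum.swap) (intro sum.cong refl, use comm_new[OF T] in \<open>simp add: mult.commute\<close>)
  then show ?thesis using trans[OF double[OF \<sigma> \<rho>]] sym[OF double[OF \<rho> \<sigma>]] by simp
qed

lemma comm:
  assumes "T \<in> C" "\<sigma> \<in> V" "\<rho> \<in> V"
  shows "A \<sigma> (A \<rho> (E T)) - A \<rho> (A \<sigma> (E T)) \<in> J"
  using comm_new[OF assms] comm_mixed[OF assms(1), of \<sigma> \<rho>] comm_mixed[OF assms(1), of \<rho> \<sigma>]
    comm_old[OF assms(1), of \<sigma> \<rho>] sym zero assms
  by (cases "\<sigma> \<in> T"; cases "\<rho> \<in> T") auto

text \<open>The relation operator commutes with \<open>A \<sigma>\<close> modulo \<open>J\<close>.
  Applied to \<open>A \<sigma> (E T)\<close> it falls into \<open>J\<close>, because that chain is a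
  combination of basis elements, by \<open>A_old\<close> in case \<sigma> belongs to
  \<open>T\<close>.\<close>

lemma rel_stable:
  assumes f: "f \<in> Q" and T: "T \<in> C" and \<sigma>: "\<sigma> \<in> V"
  shows "A \<sigma> (\<Sum>\<rho>\<in>V. scale (f \<rho>) (A \<rho> (E T))) \<in> J"
proof -
  let ?r = "\<lambda>x. \<Sum>\<rho>\<in>V. scale (f \<rho>) (A \<rho> x)"
  have r: "linear_operator ?r"
    by unfold_locales (simp_all add: op.add op.scale scale_distribs sum.distrib scale_scale scale_sum mult.commute)
  interpret r: linear_operator ?r by (rule r)
  have new: "?r (A \<kappa> (E T)) \<in> J" if "\<kappa> \<in> V" "\<kappa> \<notin> T" for \<kappa>
    using rel[OF f, of "insert \<kappa> T"] zero that by (simp add: A_new[OF T])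
  have "?r (A \<sigma> (E T)) \<in> J"
  proof (cases "\<sigma> \<in> T")
    case True
    have "?r (A \<sigma> (E T)) = - (\<Sum>\<kappa>\<in>V - T. scale (m T \<sigma> \<kappa>) (?r (A \<kappa> (E T))))"
      unfolding A_old[OF T True] by (simp only: r.minus r.sum r.scale)
    also have "\<dots> \<in> J"
      by (rule minus, rule sum, rule scale, rule new) auto
    finally show ?thesis .
  qed (use new \<sigma> in simp)
  moreover have "A \<sigma> (?r (E T)) - ?r (A \<sigma> (E T)) \<in> J"
  proof -
    have "A \<sigma> (?r (E T)) - ?r (A \<sigma> (E T)) =
        (\<Sum>\<rho>\<in>V. scale (f \<rho>) (A \<sigma> (A \<rho> (E T)) - A \<rho> (A \<sigma> (E T))))"
      by (simp add: op.sum op.scale scale_distribs sum_subtractf)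
    also have "\<dots> \<in> J"
      by (rule sum, rule scale, rule comm[OF T \<sigma>])
    finally show ?thesis .
  qed
  ultimately show ?thesis using add[of "A \<sigma> (?r (E T)) - ?r (A \<sigma> (E T))" "?r (A \<sigma> (E T))"] by simp
qed

end


text \<open>The case of a single term keeps the information that its index occurs in
  \<open>p\<close>, through which membership in a carrier enters the later inductions.\<close>

lemma single_induct [case_names zero single add]:
  fixes p :: "'i \<Rightarrow>\<^sub>0 'c::comm_monoid_add"
  assumes "P 0" and "\<And>m c. m \<in> Poly_Mapping.keys p \<Longrightarrow> P (Poly_Mapping.single m c)"
    and "\<And>x y. P x \<Longrightarrow> P y \<Longrightarrow> P (x + y)"
  shows "P p"
proof -
  let ?s = "\<lambda>m. Poly_Mapping.single m (Poly_Mapping.lookup p m)"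
  have "p = (\<Sum>m\<in>Poly_Mapping.keys p. ?s m)"
  proof (rule poly_mapping_eqI)
    fix b
    have "Poly_Mapping.lookup (\<Sum>m\<in>Poly_Mapping.keys p. ?s m) b =
        (\<Sum>m\<in>Poly_Mapping.keys p. if m = b then Poly_Mapping.lookup p b else 0)"
      unfolding lookup_sum by (intro sum.cong refl) (simp add: lookup_single when_def)
    then show "Poly_Mapping.lookup p b = Poly_Mapping.lookup (\<Sum>m\<in>Poly_Mapping.keys p. ?s m) b"
      by (simp add: in_keys_iff)
  qed
  moreover have "P (\<Sum>m\<in>B. ?s m)" if "finite B" "B \<subseteq> Poly_Mapping.keys p" for B
    using that
  proof (induction B)
    case (insert b B)
    then have "P (?s b)" "P (\<Sum>m\<in>B. ?s m)" using assms(2) by auto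
    then show ?case unfolding sum.insert[OF insert(1,2)] by (rule assms(3))
  qed (simp add: assms(1))
  ultimately show ?thesis by (metis finite_keys order_refl)
qed

section \<open>The action of the variables\<close>

definition tree_class :: "'a set \<Rightarrow> 'a set \<Rightarrow> 'a set set set \<Rightarrow> 'a stree set" where
  "tree_class S W T = {\<tau> \<in> stable_trees S W. splits S \<tau> = T}"

definition basis :: "'a set \<Rightarrow> 'a set \<Rightarrow> 'a set set set \<Rightarrow> ('a, 'k::{comm_ring,comm_monoid_mult}) chain" where
  "basis S W T = Poly_Mapping.single (tree_class S W T) 1"

text \<open>The inverse of \<open>tree_class\<close>, since all members of such a class have the
  same splits.\<close>

definition family_of :: "'a set \<Rightarrow> 'a stree set \<Rightarrow> 'a set set set" where
  "family_of S b = splits S (SOME \<tau>. \<tau> \<in> b)"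

definition link_sum ::
    "'a set \<Rightarrow> 'a set \<Rightarrow> 'a set set set \<Rightarrow> 'a set \<Rightarrow> 'a set \<Rightarrow> ('a, 'k::{comm_ring,comm_monoid_mult}) chain" where
  "link_sum S W T X Y = (\<Sum>\<rho>\<in>{\<rho> \<in> neighbours S W T. separates \<rho> X Y}. basis S W (insert \<rho> T))"

text \<open>A quadruple for rule (3), up to the order of the pairs; meaningful for \<open>\<sigma> \<in> T\<close> only.\<close>

definition quad :: "'a set \<Rightarrow> 'a set \<Rightarrow> 'a set set set \<Rightarrow> 'a set set \<Rightarrow> 'a \<times> 'a \<times> 'a \<times> 'a" where
  "quad S W T \<sigma> = (SOME (i, j, k, l). allowed S W i j k l \<and> separates \<sigma> {i, j} {k, l} \<and>
    (\<forall>\<rho>\<in>T. separates \<rho> {i, j} {k, l} \<longrightarrow> \<rho> = \<sigma>))"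

definition near :: "'a set \<Rightarrow> 'a set \<Rightarrow> 'a set set set \<Rightarrow> 'a set set \<Rightarrow> 'a set" where
  "near S W T \<sigma> = (case quad S W T \<sigma> of (i, j, k, l) \<Rightarrow> {i, j})"

definition far :: "'a set \<Rightarrow> 'a set \<Rightarrow> 'a set set set \<Rightarrow> 'a set set \<Rightarrow> 'a set" where
  "far S W T \<sigma> = (case quad S W T \<sigma> of (i, j, k, l) \<Rightarrow> {k, l})"

text \<open>One quadruple, chosen by \<open>quad\<close>, is built into case (3). Other choices are
  compared with it later, modulo the relations.\<close>

definition var_act :: "'a set \<Rightarrow> 'a set \<Rightarrow> 'a set set \<Rightarrow>
    ('a, 'k::{comm_ring,comm_monoid_mult}) chain \<Rightarrow> ('a, 'k) chain" where
  "var_act S W \<sigma> = extend (\<lambda>b. let T = family_of S b in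
     if \<sigma> \<in> T then - link_sum S W T (near S W T \<sigma>) (far S W T \<sigma>)
     else if \<sigma> \<in> neighbours S W T then basis S W (insert \<sigma> T) else 0)"

definition coefficient :: "'a \<Rightarrow> 'a \<Rightarrow> 'a \<Rightarrow> 'a \<Rightarrow> 'a set set \<Rightarrow> 'k::{comm_ring,comm_monoid_mult}" where
  "coefficient i j k l \<rho> =
     (if separates \<rho> {i, j} {k, l} then 1 else 0) - (if separates \<rho> {k, j} {i, l} then 1 else 0)"

lemma coefficient_sum:
  assumes "finite V"
  shows "(\<Sum>\<rho>\<in>V. scale (coefficient i j k l \<rho>) (g \<rho>)) =
    (\<Sum>\<rho>\<in>{\<rho> \<in> V. separates \<rho> {i, j} {k, l}}. g \<rho>) - (\<Sum>\<rho>\<in>{\<rho> \<in> V. separates \<rho> {k, j} {i, l}}. g \<rho>)"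
proof -
  have "(\<Sum>\<rho>\<in>V. scale (coefficient i j k l \<rho>) (g \<rho>)) =
      (\<Sum>\<rho>\<in>V. (if separates \<rho> {i, j} {k, l} then g \<rho> else 0) - (if separates \<rho> {k, j} {i, l} then g \<rho> else 0))"
    by (intro sum.cong refl) (simp add: coefficient_def scale_distribs)
  then show ?thesis by (simp add: sum_subtractf sum.inter_filter[OF assms])
qed

text \<open>The argument \<open>ground\<close> fixes the coefficient type, so that chains and
  polynomials over it can be named within the locale.\<close>

locale tree_homology = painted S W for S W :: "'a set" +
  fixes ground :: "'k::{comm_ring,comm_monoid_mult} itself"
begin

abbreviation V where "V \<equiv> stable_partitions S W"
abbreviation C where "C \<equiv> families S W"
abbreviation M :: "('k, ('a, 'k) chain) module" where "M \<equiv> chain_module S W"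
abbreviation J :: "('a, 'k) chain set" where "J \<equiv> chain_submodule S W"
abbreviation E :: "'a set set set \<Rightarrow> ('a, 'k) chain" where "E \<equiv> basis S W"
abbreviation N :: "'a set set set \<Rightarrow> 'a set \<Rightarrow> 'a set \<Rightarrow> ('a, 'k) chain" where "N \<equiv> link_sum S W"
abbreviation A :: "'a set set \<Rightarrow> ('a, 'k) chain \<Rightarrow> ('a, 'k) chain" where "A \<equiv> var_act S W"

lemma painted: "painted S W" ..

lemma finite_family: "T \<in> C \<Longrightarrow> finite T"
  using finite_partitions finite_subset by (auto simp: families_def)

lemma stable_treeI: "\<tau> \<in> stable_trees S W \<Longrightarrow> stable_tree S W \<tau>"
  by (simp add: stable_tree_def stable_tree_axioms_def painted)

lemma splits_family: "\<tau> \<in> stable_trees S W \<Longrightarrow> splits S \<tau> \<in> C"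
  using stable_tree.splits_stable[OF stable_treeI] stable_tree.splits_compat[OF stable_treeI]
  by (simp add: families_def)

lemma family_tree: "T \<in> C \<Longrightarrow> \<exists>\<tau>\<in>stable_trees S W. splits S \<tau> = T"
  by (rule tree_exists[OF painted finite_family]) (simp_all add: families_def)

lemma siso_class: "\<tau> \<in> stable_trees S W \<Longrightarrow> siso_rel S W `` {\<tau>} = tree_class S W (splits S \<tau>)"
  using siso_rel_iff[OF painted] by (auto simp: tree_class_def) (auto simp: siso_rel_def)

lemma mu_basis: "\<tau> \<in> stable_trees S W \<Longrightarrow> mu S W \<tau> = E (splits S \<tau>)"
  by (simp add: mu_def basis_def siso_class)

lemma family_of_class: "T \<in> C \<Longrightarrow> family_of S (tree_class S W T) = T"
proof -
  assume "T \<in> C"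
  then have "\<exists>\<tau>. \<tau> \<in> tree_class S W T" using family_tree by (auto simp: tree_class_def)
  then have "(SOME \<tau>. \<tau> \<in> tree_class S W T) \<in> tree_class S W T" by (rule someI_ex)
  then show ?thesis by (simp add: family_of_def tree_class_def)
qed

lemma classes: "stable_trees S W // siso_rel S W = tree_class S W ` C"
proof (intro equalityI subsetI)
  fix b assume "b \<in> stable_trees S W // siso_rel S W"
  then obtain \<tau> where "\<tau> \<in> stable_trees S W" "b = siso_rel S W `` {\<tau>}" by (auto simp: quotient_def)
  then show "b \<in> tree_class S W ` C" using siso_class splits_family by auto
next
  fix b assume "b \<in> tree_class S W ` C"
  then obtain T where "T \<in> C" "b = tree_class S W T" by blast
  moreover from this obtain \<tau> where "\<tau> \<in> stable_trees S W" "splits S \<tau> = T" using family_tree by blast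
  ultimately show "b \<in> stable_trees S W // siso_rel S W" using siso_class by (auto simp: quotient_def)
qed

lemma families_insert:
  assumes "T \<in> C" shows "insert \<sigma> T \<in> C \<longleftrightarrow> \<sigma> \<in> V \<and> (\<forall>\<rho>\<in>T. compat \<sigma> \<rho>)"
proof -
  have "compat \<sigma> \<sigma>" if \<sigma>: "\<sigma> \<in> V"
  proof -
    obtain P where "\<sigma> = {P, S - P}" using stable_partition_parts[OF \<sigma>] by blast
    moreover have "P \<inter> (S - P) = {}" by blast
    ultimately show ?thesis unfolding compat_def by blast
  qed
  moreover have "(\<forall>\<rho>\<in>T. compat \<rho> \<sigma>) \<longleftrightarrow> (\<forall>\<rho>\<in>T. compat \<sigma> \<rho>)" using compat_sym by metis
  ultimately show ?thesis using assms unfolding families_def by auto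
qed

lemma neighbours_iff: "T \<in> C \<Longrightarrow> \<sigma> \<in> neighbours S W T \<longleftrightarrow> \<sigma> \<notin> T \<and> insert \<sigma> T \<in> C"
  using families_insert[of T \<sigma>] by (auto simp: neighbours_def)

lemma carrier_M: "carrier M = {x. Poly_Mapping.keys x \<subseteq> tree_class S W ` C}"
  by (simp add: chain_module_def classes)

lemma M_simps [simp]: "add M = (+)" "zero M = 0" "smult M = scale"
  by (simp_all add: chain_module_def scale_def fun_eq_iff)

lemma carrier_zero: "0 \<in> carrier M"
  by (simp add: carrier_M)

lemma carrier_add: "x \<in> carrier M \<Longrightarrow> y \<in> carrier M \<Longrightarrow> x + y \<in> carrier M"
  using keys_add[of x y] by (auto simp: carrier_M)

lemma carrier_scale: "x \<in> carrier M \<Longrightarrow> scale c x \<in> carrier M"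
proof -
  have "Poly_Mapping.keys (scale c x) \<subseteq> Poly_Mapping.keys x" by (auto simp: in_keys_iff)
  then show "x \<in> carrier M \<Longrightarrow> scale c x \<in> carrier M" by (auto simp: carrier_M)
qed

lemma carrier_basis: "T \<in> C \<Longrightarrow> E T \<in> carrier M"
  by (auto simp: carrier_M basis_def)

sublocale carrier: span "carrier M"
proof
qed (simp_all add: carrier_zero carrier_add carrier_scale)

lemma carrier_induct [consumes 1, case_names basis zero add scale]:
  assumes x: "x \<in> carrier M"
    and basis: "\<And>T. T \<in> C \<Longrightarrow> P (E T)" and "P 0" and "\<And>x y. P x \<Longrightarrow> P y \<Longrightarrow> P (x + y)"
    and scale: "\<And>c x. P x \<Longrightarrow> P (scale c x)"
  shows "P x"
proof (induction x rule: single_induct)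
  case (single b c)
  then obtain T where "T \<in> C" "b = tree_class S W T" using x by (auto simp: carrier_M)
  then show ?case using scale[OF basis, of T c] by (simp add: basis_def)
qed (use assms in auto)

lemma ground_cring: "cring (ground_ring :: 'k ring)"
proof (rule cringI)
  show "abelian_group (ground_ring :: 'k ring)"
    by (rule abelian_groupI) (auto simp: ground_ring_def algebra_simps intro: exI[of _ "- x" for x])
  show "comm_monoid (ground_ring :: 'k ring)"
    by (rule comm_monoidI) (auto simp: ground_ring_def algebra_simps)
qed (auto simp: ground_ring_def algebra_simps)

lemma M_abelian_group: "abelian_group M"
proof (rule abelian_groupI)
  fix x assume "x \<in> carrier M"
  then have "- x \<in> carrier M" "- x \<oplus>\<^bsub>M\<^esub> x = \<zero>\<^bsub>M\<^esub>" by (simp_all add: carrier.minus)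
  then show "\<exists>y\<in>carrier M. y \<oplus>\<^bsub>M\<^esub> x = \<zero>\<^bsub>M\<^esub>" by blast
qed (auto simp: carrier.zero carrier.add add.assoc add.commute)

lemma M_module: "module (ground_ring :: 'k ring) M"
proof (rule moduleI[OF ground_cring M_abelian_group])
qed (auto simp: ground_ring_def carrier.scale scale_distribs scale_scale)

lemma M_minus: "x \<in> carrier M \<Longrightarrow> \<ominus>\<^bsub>M\<^esub> x = - x"
  by (rule abelian_group.minus_equality[OF M_abelian_group]) (simp_all add: carrier.minus)

text \<open>Through this the intersection defining \<open>chain_submodule\<close> is handled by the
  closure conditions of \<open>span\<close>.\<close>

lemma submodule_iff:
  "submodule H (ground_ring :: 'k ring) M \<longleftrightarrow> H \<subseteq> carrier M \<and> span H"
proof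
  assume s: "submodule H (ground_ring :: 'k ring) M"
  note e = module.submoduleE[OF M_module s]
  have sub: "H \<subseteq> carrier M" by (rule e(1))
  have z: "0 \<in> H" using subgroup.one_closed[OF submodule.axioms(1)[OF s]] by simp
  have "span H"
  proof
    show "x + y \<in> H" if "x \<in> H" "y \<in> H" for x y
      using subgroup.m_closed[OF submodule.axioms(1)[OF s] that] by simp
    show "scale c x \<in> H" if "x \<in> H" for c x
      using submodule.smult_closed[OF s _ that, of c] by (simp add: ground_ring_def)
  qed (rule z)
  then show "H \<subseteq> carrier M \<and> span H" using sub by blast
next
  assume a: "H \<subseteq> carrier M \<and> span H"
  then interpret H: span H by blast
  show "submodule H (ground_ring :: 'k ring) M"
  proof (rule module.submoduleI[OF M_module])
    show "\<ominus>\<^bsub>M\<^esub> x \<in> H" if "x \<in> H" for x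
      using that a M_minus[of x] H.minus by auto
  qed (use a H.zero H.add H.scale in \<open>auto simp: ground_ring_def\<close>)
qed

section \<open>The relations of homology in terms of families of splits\<close>

lemma star_basis:
  assumes \<tau>: "\<tau> \<in> stable_trees S W" and \<sigma>: "\<sigma> \<in> neighbours S W (splits S \<tau>)"
  shows "mu S W (star S W \<sigma> \<tau>) = E (insert \<sigma> (splits S \<tau>))"
  using star_splits[OF painted \<tau> neighboursD(1,2)[OF \<sigma>] neighboursD(3)[OF \<sigma>]] by (simp add: mu_basis)

lemma sum_star:
  assumes "\<tau> \<in> stable_trees S W"
  shows "(\<Sum>\<sigma>\<in>{\<sigma> \<in> neighbours S W (splits S \<tau>). separates \<sigma> X Y}. mu S W (star S W \<sigma> \<tau>)) =
    N (splits S \<tau>) X Y"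
  unfolding link_sum_def by (intro sum.cong refl) (simp add: star_basis[OF assms])

definition unseparated :: "'a set set set \<Rightarrow> 'a \<Rightarrow> 'a \<Rightarrow> 'a \<Rightarrow> 'a \<Rightarrow> bool" where
  "unseparated T i j k l \<longleftrightarrow> (\<forall>\<rho>\<in>T. \<not> separates \<rho> {i, j} {k, l} \<and> \<not> separates \<rho> {k, j} {i, l} \<and>
    \<not> separates \<rho> {i, k} {j, l})"

text \<open>Four flags at a vertex give labels that no edge separates two against two, and by
  \<open>quadruple_center\<close> every such label quadruple arises from a vertex. In this form the
  relations match \<open>J_rel\<close>.\<close>

lemma chain_relations_eq:
  "chain_relations S W = {N T {i, j} {k, l} - N T {k, j} {i, l} | T i j k l.
    T \<in> C \<and> allowed S W i j k l \<and> unseparated T i j k l}" (is "_ = ?R")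
proof (intro equalityI subsetI)
  fix x :: "('a, 'k) chain" assume "x \<in> chain_relations S W"
  then obtain \<tau> v I J K L where \<tau>: "\<tau> \<in> stable_trees S W" "v \<in> verts \<tau>"
    and fl: "{I, J, K, L} \<subseteq> flags_at \<tau> v" and al: "allowed_flags S W \<tau> I J K L"
    and x: "x = (\<Sum>\<alpha> \<in> {\<alpha> \<in> stable_flag_partitions S W \<tau> v. separates \<alpha> {I, J} {K, L}}. mu S W (split_tree S W \<tau> \<alpha>)) -
      (\<Sum>\<alpha> \<in> {\<alpha> \<in> stable_flag_partitions S W \<tau> v. separates \<alpha> {K, J} {I, L}}. mu S W (split_tree S W \<tau> \<alpha>))"
    unfolding chain_relations_def mem_Collect_eq by (elim exE conjE) (rule that)
  interpret stable_tree S W \<tau> by (rule stable_treeI[OF \<tau>(1)])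
  have d: "distinct [I, J, K, L]" using al by (simp add: allowed_flags_def)
  obtain i j k l where q: "i \<in> B I" "j \<in> B J" "k \<in> B K" "l \<in> B L" "allowed S W i j k l"
    using al by (auto simp: allowed_flags_def)
  have p: "{K, J, I, L} \<subseteq> flags_at \<tau> v" "distinct [K, J, I, L]"
    "{I, K, J, L} \<subseteq> flags_at \<tau> v" "distinct [I, K, J, L]" using fl d by auto
  have "x = N (splits S \<tau>) {i, j} {k, l} - N (splits S \<tau>) {k, j} {i, l}"
    unfolding x vertex_sum[OF \<tau>(2) fl d q(1-4)] vertex_sum[OF \<tau>(2) p(1,2) q(3,2,1,4)] sum_star[OF \<tau>(1)] ..
  moreover have "unseparated (splits S \<tau>) i j k l"
    unfolding unseparated_def
    using not_separated_at[OF \<tau>(2) fl d q(1-4)] not_separated_at[OF \<tau>(2) p(1,2) q(3,2,1,4)]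
      not_separated_at[OF \<tau>(2) p(3,4) q(1,3,2,4)] by blast
  ultimately show "x \<in> ?R"
    unfolding mem_Collect_eq using q(5) splits_family[OF \<tau>(1)] by (intro exI conjI)
next
  fix x assume "x \<in> ?R"
  then obtain T i j k l where T: "T \<in> C" and al: "allowed S W i j k l" and u: "unseparated T i j k l"
    and x: "x = N T {i, j} {k, l} - N T {k, j} {i, l}"
    unfolding mem_Collect_eq by (elim exE conjE) (rule that)
  obtain \<tau> where \<tau>: "\<tau> \<in> stable_trees S W" "splits S \<tau> = T" using family_tree[OF T] by blast
  interpret stable_tree S W \<tau> by (rule stable_treeI[OF \<tau>(1)])
  have "{i, j, k, l} \<subseteq> S" "distinct [i, j, k, l]" using al unfolding allowed_iff by blast+
  then obtain v I J K L where v: "v \<in> verts \<tau>" and fl: "{I, J, K, L} \<subseteq> flags_at \<tau> v" "distinct [I, J, K, L]"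
    and q: "i \<in> B I" "j \<in> B J" "k \<in> B K" "l \<in> B L"
    using quadruple_center[of i j k l] u \<tau>(2) unfolding unseparated_def by metis
  have p: "{K, J, I, L} \<subseteq> flags_at \<tau> v" "distinct [K, J, I, L]" using fl by auto
  have "allowed_flags S W \<tau> I J K L" using fl(2) q al unfolding allowed_flags_def by blast
  moreover have "x = (\<Sum>\<alpha> \<in> {\<alpha> \<in> stable_flag_partitions S W \<tau> v. separates \<alpha> {I, J} {K, L}}. mu S W (split_tree S W \<tau> \<alpha>)) -
      (\<Sum>\<alpha> \<in> {\<alpha> \<in> stable_flag_partitions S W \<tau> v. separates \<alpha> {K, J} {I, L}}. mu S W (split_tree S W \<tau> \<alpha>))"
    unfolding vertex_sum[OF v fl q] vertex_sum[OF v p q(3,2,1,4)] x \<tau>(2) sum_star[OF \<tau>(1), unfolded \<tau>(2)] ..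
  ultimately show "x \<in> chain_relations S W"
    unfolding chain_relations_def mem_Collect_eq using \<tau>(1) v fl(1) by (intro exI conjI)
qed

lemma N_carrier: "T \<in> C \<Longrightarrow> N T X Y \<in> carrier M"
  unfolding link_sum_def by (rule carrier.sum) (simp add: neighbours_iff carrier_basis)

lemma relations_carrier: "chain_relations S W \<subseteq> carrier M"
  unfolding chain_relations_eq using N_carrier carrier.diff by blast

lemma J_minimal: "chain_relations S W \<subseteq> H \<Longrightarrow> H \<subseteq> carrier M \<Longrightarrow> span H \<Longrightarrow> J \<subseteq> H"
  unfolding chain_submodule_def submodule_iff by blast

lemma J_relations: "chain_relations S W \<subseteq> J"
  unfolding chain_submodule_def by blast

sublocale J: span J
proof
  have span: "span H" if "H \<in> {N. submodule N (ground_ring :: 'k ring) M \<and> chain_relations S W \<subseteq> N}" for H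
    using that by (simp add: submodule_iff)
  show "0 \<in> J" unfolding chain_submodule_def by (rule InterI) (rule span.zero[OF span])
  show "x + y \<in> J" if xy: "x \<in> J" "y \<in> J" for x y
    unfolding chain_submodule_def
  proof (rule InterI)
    fix H assume H: "H \<in> {N. submodule N (ground_ring :: 'k ring) M \<and> chain_relations S W \<subseteq> N}"
    show "x + y \<in> H" using xy unfolding chain_submodule_def by (intro span.add[OF span[OF H]] InterD[OF _ H])
  qed
  show "scale c x \<in> J" if x: "x \<in> J" for c x
    unfolding chain_submodule_def
  proof (rule InterI)
    fix H assume H: "H \<in> {N. submodule N (ground_ring :: 'k ring) M \<and> chain_relations S W \<subseteq> N}"
    show "scale c x \<in> H" using x unfolding chain_submodule_def by (intro span.scale[OF span[OF H]] InterD[OF _ H])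
  qed
qed

sublocale link: link_relations S W E J N
proof
  show "N T X Y = (\<Sum>\<rho>\<in>{\<rho> \<in> neighbours S W T. separates \<rho> X Y}. E (insert \<rho> T))" for T X Y
    by (simp add: link_sum_def)
  show "N T {i, j} {k, l} - N T {k, j} {i, l} \<in> J"
    if "T \<in> C" "allowed S W i j k l" "\<And>\<rho>. \<rho> \<in> T \<Longrightarrow> \<not> separates \<rho> {i, j} {k, l} \<and>
      \<not> separates \<rho> {k, j} {i, l} \<and> \<not> separates \<rho> {i, k} {j, l}" for T i j k l
  proof -
    have "unseparated T i j k l" using that(3) by (simp add: unseparated_def)
    then have "N T {i, j} {k, l} - N T {k, j} {i, l} \<in> chain_relations S W"
      unfolding chain_relations_eq mem_Collect_eq using that(1,2)
      by (intro exI[of _ T] exI[of _ i] exI[of _ j] exI[of _ k] exI[of _ l] conjI refl)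
    then show ?thesis by (rule subsetD[OF J_relations])
  qed
qed (simp_all add: J.zero J.add J.minus)

section \<open>The operators of the variables on chains\<close>

lemma quad_prop:
  assumes "T \<in> C" "\<sigma> \<in> T"
  shows "\<exists>i j k l. quad S W T \<sigma> = (i, j, k, l) \<and> allowed S W i j k l \<and> separates \<sigma> {i, j} {k, l} \<and>
    (\<forall>\<rho>\<in>T. separates \<rho> {i, j} {k, l} \<longrightarrow> \<rho> = \<sigma>)"
proof -
  let ?P = "\<lambda>(i, j, k, l). allowed S W i j k l \<and> separates \<sigma> {i, j} {k, l} \<and>
    (\<forall>\<rho>\<in>T. separates \<rho> {i, j} {k, l} \<longrightarrow> \<rho> = \<sigma>)"
  have "\<exists>q. ?P q" using simple_quadruple[OF painted assms] by (simp add: split_paired_Ex)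
  then have "?P (quad S W T \<sigma>)" unfolding quad_def by (rule someI_ex)
  then show ?thesis by (cases "quad S W T \<sigma>") simp
qed

lemma simpleI:
  assumes "allowed S W i j k l" "\<sigma> \<in> T" "separates \<sigma> {i, j} {k, l}"
    "\<And>\<rho>. \<rho> \<in> T \<Longrightarrow> separates \<rho> {i, j} {k, l} \<Longrightarrow> \<rho> = \<sigma>"
  shows "link.simple T \<sigma> {i, j} {k, l}"
proof -
  have "card {i, j} = 2" "card {k, l} = 2" "{i, j} \<inter> W \<noteq> {}" "{k, l} \<inter> W \<noteq> {}"
    using assms(1) unfolding allowed_iff by auto
  then show ?thesis unfolding link.simple_def using assms(2-4) by blast
qed

lemma near_far_simple:
  assumes "T \<in> C" "\<sigma> \<in> T" shows "link.simple T \<sigma> (near S W T \<sigma>) (far S W T \<sigma>)"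
proof -
  obtain i j k l where q: "quad S W T \<sigma> = (i, j, k, l)" "allowed S W i j k l" "separates \<sigma> {i, j} {k, l}"
    "\<forall>\<rho>\<in>T. separates \<rho> {i, j} {k, l} \<longrightarrow> \<rho> = \<sigma>" using quad_prop[OF assms] by blast
  then show ?thesis unfolding near_def far_def using simpleI[OF q(2) assms(2) q(3)] by simp
qed

lemma A_basis:
  assumes T: "T \<in> C"
  shows "A \<sigma> (E T) = (if \<sigma> \<in> T then - N T (near S W T \<sigma>) (far S W T \<sigma>)
    else if \<sigma> \<in> neighbours S W T then E (insert \<sigma> T) else 0)"
  unfolding var_act_def basis_def[of S W T] extend_single family_of_class[OF T] Let_def by simp

lemma A_linear: "linear_operator (A \<sigma>)"
  unfolding var_act_def by (rule linear_extend)

text \<open>Members of \<open>T\<close> contribute through rule (3), which yields the correction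
  terms in the form treated by \<open>linear_relation_link\<close>.\<close>

lemma sum_A:
  assumes T: "T \<in> C"
  shows "(\<Sum>\<rho>\<in>{\<rho> \<in> V. separates \<rho> X Y}. A \<rho> (E T)) =
    N T X Y - (\<Sum>\<sigma>\<in>{\<sigma> \<in> T. separates \<sigma> X Y}. N T (near S W T \<sigma>) (far S W T \<sigma>))"
proof -
  let ?V = "{\<rho> \<in> V. separates \<rho> X Y}"
  let ?n = "\<lambda>\<sigma>. N T (near S W T \<sigma>) (far S W T \<sigma>)"
  have "(\<Sum>\<rho>\<in>?V. A \<rho> (E T)) =
      (\<Sum>\<rho>\<in>?V. (if \<rho> \<in> neighbours S W T then E (insert \<rho> T) else 0) - (if \<rho> \<in> T then ?n \<rho> else 0))"
    by (intro sum.cong refl) (auto simp: A_basis[OF T] neighbours_def)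
  also have "\<dots> = (\<Sum>\<rho>\<in>{\<rho> \<in> ?V. \<rho> \<in> neighbours S W T}. E (insert \<rho> T)) - (\<Sum>\<rho>\<in>{\<rho> \<in> ?V. \<rho> \<in> T}. ?n \<rho>)"
  proof -
    have "finite ?V" using finite_partitions by simp
    then show ?thesis by (simp only: sum_subtractf sum.inter_filter)
  qed
  also have "{\<rho> \<in> ?V. \<rho> \<in> neighbours S W T} = {\<rho> \<in> neighbours S W T. separates \<rho> X Y}"
    by (auto simp: neighbours_def)
  also have "{\<rho> \<in> ?V. \<rho> \<in> T} = {\<rho> \<in> T. separates \<rho> X Y}"
    using T by (auto simp: families_def)
  finally show ?thesis by (simp add: link_sum_def[of S W T X Y])
qed

text \<open>The linear function of the chosen quadruple, taking the role of \<open>m\<close> in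
  \<open>fan_action\<close>.\<close>

definition slope :: "'a set set set \<Rightarrow> 'a set set \<Rightarrow> 'a set set \<Rightarrow> 'k" where
  "slope T \<sigma> = (case quad S W T \<sigma> of (i, j, k, l) \<Rightarrow> coefficient i j k l)"

sublocale fan: fan_action J V C E A
  "{coefficient i j k l | i j k l. allowed S W i j k l}" slope
proof
  show "finite V" by (rule finite_partitions)
  show "T \<subseteq> V" if "T \<in> C" for T using that by (simp add: families_def)
  show "T \<in> C" if "insert \<sigma> T \<in> C" for \<sigma> T using that by (simp add: families_def)
  show "A \<sigma> (x + y) = A \<sigma> x + A \<sigma> y" "A \<sigma> (scale c x) = scale c (A \<sigma> x)" for \<sigma> x y c
    by (rule linear_operator.add[OF A_linear] linear_operator.scale[OF A_linear])+
  show A_new: "A \<sigma> (E T) = (if insert \<sigma> T \<in> C then E (insert \<sigma> T) else 0)"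
    if "T \<in> C" "\<sigma> \<in> V" "\<sigma> \<notin> T" for \<sigma> T
    using that by (simp add: A_basis neighbours_iff)
  fix T \<sigma> assume T: "T \<in> C" and \<sigma>: "\<sigma> \<in> T"
  obtain i j k l where q: "quad S W T \<sigma> = (i, j, k, l)" "allowed S W i j k l" "separates \<sigma> {i, j} {k, l}"
    "\<forall>\<rho>\<in>T. separates \<rho> {i, j} {k, l} \<longrightarrow> \<rho> = \<sigma>" using quad_prop[OF T \<sigma>] by blast
  have sl: "slope T \<sigma> = coefficient i j k l" by (simp add: slope_def q(1))
  \<comment> \<open>A member of \<open>T\<close> separating the crossing pairing would be
    incompatible with \<sigma>, so the negative half of the coefficient vanishes on
    \<open>T\<close>.\<close>
  have nc: "\<not> separates \<rho> {k, j} {i, l}" if "\<rho> \<in> T" for \<rho>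
    using separates_incompatible[OF q(3) familiesD(1)[OF T \<sigma>] _ familiesD(1)[OF T that]] familiesD(2)[OF T \<sigma> that]
    by blast
  show "slope T \<sigma> \<in> {coefficient i j k l | i j k l. allowed S W i j k l}" using sl q(2) by blast
  show "slope T \<sigma> \<sigma> = 1" using q(3) nc[OF \<sigma>] by (simp add: sl coefficient_def)
  show "slope T \<sigma> \<rho> = 0" if "\<rho> \<in> T" "\<rho> \<noteq> \<sigma>" for \<rho>
    using q(4) nc that by (auto simp: sl coefficient_def)
  \<comment> \<open>Outside \<open>T\<close> only neighbours have a nonzero product, and they cannot
    separate the crossing pairing either. So the coefficient reduces to its positive half.\<close>
  have "(\<Sum>\<rho>\<in>V - T. scale (slope T \<sigma> \<rho>) (A \<rho> (E T))) = N T {i, j} {k, l}"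
  proof -
    have "(\<Sum>\<rho>\<in>V - T. scale (slope T \<sigma> \<rho>) (A \<rho> (E T))) =
        (\<Sum>\<rho>\<in>neighbours S W T. if separates \<rho> {i, j} {k, l} then E (insert \<rho> T) else 0)"
    proof (rule sum.mono_neutral_cong_right)
      show "scale (slope T \<sigma> \<rho>) (A \<rho> (E T)) = (if separates \<rho> {i, j} {k, l} then E (insert \<rho> T) else 0)"
        if "\<rho> \<in> neighbours S W T" for \<rho>
        using that link.neighbour_not_crossing[OF \<sigma> q(3) T that] neighboursD(2)[OF that]
        by (simp add: sl coefficient_def A_basis[OF T])
      show "\<forall>\<rho>\<in>V - T - neighbours S W T. scale (slope T \<sigma> \<rho>) (A \<rho> (E T)) = 0"
        by (simp add: A_basis[OF T])
    qed (use finite_partitions in \<open>auto simp: neighbours_def\<close>)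
    then show ?thesis by (simp add: link.N_sum)
  qed
  then show "A \<sigma> (E T) = - (\<Sum>\<rho>\<in>V - T. scale (slope T \<sigma> \<rho>) (A \<rho> (E T)))"
    using \<sigma> by (simp add: A_basis[OF T] near_def far_def q(1))
next
  fix f :: "'a set set \<Rightarrow> 'k" and T
  assume "f \<in> {coefficient i j k l | i j k l. allowed S W i j k l}" and T: "T \<in> C"
  then obtain i j k l where f: "f = coefficient i j k l" and q: "allowed S W i j k l" by blast
  show "(\<Sum>\<rho>\<in>V. scale (f \<rho>) (A \<rho> (E T))) \<in> J"
    unfolding f coefficient_sum[OF finite_partitions] sum_A[OF T]
    by (rule link.linear_relation_link[OF T near_far_simple[OF T] q])
qed

lemma A_carrier: "x \<in> carrier M \<Longrightarrow> A \<sigma> x \<in> carrier M"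
proof (induction rule: carrier_induct)
  case (basis T)
  then show ?case
    using N_carrier carrier_basis by (auto simp: A_basis neighbours_iff carrier_zero carrier.minus)
qed (simp_all add: fan.op.add fan.op.scale carrier.zero carrier.add carrier.scale)

lemma A_comm:
  assumes "\<sigma> \<in> V" "\<rho> \<in> V" "x \<in> carrier M"
  shows "A \<sigma> (A \<rho> x) - A \<rho> (A \<sigma> x) \<in> J"
  using assms(3)
proof (induction rule: carrier_induct)
  case (basis T)
  then show ?case by (rule fan.comm[OF _ assms(1,2)])
next
  case (add x y)
  then show ?case using J.add[OF add] by (simp add: fan.op.add algebra_simps)
next
  case (scale c x)
  then show ?case using J.scale[OF scale, of c] by (simp add: fan.op.scale scale_distribs)
qed (simp add: J.zero)

lemma A_linear_relation:
  assumes "allowed S W i j k l" "x \<in> carrier M"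
  shows "(\<Sum>\<rho>\<in>{\<rho> \<in> V. separates \<rho> {i, j} {k, l}}. A \<rho> x) - (\<Sum>\<rho>\<in>{\<rho> \<in> V. separates \<rho> {k, j} {i, l}}. A \<rho> x) \<in> J"
  unfolding coefficient_sum[OF finite_partitions, symmetric]
  using assms(2)
proof (induction rule: carrier_induct)
  case (basis T)
  then show ?case using fan.rel[of "coefficient i j k l"] assms(1) by blast
next
  case (add x y)
  then show ?case using J.add[OF add] by (simp add: fan.op.add scale_distribs sum.distrib)
next
  case (scale c x)
  then show ?case using J.scale[OF scale, of c]
    by (simp add: fan.op.scale scale_scale scale_sum mult.commute)
qed (simp add: J.zero)

text \<open>This is exact, not only modulo \<open>J\<close>: every basis element occurring in
  \<open>A \<rho> (E T)\<close> has a family containing \<rho>, and \<sigma> neither belongs to such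
  a family nor extends it.\<close>

lemma A_incompatible:
  assumes \<sigma>: "\<sigma> \<in> V" "\<rho> \<in> V" "\<not> compat \<sigma> \<rho>" and x: "x \<in> carrier M"
  shows "A \<sigma> (A \<rho> x) = 0"
  using x
proof (induction rule: carrier_induct)
  case (basis T)
  have zero: "A \<sigma> (E T') = 0" if T': "T' \<in> C" "\<rho> \<in> T'" for T'
  proof -
    have "\<sigma> \<notin> T'" using familiesD(2)[OF T'(1)] T'(2) \<sigma>(3) by blast
    moreover have "\<sigma> \<notin> neighbours S W T'" using neighboursD(3)[of \<sigma> S W T' \<rho>] T'(2) \<sigma>(3) by blast
    ultimately show ?thesis by (simp add: A_basis[OF T'(1)])
  qed
  show ?case
  proof (cases "\<rho> \<in> T")
    case True
    have "A \<sigma> (N T X Y) = 0" for X Y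
      unfolding link_sum_def fan.op.sum
      by (rule sum.neutral) (use zero True neighbours_iff[OF basis] in auto)
    then show ?thesis using True by (simp add: A_basis[OF basis] fan.op.minus)
  next
    case False
    then show ?thesis using zero neighbours_iff[OF basis] by (simp add: A_basis[OF basis])
  qed
qed (simp_all add: fan.op.add fan.op.scale)

text \<open>For an unseparated quadruple no member of \<open>T\<close> contributes to the relation
  operator. So a generator of \<open>J\<close> is that operator applied to \<open>E T\<close>, and
  \<open>rel_stable\<close> applies.\<close>

lemma A_J:
  assumes \<sigma>: "\<sigma> \<in> V" and x: "x \<in> J" shows "A \<sigma> x \<in> J"
proof -
  let ?H = "{x \<in> carrier M. A \<sigma> x \<in> J}"
  have "J \<subseteq> ?H"
  proof (rule J_minimal)
    show "span ?H"
      by unfold_locales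
        (auto simp: fan.op.add fan.op.scale carrier.zero carrier.add carrier.scale J.zero J.add J.scale)
    show "chain_relations S W \<subseteq> ?H"
    proof
      fix r :: "('a, 'k) chain" assume r: "r \<in> chain_relations S W"
      then obtain T i j k l where T: "T \<in> C" and q: "allowed S W i j k l" and u: "unseparated T i j k l"
        and r': "r = N T {i, j} {k, l} - N T {k, j} {i, l}"
        unfolding chain_relations_eq mem_Collect_eq by (elim exE conjE) (rule that)
      have "{\<sigma> \<in> T. separates \<sigma> {i, j} {k, l}} = {}" "{\<sigma> \<in> T. separates \<sigma> {k, j} {i, l}} = {}"
        using u by (auto simp: unseparated_def)
      then have "(\<Sum>\<rho>\<in>V. scale (coefficient i j k l \<rho>) (A \<rho> (E T))) = r"
        unfolding coefficient_sum[OF finite_partitions] sum_A[OF T] r' by (simp only: sum.empty diff_zero)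
      then have "A \<sigma> r \<in> J" using fan.rel_stable[of "coefficient i j k l" T \<sigma>] q T \<sigma> by auto
      then show "r \<in> ?H" using r relations_carrier by blast
    qed
  qed auto
  then show ?thesis using x by blast
qed

section \<open>Comparison of the operators with the prescription\<close>

lemma breaks_at_edge_iff: "(\<exists>f. breaks_at_edge S \<sigma> \<tau> f) \<longleftrightarrow> \<sigma> \<in> splits S \<tau>"
  by (auto simp: breaks_at_edge_def splits_def)

lemma neighbours_breaks:
  assumes "\<tau> \<in> stable_trees S W" "\<sigma> \<in> V"
  shows "(\<exists>v. breaks_at_vertex S W \<sigma> \<tau> v) \<longleftrightarrow> \<sigma> \<in> neighbours S W (splits S \<tau>)"
  using breaks_at_vertex_iff[OF painted assms] assms(2) by (simp add: neighbours_def)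

text \<open>A quadruple permitted in (3) gives \<open>simple\<close> data, so the resulting value
  differs from the one built into \<open>A\<close> by an element of \<open>J\<close>. Only the sum
  of both terms is identified with a sum over the link, hence the claim about
  \<open>a + b\<close>.\<close>

lemma edge_prescription:
  assumes \<tau>: "\<tau> \<in> stable_trees S W" and br: "breaks_at_edge S \<sigma> \<tau> e1" and e2: "e2 = opp \<tau> e1"
    and IJ: "I \<in> flags_at \<tau> (base \<tau> e1) - {e1}" "J' \<in> flags_at \<tau> (base \<tau> e1) - {e1}" "I \<noteq> J'"
    and KL: "K \<in> flags_at \<tau> (base \<tau> e2) - {e2}" "L \<in> flags_at \<tau> (base \<tau> e2) - {e2}" "K \<noteq> L"
    and al: "allowed_flags S W \<tau> I J' K L"
    and a: "a = (\<Sum>\<alpha> \<in> {\<alpha> \<in> stable_flag_partitions S W \<tau> (base \<tau> e1). separates \<alpha> {I, J'} {e1}}. mu S W (split_tree S W \<tau> \<alpha>))"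
    and b: "b = (\<Sum>\<beta> \<in> {\<beta> \<in> stable_flag_partitions S W \<tau> (base \<tau> e2). separates \<beta> {e2} {K, L}}. mu S W (split_tree S W \<tau> \<beta>))"
  shows "- a - b - A \<sigma> (mu S W \<tau>) \<in> J" and "a + b \<in> carrier M"
proof -
  interpret stable_tree S W \<tau> by (rule stable_treeI[OF \<tau>])
  let ?T = "splits S \<tau>"
  have T: "?T \<in> C" by (rule splits_family[OF \<tau>])
  have e1: "e1 \<in> halves \<tau>" "\<sigma> = edge_partition S \<tau> e1" using br by (auto simp: breaks_at_edge_def)
  have \<sigma>: "\<sigma> \<in> ?T" using e1 by (simp add: splits_def)
  obtain i j k l where q: "i \<in> B I" "j \<in> B J'" "k \<in> B K" "l \<in> B L" "allowed S W i j k l"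
    using al by (auto simp: allowed_flags_def)
  note es = edge_sum[OF e1(1) e2 IJ KL q(1-4)]
  have "link.simple ?T \<sigma> {i, j} {k, l}"
    by (rule simpleI[OF q(5) \<sigma>]) (use es(2,3) e1(2) in auto)
  then have "N ?T (near S W ?T \<sigma>) (far S W ?T \<sigma>) - N ?T {i, j} {k, l} \<in> J"
    using link.simple_independent[OF T near_far_simple[OF T \<sigma>]] by blast
  moreover have ab: "a + b = N ?T {i, j} {k, l}"
    unfolding a b es(1) sum_star[OF \<tau>] ..
  moreover have "- a - b - A \<sigma> (mu S W \<tau>) = N ?T (near S W ?T \<sigma>) (far S W ?T \<sigma>) - (a + b)"
    using \<sigma> by (simp add: mu_basis[OF \<tau>] A_basis[OF T])
  ultimately show "- a - b - A \<sigma> (mu S W \<tau>) \<in> J" by simp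
  show "a + b \<in> carrier M" unfolding ab by (rule N_carrier[OF T])
qed

text \<open>All prescribed values are compared with the single operator \<open>A\<close>; therefore
  any two of them agree modulo \<open>J\<close>.\<close>

lemma prescribed_A:
  assumes \<sigma>: "\<sigma> \<in> V" and \<tau>: "\<tau> \<in> stable_trees S W" and x: "prescribed S W \<sigma> \<tau> (x :: ('a, 'k) chain)"
  shows "x \<in> carrier M \<and> x - A \<sigma> (mu S W \<tau>) \<in> J"
proof -
  note T = splits_family[OF \<tau>]
  from x show ?thesis
  proof cases
    case no_break
    then have "\<sigma> \<notin> splits S \<tau>" "\<sigma> \<notin> neighbours S W (splits S \<tau>)"
      using breaks_at_edge_iff[of \<sigma> \<tau>] neighbours_breaks[OF \<tau> \<sigma>] by auto
    then show ?thesis using no_break(1) by (simp add: mu_basis[OF \<tau>] A_basis[OF T] J.zero carrier_zero)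
  next
    case (at_vertex v)
    then have n: "\<sigma> \<in> neighbours S W (splits S \<tau>)" using neighbours_breaks[OF \<tau> \<sigma>] by blast
    then have "insert \<sigma> (splits S \<tau>) \<in> C" using neighbours_iff[OF T] by blast
    then show ?thesis
      using neighboursD(2)[OF n] n at_vertex(1)
      by (simp add: mu_basis[OF \<tau>] A_basis[OF T] star_basis[OF \<tau>] J.zero carrier_basis)
  next
    case (at_edge e1 e2 v1 v2 I J' K L)
    note p = edge_prescription[OF \<tau> at_edge(2,3) at_edge(6,7)[unfolded at_edge(4)] at_edge(8)
        at_edge(9,10)[unfolded at_edge(5)] at_edge(11,12) refl refl]
    have "- x \<in> carrier M" using p(2) unfolding at_edge(1,4,5) by (simp add: add.commute)
    then have "x \<in> carrier M" using carrier.minus[of "- x"] by simp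
    then show ?thesis using p(1) unfolding at_edge(1,4,5) by blast
  qed
qed

lemma prescribed_exists:
  assumes \<sigma>: "\<sigma> \<in> V" and \<tau>: "\<tau> \<in> stable_trees S W"
  shows "\<exists>x :: ('a, 'k) chain. prescribed S W \<sigma> \<tau> x"
proof (cases "\<exists>f. breaks_at_edge S \<sigma> \<tau> f")
  case True
  then obtain e1 where e1: "breaks_at_edge S \<sigma> \<tau> e1" by blast
  interpret stable_tree S W \<tau> by (rule stable_treeI[OF \<tau>])
  have "e1 \<in> halves \<tau>" using e1 by (simp add: breaks_at_edge_def)
  from edge_quadruple[OF this refl] obtain I J' K L where
    q: "I \<in> flags_at \<tau> (base \<tau> e1) - {e1}" "J' \<in> flags_at \<tau> (base \<tau> e1) - {e1}" "I \<noteq> J'"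
    "K \<in> flags_at \<tau> (base \<tau> (opp \<tau> e1)) - {opp \<tau> e1}" "L \<in> flags_at \<tau> (base \<tau> (opp \<tau> e1)) - {opp \<tau> e1}"
    "K \<noteq> L" "allowed_flags S W \<tau> I J' K L" by blast
  show ?thesis by (rule exI, rule prescribed.at_edge[OF e1 refl refl refl q])
next
  case False
  show ?thesis
  proof (cases "\<exists>v. breaks_at_vertex S W \<sigma> \<tau> v")
    case True
    then show ?thesis using prescribed.at_vertex by blast
  next
    case nv: False
    show ?thesis by (rule exI, rule prescribed.no_break[OF False nv])
  qed
qed

end


section \<open>The action of polynomials\<close>

text \<open>Induction on the total degree, splitting off one variable.\<close>

lemma monomial_induct [consumes 2, case_names one step]:
  fixes m :: "'v \<Rightarrow>\<^sub>0 nat"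
  assumes V: "finite V" and m: "Poly_Mapping.keys m \<subseteq> V" and "P 0"
    and step: "\<And>m \<sigma>. \<sigma> \<in> V \<Longrightarrow> Poly_Mapping.keys m \<subseteq> V \<Longrightarrow> P m \<Longrightarrow> P (m + Poly_Mapping.single \<sigma> 1)"
  shows "P m"
  using m
proof (induction "\<Sum>\<sigma>\<in>V. Poly_Mapping.lookup m \<sigma>" arbitrary: m)
  case 0
  then have "\<forall>\<sigma>\<in>V. Poly_Mapping.lookup m \<sigma> = 0" using V by (metis sum_eq_0_iff)
  then have "m = 0" using 0(2) by (intro poly_mapping_eqI) (metis in_keys_iff lookup_zero subsetD)
  then show ?case using assms(3) by simp
next
  case (Suc n)
  then have "(\<Sum>\<sigma>\<in>V. Poly_Mapping.lookup m \<sigma>) \<noteq> 0" by simp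
  then obtain \<sigma> where \<sigma>: "\<sigma> \<in> V" "Poly_Mapping.lookup m \<sigma> \<noteq> 0" using V by (metis sum_eq_0_iff)
  let ?m = "m - Poly_Mapping.single \<sigma> 1"
  have m: "m = ?m + Poly_Mapping.single \<sigma> 1"
    by (rule poly_mapping_eqI) (use \<sigma>(2) in \<open>auto simp: lookup_add lookup_minus lookup_single when_def\<close>)
  have k: "Poly_Mapping.keys ?m \<subseteq> V"
    using Suc(3) by (auto simp: in_keys_iff lookup_minus)
  have "(\<Sum>\<rho>\<in>V. Poly_Mapping.lookup m \<rho>) =
      (\<Sum>\<rho>\<in>V. Poly_Mapping.lookup ?m \<rho> + (if \<rho> = \<sigma> then 1 else 0))"
    by (subst m) (intro sum.cong refl, simp add: lookup_add lookup_single when_def)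
  then have "n = (\<Sum>\<rho>\<in>V. Poly_Mapping.lookup ?m \<rho>)" using Suc(2) V \<sigma>(1) by (simp add: sum.distrib)
  then have "P ?m" using Suc(1) k by blast
  then show ?case using step[OF \<sigma>(1) k] m by simp
qed

lemma a_r_coset_plus: "add G = (+) \<Longrightarrow> N +>\<^bsub>G\<^esub> x = (\<lambda>n. n + x) ` N"
  by (auto simp: a_r_coset_def r_coset_def)

context tree_homology
begin

lemma diff_trans:
  assumes "x - y - (z - w) \<in> J" "y - w \<in> J" shows "x - z \<in> J"
  using J.add[OF assms] by (simp add: algebra_simps)

lemma A_power:
  shows "linear_operator (A \<sigma> ^^ n)"
    and "x \<in> carrier M \<Longrightarrow> (A \<sigma> ^^ n) x \<in> carrier M"
    and "\<sigma> \<in> V \<Longrightarrow> x \<in> J \<Longrightarrow> (A \<sigma> ^^ n) x \<in> J"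
proof -
  show "linear_operator (A \<sigma> ^^ n)"
    by (induction n) (simp_all add: linear_operator_def fan.op.add fan.op.scale)
  show "x \<in> carrier M \<Longrightarrow> (A \<sigma> ^^ n) x \<in> carrier M" by (induction n) (simp_all add: A_carrier)
  show "\<sigma> \<in> V \<Longrightarrow> x \<in> J \<Longrightarrow> (A \<sigma> ^^ n) x \<in> J" by (induction n) (simp_all add: A_J)
qed

lemma A_cong: "\<sigma> \<in> V \<Longrightarrow> x - y \<in> J \<Longrightarrow> A \<sigma> x - A \<sigma> y \<in> J"
  using A_J[of \<sigma> "x - y"] by (simp add: fan.op.diff)

lemma A_power_comm:
  assumes "\<sigma> \<in> V" "\<rho> \<in> V" "x \<in> carrier M"
  shows "(A \<sigma> ^^ n) (A \<rho> x) - A \<rho> ((A \<sigma> ^^ n) x) \<in> J"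
proof (induction n)
  case (Suc n)
  show ?case
    using J.trans[OF A_cong[OF assms(1) Suc] A_comm[OF assms(1,2) A_power(2)[OF assms(3)]]] by simp
qed (simp add: J.zero)

text \<open>The operators commute only modulo \<open>J\<close>, so monomials act on chains in a fixed order of the variables.\<close>

definition monomial_on :: "('a set set \<Rightarrow>\<^sub>0 nat) \<Rightarrow> 'a set set list \<Rightarrow> ('a, 'k) chain \<Rightarrow> ('a, 'k) chain" where
  "monomial_on m = foldr (\<lambda>\<sigma>. A \<sigma> ^^ Poly_Mapping.lookup m \<sigma>)"

lemma monomial_on:
  shows "linear_operator (monomial_on m \<sigma>s)"
    and "x \<in> carrier M \<Longrightarrow> monomial_on m \<sigma>s x \<in> carrier M"
    and "set \<sigma>s \<subseteq> V \<Longrightarrow> x \<in> J \<Longrightarrow> monomial_on m \<sigma>s x \<in> J"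
proof -
  show "linear_operator (monomial_on m \<sigma>s)"
    by (induction \<sigma>s)
      (simp_all add: monomial_on_def linear_operator_def A_power(1)[unfolded linear_operator_def])
  show "x \<in> carrier M \<Longrightarrow> monomial_on m \<sigma>s x \<in> carrier M"
    by (induction \<sigma>s) (simp_all add: monomial_on_def A_power(2))
  show "set \<sigma>s \<subseteq> V \<Longrightarrow> x \<in> J \<Longrightarrow> monomial_on m \<sigma>s x \<in> J"
    by (induction \<sigma>s) (simp_all add: monomial_on_def A_power(3))
qed

lemma monomial_on_cong:
  "(\<And>\<rho>. \<rho> \<in> set \<sigma>s \<Longrightarrow> Poly_Mapping.lookup m \<rho> = Poly_Mapping.lookup m' \<rho>) \<Longrightarrow>
    monomial_on m \<sigma>s x = monomial_on m' \<sigma>s x"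
  by (induction \<sigma>s) (simp_all add: monomial_on_def)

text \<open>Raising the exponent of \<sigma> inserts a factor at the place of \<sigma> in the list;
  moving it to the front past the powers of earlier variables costs only elements of
  \<open>J\<close>.\<close>

lemma monomial_on_step:
  assumes x: "x \<in> carrier M" and \<sigma>: "\<sigma> \<in> V"
  shows "set \<sigma>s \<subseteq> V \<Longrightarrow> distinct \<sigma>s \<Longrightarrow> \<sigma> \<in> set \<sigma>s \<Longrightarrow>
    monomial_on (m + Poly_Mapping.single \<sigma> 1) \<sigma>s x - A \<sigma> (monomial_on m \<sigma>s x) \<in> J"
proof (induction \<sigma>s)
  case (Cons \<rho> \<sigma>s)
  let ?m = "m + Poly_Mapping.single \<sigma> 1"
  have lk: "Poly_Mapping.lookup (m + Poly_Mapping.single \<sigma> (Suc 0)) \<kappa> = Poly_Mapping.lookup m \<kappa> + (if \<kappa> = \<sigma> then 1 else 0)" for \<kappa>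
    by (simp add: lookup_add lookup_single when_def)
  have unf: "monomial_on m' (\<rho> # \<sigma>s) x = (A \<rho> ^^ Poly_Mapping.lookup m' \<rho>) (monomial_on m' \<sigma>s x)" for m'
    by (simp add: monomial_on_def)
  show ?case
  proof (cases "\<rho> = \<sigma>")
    case True
    then have "monomial_on ?m \<sigma>s x = monomial_on m \<sigma>s x"
      using Cons.prems(2) by (intro monomial_on_cong) (auto simp: lk)
    then show ?thesis unfolding unf using True by (simp add: lk J.zero)
  next
    case False
    let ?n = "Poly_Mapping.lookup m \<rho>"
    have \<rho>: "\<rho> \<in> V" using Cons.prems by simp
    have "monomial_on ?m \<sigma>s x - A \<sigma> (monomial_on m \<sigma>s x) \<in> J" using Cons False by simp
    then have "(A \<rho> ^^ ?n) (monomial_on ?m \<sigma>s x - A \<sigma> (monomial_on m \<sigma>s x)) \<in> J"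
      by (rule A_power(3)[OF \<rho>])
    then have "(A \<rho> ^^ ?n) (monomial_on ?m \<sigma>s x) - (A \<rho> ^^ ?n) (A \<sigma> (monomial_on m \<sigma>s x)) \<in> J"
      by (simp add: linear_operator.diff[OF A_power(1)])
    from J.trans[OF this A_power_comm[OF \<rho> \<sigma> monomial_on(2)[OF x]]]
    show ?thesis unfolding unf using False by (simp add: lk)
  qed
qed simp

definition variables :: "'a set set list" where
  "variables = (SOME \<sigma>s. set \<sigma>s = V \<and> distinct \<sigma>s)"

lemma variables: "set variables = V" "distinct variables"
  using someI_ex[OF finite_distinct_list[OF finite_partitions]] by (auto simp: variables_def)

definition monomial :: "('a set set \<Rightarrow>\<^sub>0 nat) \<Rightarrow> ('a, 'k) chain \<Rightarrow> ('a, 'k) chain" where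
  "monomial m = monomial_on m variables"

lemma monomial_linear: "linear_operator (monomial m)"
  and monomial_carrier: "x \<in> carrier M \<Longrightarrow> monomial m x \<in> carrier M"
  and monomial_J: "x \<in> J \<Longrightarrow> monomial m x \<in> J"
  using monomial_on variables(1) by (simp_all add: monomial_def)

lemma monomial_zero [simp]: "monomial 0 x = x"
proof -
  have "monomial_on 0 \<sigma>s x = x" for \<sigma>s by (induction \<sigma>s) (simp_all add: monomial_on_def)
  then show ?thesis by (simp add: monomial_def)
qed

lemma monomial_step:
  "x \<in> carrier M \<Longrightarrow> \<sigma> \<in> V \<Longrightarrow> monomial (m + Poly_Mapping.single \<sigma> 1) x - A \<sigma> (monomial m x) \<in> J"
  using monomial_on_step[of x \<sigma> variables m] variables by (simp add: monomial_def)

lemma monomial_add: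
  assumes x: "x \<in> carrier M" and m: "Poly_Mapping.keys m \<subseteq> V"
  shows "monomial (m + m') x - monomial m (monomial m' x) \<in> J"
  using finite_partitions m
proof (induction m rule: monomial_induct)
  case (step m \<sigma>)
  have "monomial (m + m' + Poly_Mapping.single \<sigma> 1) x - A \<sigma> (monomial (m + m') x) \<in> J"
    by (rule monomial_step[OF x step(1)])
  moreover have "A \<sigma> (monomial (m + m') x) - A \<sigma> (monomial m (monomial m' x)) \<in> J"
    by (rule A_cong[OF step(1,3)])
  moreover have "A \<sigma> (monomial m (monomial m' x)) - monomial (m + Poly_Mapping.single \<sigma> 1) (monomial m' x) \<in> J"
    by (rule J.sym[OF monomial_step[OF monomial_carrier[OF x] step(1)]])
  ultimately have "monomial (m + m' + Poly_Mapping.single \<sigma> 1) x -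
      monomial (m + Poly_Mapping.single \<sigma> 1) (monomial m' x) \<in> J" using J.trans by blast
  then show ?case by (simp add: ac_simps)
qed (simp add: J.zero)

definition evaluate :: "('a, 'k) poly \<Rightarrow> ('a, 'k) chain \<Rightarrow> ('a, 'k) chain" where
  "evaluate p x = extend (\<lambda>m. monomial m x) p"

lemma evaluate_linear: "linear_operator (evaluate p)"
  unfolding evaluate_def extend_def
  by unfold_locales
    (simp_all add: linear_operator.add[OF monomial_linear] linear_operator.scale[OF monomial_linear]
      scale_distribs sum.distrib scale_sum scale_scale mult.commute)

lemma evaluate_add: "evaluate (p + q) x = evaluate p x + evaluate q x"
  and evaluate_minus: "evaluate (- p) x = - evaluate p x"
  and evaluate_diff: "evaluate (p - q) x = evaluate p x - evaluate q x"
  and evaluate_zero: "evaluate 0 x = 0"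
  and evaluate_single: "evaluate (Poly_Mapping.single m c) x = scale c (monomial m x)"
  and evaluate_sum: "evaluate (sum g I) x = (\<Sum>i\<in>I. evaluate (g i) x)"
  by (simp_all add: evaluate_def extend_add extend_minus extend_diff extend_sum)

lemma evaluate_carrier: "x \<in> carrier M \<Longrightarrow> evaluate p x \<in> carrier M"
  unfolding evaluate_def extend_def by (intro carrier.sum carrier.scale monomial_carrier)

lemma evaluate_J: "x \<in> J \<Longrightarrow> evaluate p x \<in> J"
  unfolding evaluate_def extend_def by (intro J.sum J.scale monomial_J)

lemma evaluate_const: "evaluate (const c) x = scale c x"
  by (simp add: const_def evaluate_single)

lemma evaluate_var: "x \<in> carrier M \<Longrightarrow> \<sigma> \<in> V \<Longrightarrow> evaluate (var \<sigma>) x - A \<sigma> x \<in> J"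
  using monomial_step[of x \<sigma> 0] by (simp add: var_def evaluate_single)

section \<open>The polynomial ring and the action of its ideal on chains\<close>

abbreviation R :: "('a, 'k) poly ring" where "R \<equiv> poly_ring S W"
abbreviation I :: "('a, 'k) poly set" where "I \<equiv> ring_ideal S W"

lemma carrier_R: "carrier R = {p. \<forall>m\<in>Poly_Mapping.keys p. Poly_Mapping.keys m \<subseteq> V}"
  and R_simps [simp]: "add R = (+)" "mult R = (*)" "zero R = 0" "one R = const 1"
  by (simp_all add: poly_ring_def)

lemma evaluate_mult:
  assumes p: "p \<in> carrier R" and x: "x \<in> carrier M"
  shows "evaluate (p * q) x - evaluate p (evaluate q x) \<in> J"
proof (induction p rule: single_induct)
  case (single m c)
  have m: "Poly_Mapping.keys m \<subseteq> V" using p single by (simp add: carrier_R)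
  show ?case
  proof (induction q rule: single_induct)
    case (single m' c')
    have "scale (c * c') (monomial (m + m') x - monomial m (monomial m' x)) \<in> J"
      by (rule J.scale[OF monomial_add[OF x m]])
    then show ?case
      by (simp add: mult_single evaluate_single linear_operator.scale[OF monomial_linear] scale_distribs scale_scale)
  next
    case (add q q')
    then show ?case
      using J.add[OF add] by (simp add: distrib_left evaluate_add linear_operator.add[OF evaluate_linear] algebra_simps)
  qed (simp add: evaluate_zero linear_operator.zero[OF evaluate_linear] J.zero)
next
  case (add p p')
  then show ?case using J.add[OF add] by (simp add: distrib_right evaluate_add algebra_simps)
qed (simp add: evaluate_zero J.zero)

lemma carrier_R_zero: "0 \<in> carrier R"
  and carrier_R_add: "p \<in> carrier R \<Longrightarrow> q \<in> carrier R \<Longrightarrow> p + q \<in> carrier R"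
  and carrier_R_minus: "p \<in> carrier R \<Longrightarrow> - p \<in> carrier R"
  and carrier_R_mult: "p \<in> carrier R \<Longrightarrow> q \<in> carrier R \<Longrightarrow> p * q \<in> carrier R"
  and carrier_R_const: "const c \<in> carrier R"
  and carrier_R_var: "\<sigma> \<in> V \<Longrightarrow> var \<sigma> \<in> carrier R"
proof -
  show "0 \<in> carrier R" by (simp add: carrier_R)
  show "p \<in> carrier R \<Longrightarrow> q \<in> carrier R \<Longrightarrow> p + q \<in> carrier R"
    using keys_add[of p q] by (auto simp: carrier_R)
  show "p \<in> carrier R \<Longrightarrow> - p \<in> carrier R" by (simp add: carrier_R in_keys_iff)
  show "p * q \<in> carrier R" if pq: "p \<in> carrier R" "q \<in> carrier R"
    unfolding carrier_R mem_Collect_eq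
  proof
    fix m assume "m \<in> Poly_Mapping.keys (p * q)"
    then obtain a b where ab: "a \<in> Poly_Mapping.keys p" "b \<in> Poly_Mapping.keys q" "m = a + b"
      using keys_mult[of p q] by blast
    then have "Poly_Mapping.keys a \<subseteq> V" "Poly_Mapping.keys b \<subseteq> V" using pq by (auto simp: carrier_R)
    then show "Poly_Mapping.keys m \<subseteq> V" using keys_add[of a b] ab(3) by blast
  qed
  show "const c \<in> carrier R" by (cases "c = 0") (auto simp: carrier_R const_def)
  \<comment> \<open>Over the zero ring a variable is the zero polynomial and has no monomials at
    all, hence the case distinction.\<close>
  show "\<sigma> \<in> V \<Longrightarrow> var \<sigma> \<in> carrier R"
    by (cases "(1 :: 'k) = 0") (auto simp: carrier_R var_def)
qed

lemma const_one_mult: "const 1 * p = (p :: ('a, 'k) poly)"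
  by (induction p rule: single_induct) (simp_all add: const_def mult_single distrib_left)

lemma mult_const_one: "p * const 1 = (p :: ('a, 'k) poly)"
  using const_one_mult[of p] by (simp add: mult.commute)

lemma R_cring: "cring R"
proof (rule cringI)
  show "abelian_group R"
  proof (rule abelian_groupI)
    fix p assume "p \<in> carrier R"
    then have "- p \<in> carrier R" "- p \<oplus>\<^bsub>R\<^esub> p = \<zero>\<^bsub>R\<^esub>" by (simp_all add: carrier_R_minus)
    then show "\<exists>q\<in>carrier R. q \<oplus>\<^bsub>R\<^esub> p = \<zero>\<^bsub>R\<^esub>" by blast
  qed (simp_all add: carrier_R_zero carrier_R_add ac_simps)
  show "comm_monoid R"
    by (rule comm_monoidI) (simp_all add: carrier_R_const carrier_R_mult const_one_mult mult_const_one ac_simps)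
qed (simp add: distrib_right)

lemma R_ring: "ring R"
  using R_cring by (simp add: cring_def)

lemma R_minus: "p \<in> carrier R \<Longrightarrow> \<ominus>\<^bsub>R\<^esub> p = - p"
  by (rule abelian_group.minus_equality[OF ring.is_abelian_group[OF R_ring]]) (simp_all add: carrier_R_minus)

lemma relations_R: "ring_relations S W \<subseteq> carrier R"
proof
  have sum: "sum g K \<in> carrier R" if "\<And>i. i \<in> K \<Longrightarrow> g i \<in> carrier R" for g :: "'a set set \<Rightarrow> ('a, 'k) poly" and K
    using that by (induction K rule: infinite_finite_induct) (auto intro: carrier_R_zero carrier_R_add)
  fix r :: "('a, 'k) poly" assume "r \<in> ring_relations S W"
  then consider i j k l where "r = linear_relation S W i j k l"
    | \<sigma> \<rho> where "r = var \<sigma> * var \<rho>" "\<sigma> \<in> V" "\<rho> \<in> V"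
    unfolding ring_relations_def by blast
  then show "r \<in> carrier R"
  proof cases
    case 1
    then show ?thesis
      unfolding 1 linear_relation_def diff_conv_add_uminus
      by (intro carrier_R_add carrier_R_minus sum carrier_R_var) auto
  next
    case 2
    then show ?thesis by (simp add: carrier_R_mult carrier_R_var)
  qed
qed

lemma I_ideal: "ideal I R"
  unfolding ring_ideal_def by (rule ring.genideal_ideal[OF R_ring relations_R])

text \<open>The linear relations are covered by \<open>A_linear_relation\<close>; the two factors of
  a product relation are incompatible splits, whose operators compose to zero.\<close>

lemma relations_evaluate:
  assumes r: "r \<in> ring_relations S W" and x: "x \<in> carrier M"
  shows "evaluate r x \<in> J"
proof -
  from r consider i j k l where "r = linear_relation S W i j k l" "allowed S W i j k l"
    | \<sigma> \<rho> i j k l where "r = var \<sigma> * var \<rho>" "\<sigma> \<in> V" "\<rho> \<in> V" "separates \<sigma> {i, j} {k, l}" "separates \<rho> {k, j} {i, l}"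
    unfolding ring_relations_def by blast
  then show ?thesis
  proof cases
    case 1
    have "(\<Sum>\<rho>\<in>{\<rho> \<in> V. separates \<rho> X Y}. evaluate (var \<rho>) x) - (\<Sum>\<rho>\<in>{\<rho> \<in> V. separates \<rho> X Y}. A \<rho> x) \<in> J" for X Y
      unfolding sum_subtractf[symmetric] by (rule J.sum) (simp add: evaluate_var[OF x])
    from J.diff[OF this[of "{i, j}" "{k, l}"] this[of "{k, j}" "{i, l}"]]
    show ?thesis
      unfolding 1(1) linear_relation_def evaluate_diff evaluate_sum
      by (rule diff_trans) (rule A_linear_relation[OF 1(2) x])
  next
    case 2
    have "evaluate (var \<sigma>) (evaluate (var \<rho>) x) - A \<sigma> (evaluate (var \<rho>) x) \<in> J"
      by (rule evaluate_var[OF evaluate_carrier[OF x] 2(2)])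
    moreover have "A \<sigma> (evaluate (var \<rho>) x) - A \<sigma> (A \<rho> x) \<in> J"
      by (rule A_cong[OF 2(2) evaluate_var[OF x 2(3)]])
    ultimately have "evaluate (var \<sigma>) (evaluate (var \<rho>) x) - A \<sigma> (A \<rho> x) \<in> J" by (rule J.trans)
    from J.trans[OF evaluate_mult[OF carrier_R_var[OF 2(2)] x, of "var \<rho>"] this]
    show ?thesis
      using A_incompatible[OF 2(2,3) separates_incompatible[OF 2(4,2,5,3)] x] unfolding 2(1) by simp
  qed
qed

text \<open>The polynomials that send all chains into \<open>J\<close> form an ideal, because
  products act by composition modulo \<open>J\<close> and evaluation preserves
  \<open>J\<close>.\<close>

lemma I_evaluate:
  assumes p: "p \<in> I" and x: "x \<in> carrier M"
  shows "evaluate p x \<in> J"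
proof -
  let ?H = "{p \<in> carrier R. \<forall>x\<in>carrier M. evaluate p x \<in> J}"
  have "ideal ?H R"
  proof (rule idealI[OF R_ring])
    show "subgroup ?H (add_monoid R)"
    proof (rule subgroup.intro)
      show "inv\<^bsub>add_monoid R\<^esub> q \<in> ?H" if "q \<in> ?H" for q
      proof -
        have "inv\<^bsub>add_monoid R\<^esub> q = - q" using R_minus[of q] that by (simp add: a_inv_def)
        then show ?thesis using that by (simp add: carrier_R_minus evaluate_minus J.minus)
      qed
    qed (auto simp: carrier_R_zero carrier_R_add evaluate_add evaluate_zero J.zero J.add)
    fix a q assume a: "a \<in> ?H" and q: "q \<in> carrier R"
    have "evaluate (q * a) x \<in> J" if x: "x \<in> carrier M" for x
      using J.add[OF evaluate_mult[OF q x, of a] evaluate_J[of "evaluate a x" q]] a x by simp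
    then show "q \<otimes>\<^bsub>R\<^esub> a \<in> ?H" "a \<otimes>\<^bsub>R\<^esub> q \<in> ?H"
      using a q carrier_R_mult by (auto simp: mult.commute)
  qed
  moreover have "ring_relations S W \<subseteq> ?H" using relations_R relations_evaluate by blast
  ultimately have "I \<subseteq> ?H" unfolding ring_ideal_def by (rule ring.genideal_minimal[OF R_ring])
  then show ?thesis using p x by blast
qed

section \<open>Passage to the quotients\<close>

abbreviation coh :: "('a, 'k) poly \<Rightarrow> ('a, 'k) poly set" where "coh \<equiv> coh_class S W"
abbreviation hom :: "('a, 'k) chain \<Rightarrow> ('a, 'k) chain set" where "hom \<equiv> hom_class S W"
abbreviation coho :: "('a, 'k) poly set ring" where "coho \<equiv> cohomology S W"
abbreviation homo :: "('k, ('a, 'k) chain set) module" where "homo \<equiv> homology S W"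

lemma hom_image: "hom x = (\<lambda>n. n + x) ` J"
  by (simp add: hom_class_def a_r_coset_plus)

lemma hom_eq_iff: "hom x = hom y \<longleftrightarrow> x - y \<in> J"
proof
  assume "hom x = hom y"
  moreover have "x \<in> hom x" unfolding hom_image using J.zero by (intro image_eqI[of _ _ 0]) simp_all
  ultimately obtain n where "n \<in> J" "x = n + y" unfolding hom_image by auto
  then show "x - y \<in> J" by simp
next
  have sub: "hom x \<subseteq> hom y" if "x - y \<in> J" for x y
  proof
    fix z assume "z \<in> hom x"
    then obtain n where n: "n \<in> J" "z = n + x" unfolding hom_image by auto
    then have "z = (n + (x - y)) + y" by simp
    moreover have "n + (x - y) \<in> J" using n that J.add by blast
    ultimately show "z \<in> hom y" unfolding hom_image by blast
  qed
  assume "x - y \<in> J"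
  then show "hom x = hom y" using sub[of x y] sub[of y x] J.sym by blast
qed

lemma homo_simps:
  shows carrier_homo: "carrier homo = hom ` carrier M"
    and add_homo: "hom x \<oplus>\<^bsub>homo\<^esub> hom y = hom (x + y)"
    and zero_homo: "\<zero>\<^bsub>homo\<^esub> = hom 0"
    and smult_homo: "c \<odot>\<^bsub>homo\<^esub> hom x = hom (scale c x)"
proof -
  show "carrier homo = hom ` carrier M"
    unfolding homology_def quotient_module_def
    by (auto simp: A_RCOSETS_def RCOSETS_def hom_class_def a_r_coset_def)
  show "\<zero>\<^bsub>homo\<^esub> = hom 0"
    by (simp add: homology_def quotient_module_def hom_image)
  have "hom x \<oplus>\<^bsub>homo\<^esub> hom y = {a + b | a b. a \<in> hom x \<and> b \<in> hom y}"
    by (auto simp: homology_def quotient_module_def set_add_def set_mult_def)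
  also have "\<dots> = hom (x + y)"
  proof (intro equalityI subsetI)
    fix z assume "z \<in> {a + b | a b. a \<in> hom x \<and> b \<in> hom y}"
    then obtain n n' where n: "n \<in> J" "n' \<in> J" "z = (n + x) + (n' + y)" unfolding hom_image by auto
    then have "z = (n + n') + (x + y)" by simp
    then show "z \<in> hom (x + y)" unfolding hom_image using J.add[OF n(1,2)] by blast
  next
    fix z assume "z \<in> hom (x + y)"
    then obtain n where n: "n \<in> J" "z = (n + x) + (0 + y)" unfolding hom_image by (auto simp: add.assoc)
    then show "z \<in> {a + b | a b. a \<in> hom x \<and> b \<in> hom y}" unfolding hom_image using J.zero by blast
  qed
  finally show "hom x \<oplus>\<^bsub>homo\<^esub> hom y = hom (x + y)" .
  have "hom (scale c y) = hom (scale c x)" if y: "y \<in> hom x" for y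
  proof -
    obtain n where "n \<in> J" "y = n + x" using y unfolding hom_image by auto
    then have "scale c y - scale c x \<in> J" using J.scale by (simp add: scale_distribs)
    then show ?thesis by (simp add: hom_eq_iff)
  qed
  moreover have "x \<in> hom x" unfolding hom_image using J.zero by (intro image_eqI[of _ _ 0]) simp_all
  moreover have "c \<odot>\<^bsub>homo\<^esub> hom x = (\<Union>y\<in>hom x. hom (scale c y))"
    by (simp add: homology_def quotient_module_def hom_class_def)
  ultimately show "c \<odot>\<^bsub>homo\<^esub> hom x = hom (scale c x)" by blast
qed

lemma coho_simps:
  shows carrier_coho: "carrier coho = coh ` carrier R"
    and one_coho: "\<one>\<^bsub>coho\<^esub> = coh (const 1)"
    and add_coho: "p \<in> carrier R \<Longrightarrow> q \<in> carrier R \<Longrightarrow> coh p \<oplus>\<^bsub>coho\<^esub> coh q = coh (p + q)"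
    and mult_coho: "p \<in> carrier R \<Longrightarrow> q \<in> carrier R \<Longrightarrow> coh p \<otimes>\<^bsub>coho\<^esub> coh q = coh (p * q)"
proof -
  show "carrier coho = coh ` carrier R"
    unfolding cohomology_def FactRing_def
    by (auto simp: A_RCOSETS_def RCOSETS_def coh_class_def a_r_coset_def)
  show "\<one>\<^bsub>coho\<^esub> = coh (const 1)"
    by (simp add: cohomology_def FactRing_def coh_class_def)
  show "coh p \<oplus>\<^bsub>coho\<^esub> coh q = coh (p + q)" if "p \<in> carrier R" "q \<in> carrier R"
    using abelian_subgroup.a_rcos_sum[OF abelian_subgroupI3[OF ideal.axioms(1)[OF I_ideal]
          ring.is_abelian_group[OF R_ring]]] that
    by (simp add: cohomology_def FactRing_def coh_class_def)
  show "coh p \<otimes>\<^bsub>coho\<^esub> coh q = coh (p * q)" if "p \<in> carrier R" "q \<in> carrier R"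
    using ideal.rcoset_mult_add[OF I_ideal that]
    by (simp add: cohomology_def FactRing_def coh_class_def)
qed

lemma coho_cring: "cring coho"
  unfolding cohomology_def by (rule ideal.quotient_is_cring[OF I_ideal R_cring])

lemma coh_eqD:
  assumes "coh p = coh q" shows "p - q \<in> I"
proof -
  have i: "coh p = (\<lambda>n. n + p) ` I" for p by (simp add: coh_class_def a_r_coset_plus)
  have "0 \<in> I" using additive_subgroup.zero_closed[OF ideal.axioms(1)[OF I_ideal]] by simp
  then have "p \<in> coh p" unfolding i by (intro image_eqI[of _ _ 0]) simp_all
  then have "p \<in> coh q" by (simp only: assms)
  then obtain n where "n \<in> I" "p = n + q" unfolding i by auto
  then show ?thesis by simp
qed

text \<open>Evaluation on chosen representatives; \<open>action_class\<close> shows that any others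
  give the same class.\<close>

definition action :: "('a, 'k) poly set \<Rightarrow> ('a, 'k) chain set \<Rightarrow> ('a, 'k) chain set" where
  "action a X = hom (evaluate (SOME p. p \<in> carrier R \<and> coh p = a) (SOME x. x \<in> carrier M \<and> hom x = X))"

lemma action_class:
  assumes p: "p \<in> carrier R" and x: "x \<in> carrier M"
  shows "action (coh p) (hom x) = hom (evaluate p x)"
proof -
  define p' where "p' = (SOME q. q \<in> carrier R \<and> coh q = coh p)"
  define x' where "x' = (SOME y. y \<in> carrier M \<and> hom y = hom x)"
  have p': "p' \<in> carrier R \<and> coh p' = coh p" unfolding p'_def by (rule someI[of _ p]) (use p in simp)
  have x': "x' \<in> carrier M \<and> hom x' = hom x" unfolding x'_def by (rule someI[of _ x]) (use x in simp)
  have "evaluate (p' - p) x' \<in> J" using I_evaluate coh_eqD p' x' by blast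
  then have "evaluate p' x' - evaluate p x' \<in> J" by (simp add: evaluate_diff)
  moreover have "evaluate p (x' - x) \<in> J" using evaluate_J x' hom_eq_iff by blast
  then have "evaluate p x' - evaluate p x \<in> J" by (simp add: linear_operator.diff[OF evaluate_linear])
  ultimately have "evaluate p' x' - evaluate p x \<in> J" by (rule J.trans)
  then have "hom (evaluate p' x') = hom (evaluate p x)" by (simp only: hom_eq_iff)
  then show ?thesis unfolding action_def p'_def x'_def .
qed

lemma hom_evaluate_mult:
  "p \<in> carrier R \<Longrightarrow> x \<in> carrier M \<Longrightarrow> hom (evaluate (p * q) x) = hom (evaluate p (evaluate q x))"
  unfolding hom_eq_iff by (rule evaluate_mult)

lemma replace_simps [simp]:
  "carrier (replace_smult G f) = carrier G" "add (replace_smult G f) = add G"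
  "zero (replace_smult G f) = zero G" "smult (replace_smult G f) = f"
  by (simp_all add: replace_smult_def)

lemma action_module: "module coho (replace_smult homo action)"
proof (rule moduleI[OF coho_cring])
  show "abelian_group (replace_smult homo action)"
  proof (rule abelian_groupI; clarsimp simp: carrier_homo add_homo zero_homo)
    fix x assume "x \<in> carrier M"
    then show "\<exists>y\<in>carrier M. hom (y + x) = hom 0" by (intro bexI[of _ "- x"]) (simp_all add: carrier.minus)
  qed (auto simp: carrier.add carrier.zero ac_simps)
qed (auto simp: carrier_homo carrier_coho action_class add_homo add_coho mult_coho one_coho
    evaluate_carrier carrier_R_add carrier_R_mult carrier_R_const evaluate_add evaluate_const carrier.add
    linear_operator.add[OF evaluate_linear] hom_evaluate_mult)

lemma mu_carrier: "\<tau> \<in> stable_trees S W \<Longrightarrow> mu S W \<tau> \<in> carrier M"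
  by (simp add: mu_basis carrier_basis splits_family)

lemma action_induced: "induced_action S W action"
  unfolding induced_action_def
proof (intro conjI allI ballI impI)
  fix c and X assume "X \<in> carrier homo"
  then show "action (coh (const c)) X = c \<odot>\<^bsub>homo\<^esub> X"
    by (auto simp: carrier_homo action_class carrier_R_const evaluate_const smult_homo)
next
  fix \<sigma> \<tau> and x :: "('a, 'k) chain"
  assume a: "\<sigma> \<in> V" "\<tau> \<in> stable_trees S W" "prescribed S W \<sigma> \<tau> x"
  have "evaluate (var \<sigma>) (mu S W \<tau>) - x \<in> J"
    using J.trans[OF evaluate_var[OF mu_carrier[OF a(2)] a(1)] J.sym] prescribed_A[OF a] by blast
  then show "action (coh (var \<sigma>)) (hom (mu S W \<tau>)) = hom x"
    by (simp add: action_class carrier_R_var a(1) mu_carrier a(2) hom_eq_iff)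
qed (rule action_module)

text \<open>The uniqueness of the action: the prescription, which has a value in every case, fixes
  the variables on trees, \<open>const\<close> fixes the scalars, and the module axioms propagate
  this to all chains and polynomials.\<close>

lemma induced_action_evaluate:
  assumes act: "induced_action S W act" and p: "p \<in> carrier R"
  shows "x \<in> carrier M \<Longrightarrow> act (coh p) (hom x) = hom (evaluate p x)"
proof -
  let ?H = "replace_smult homo act"
  interpret module coho ?H using act by (simp add: induced_action_def)
  have cst: "act (coh (const c)) (hom x) = hom (scale c x)" if "x \<in> carrier M" for c x
    using act that by (simp add: induced_action_def carrier_homo smult_homo)
  have add_l: "act (coh (p + q)) (hom x) = act (coh p) (hom x) \<oplus>\<^bsub>homo\<^esub> act (coh q) (hom x)"
    if "p \<in> carrier R" "q \<in> carrier R" "x \<in> carrier M" for p q x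
    using smult_l_distr[of "coh p" "coh q" "hom x"] that by (simp add: carrier_coho carrier_homo add_coho)
  have add_r: "act (coh p) (hom (x + y)) = act (coh p) (hom x) \<oplus>\<^bsub>homo\<^esub> act (coh p) (hom y)"
    if "p \<in> carrier R" "x \<in> carrier M" "y \<in> carrier M" for p x y
    using smult_r_distr[of "coh p" "hom x" "hom y"] that by (simp add: carrier_coho carrier_homo add_homo)
  have mult: "act (coh (p * q)) (hom x) = act (coh p) (act (coh q) (hom x))"
    if "p \<in> carrier R" "q \<in> carrier R" "x \<in> carrier M" for p q x
    using smult_assoc1[of "coh p" "coh q" "hom x"] that by (simp add: carrier_coho carrier_homo mult_coho)
  have var: "act (coh (var \<sigma>)) (hom x) = hom (A \<sigma> x)" if \<sigma>: "\<sigma> \<in> V" and x: "x \<in> carrier M" for \<sigma> x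
  proof -
    have v: "var \<sigma> \<in> carrier R" by (rule carrier_R_var[OF \<sigma>])
    have "x \<in> carrier M \<and> act (coh (var \<sigma>)) (hom x) = hom (A \<sigma> x)"
      using x
    proof (induction rule: carrier_induct)
      case (basis T)
      obtain \<tau> where \<tau>: "\<tau> \<in> stable_trees S W" "splits S \<tau> = T" using family_tree[OF basis] by blast
      obtain y :: "('a, 'k) chain" where y: "prescribed S W \<sigma> \<tau> y" using prescribed_exists[OF \<sigma> \<tau>(1)] by blast
      have "act (coh (var \<sigma>)) (hom (mu S W \<tau>)) = hom y"
        using act \<sigma> \<tau>(1) y by (simp add: induced_action_def)
      then show ?case
        using prescribed_A[OF \<sigma> \<tau>(1) y] carrier_basis[OF basis] by (simp add: mu_basis[OF \<tau>(1)] \<tau>(2) hom_eq_iff)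
    next
      case zero
      have "scale 0 0 = (0 :: ('a, 'k) chain)" by simp
      have "act (coh (var \<sigma>)) \<zero>\<^bsub>?H\<^esub> = \<zero>\<^bsub>?H\<^esub>"
        using smult_r_null[of "coh (var \<sigma>)"] v by (simp add: carrier_coho)
      then show ?case by (simp add: zero_homo carrier_zero)
    next
      case (add x y)
      then show ?case using v by (simp add: add_r add_homo fan.op.add carrier_add)
    next
      case (scale c x)
      \<comment> \<open>That the variable acts linearly over the ground ring follows by commuting it
        with \<open>const c\<close> in the cohomology ring.\<close>
      have "act (coh (var \<sigma>)) (hom (scale c x)) = act (coh (var \<sigma> * const c)) (hom x)"
        using scale v by (simp add: mult cst carrier_R_const)
      also have "\<dots> = act (coh (const c * var \<sigma>)) (hom x)" by (simp add: mult.commute)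
      also have "\<dots> = hom (scale c (A \<sigma> x))" using scale v by (simp add: mult cst carrier_R_const A_carrier)
      finally show ?case using scale by (simp add: fan.op.scale carrier_scale)
    qed
    then show ?thesis by simp
  qed
  have mono: "act (coh (Poly_Mapping.single m 1)) (hom x) = hom (monomial m x)"
    if m: "Poly_Mapping.keys m \<subseteq> V" and x: "x \<in> carrier M" for m x
    using finite_partitions m
  proof (induction m rule: monomial_induct)
    case one
    show ?case using cst[OF x, of 1] by (simp add: const_def)
  next
    case (step m \<sigma>)
    have m: "Poly_Mapping.single m (1 :: 'k) \<in> carrier R"
      using step(2) by (cases "(1 :: 'k) = 0") (auto simp: carrier_R)
    have "Poly_Mapping.single (m + Poly_Mapping.single \<sigma> 1) (1 :: 'k) = var \<sigma> * Poly_Mapping.single m 1"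
      by (simp add: var_def mult_single add.commute)
    then have "act (coh (Poly_Mapping.single (m + Poly_Mapping.single \<sigma> 1) 1)) (hom x) = hom (A \<sigma> (monomial m x))"
      using step m x by (simp only: mult[OF carrier_R_var[OF step(1)] m x] step(3) var[OF step(1) monomial_carrier[OF x]])
    also have "\<dots> = hom (monomial (m + Poly_Mapping.single \<sigma> 1) x)"
      using J.sym[OF monomial_step[OF x step(1), of m]] by (simp add: hom_eq_iff)
    finally show ?case .
  qed
  have "p \<in> carrier R \<and> (\<forall>x\<in>carrier M. act (coh p) (hom x) = hom (evaluate p x))"
  proof (induction p rule: single_induct)
    case zero
    have "const 0 = (0 :: ('a, 'k) poly)" by (simp add: const_def)
    then show ?case using cst[of _ 0] by (simp add: carrier_R_zero evaluate_zero)
  next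
    case (single m c)
    have m: "Poly_Mapping.keys m \<subseteq> V" using p single by (simp add: carrier_R)
    have s: "Poly_Mapping.single m d \<in> carrier R" for d :: 'k
      using m by (cases "d = 0") (auto simp: carrier_R)
    have eq: "Poly_Mapping.single m c = const c * Poly_Mapping.single m 1"
      by (simp add: const_def mult_single)
    have "act (coh (Poly_Mapping.single m c)) (hom x) = hom (evaluate (Poly_Mapping.single m c) x)"
      if x: "x \<in> carrier M" for x
      unfolding evaluate_single unfolding eq
      by (simp only: mult[OF carrier_R_const s x] mono[OF m x] cst[OF monomial_carrier[OF x]])
    then show ?case using s by blast
  next
    case (add p q)
    then show ?case by (simp add: carrier_R_add add_l evaluate_add add_homo)
  qed
  then show "x \<in> carrier M \<Longrightarrow> act (coh p) (hom x) = hom (evaluate p x)" by blast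
qed

lemma action_theorem:
  "(\<forall>\<sigma> \<in> V. \<forall>\<tau> \<in> stable_trees S W.
      (\<exists>x :: ('a, 'k) chain. prescribed S W \<sigma> \<tau> x) \<and>
      (\<forall>x y :: ('a, 'k) chain. prescribed S W \<sigma> \<tau> x \<longrightarrow> prescribed S W \<sigma> \<tau> y \<longrightarrow> hom x = hom y)) \<and>
   (\<exists>act. induced_action S W act \<and>
      (\<forall>act'. induced_action S W act' \<longrightarrow> (\<forall>a \<in> carrier coho. \<forall>X \<in> carrier homo. act' a X = act a X)))"
proof (intro conjI ballI allI impI exI[of _ action])
  fix \<sigma> \<tau> assume s: "\<sigma> \<in> V" "\<tau> \<in> stable_trees S W"
  show "\<exists>x :: ('a, 'k) chain. prescribed S W \<sigma> \<tau> x" by (rule prescribed_exists[OF s])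
  fix x y :: "('a, 'k) chain" assume "prescribed S W \<sigma> \<tau> x" "prescribed S W \<sigma> \<tau> y"
  then show "hom x = hom y"
    using prescribed_A[OF s] J.trans J.sym unfolding hom_eq_iff by blast
next
  fix act' :: "('a, 'k) poly set \<Rightarrow> ('a, 'k) chain set \<Rightarrow> ('a, 'k) chain set" and a X
  assume act': "induced_action S W act'" and a: "a \<in> carrier coho" and X: "X \<in> carrier homo"
  then show "act' a X = action a X"
    using induced_action_evaluate[OF act'] by (auto simp: carrier_coho carrier_homo action_class)
qed (rule action_induced)

end

theorem theorem2p3:
  fixes S W :: "'a set"
  assumes "finite S" and "W \<subseteq> S" and "3 \<le> card S" and "2 \<le> card W"
  shows
    "(\<forall>\<sigma> \<in> stable_partitions S W. \<forall>\<tau> \<in> stable_trees S W.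
        (\<exists>x :: ('a, 'k::{comm_ring,comm_monoid_mult}) chain. prescribed S W \<sigma> \<tau> x) \<and>
        (\<forall>x y :: ('a, 'k) chain. prescribed S W \<sigma> \<tau> x \<longrightarrow> prescribed S W \<sigma> \<tau> y \<longrightarrow>
           hom_class S W x = hom_class S W y)) \<and>
     (\<exists>act :: ('a, 'k) poly set \<Rightarrow> ('a, 'k) chain set \<Rightarrow> ('a, 'k) chain set.
        induced_action S W act \<and>
        (\<forall>act'. induced_action S W act' \<longrightarrow>
           (\<forall>a \<in> carrier (cohomology S W).
            \<forall>X \<in> carrier (homology S W :: ('k, ('a, 'k) chain set) module).
              act' a X = act a X)))"
proof -
  interpret tree_homology S W "TYPE('k)" using assms by unfold_locales
  show ?thesis by (rule action_theorem)
qed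

end
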